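(* Fix $H\in(\frac12,1)$ and let $B$ be a $d$-dimensional fractional Brownian motion with Hurst parameter $H$. Let $V_0,V_1,\dots,V_d$ be vector fields on $\mathbb{R}^d$ satisfying the geometric hypothesis (G) stated in the context, let $x\in\mathbb{R}^d$, and let $X^x$ be the solution of $$X^x_t=x+\int_0^t V_0(X^x_s)\,ds+\sum_{i=1}^d\int_0^t V_i(X^x_s)\,dB^i_s .$$ Then there exist constants $C$ and $M$ such that for every $T>0$ and $\lambda\ge0$, $$\mathbb{P}\left(\sup_{0\le t\le T}|X^x_t|-\mathbb{E}\Big(\sup_{0\le t\le T}|X^x_t|\Big)\ge\lambda\right)\le\exp\left(-\frac{\lambda^2}{2M^2e^{2CT}T^{2H}}\right).$$
   Context: A $d$-dimensional fractional Brownian motion (fBm) with Hurst parameter $H$ is a centered Gaussian process $B=(B^1,\dots,B^d)$ with independent coordinates, $B_0=0$ and $\mathbb{E}[(B^j_t-B^j_s)^2]=|t-s|^{2H}$. For $H>\frac12$ the equation is understood pathwise, the integrals with respect to $B$ being Young integrals. Hypothesis (G): the vector fields $V_0,\dots,V_d$ on $\mathbb{R}^d$ are $C^\infty$-bounded (smooth, bounded, with bounded derivatives of all orders), and (i) for every $x\in\mathbb{R}^d$ the vectors $V_1(x),\dots,V_d(x)$ form a basis of $\mathbb{R}^d$; (ii) there exist smooth bounded functions $\omega_{ij}^k$ ($1\le i,j,k\le d$) such that $[V_i,V_j]=\sum_{k=1}^d\omega_{ij}^kV_k$ and $\omega_{ij}^k=-\omega_{ik}^j$. $|\cdot|$ is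 the Euclidean norm. *)

theory Defs
  imports "HOL-Probability.Probability"
begin

section \<open>Smooth functions and the geometric hypothesis\<close>

primrec iterated_derivative ::
  "'a::real_normed_vector list \<Rightarrow> ('a \<Rightarrow> 'b::real_normed_vector) \<Rightarrow> 'a \<Rightarrow> 'b" where
  "iterated_derivative [] f = f"
| "iterated_derivative (v # vs) f =
     (\<lambda>x. frechet_derivative (iterated_derivative vs f) (at x) v)"

definition smooth :: "('a::real_normed_vector \<Rightarrow> 'b::real_normed_vector) \<Rightarrow> bool" where
  "smooth f \<longleftrightarrow> (\<forall>vs x. iterated_derivative vs f differentiable (at x))"

text \<open>The empty list of directions makes \<open>f\<close> itself bounded. In finite dimension, boundedness
  for each fixed list of directions is boundedness of every derivative as a multilinear map.\<close>

definition smooth_bounded :: "('a::euclidean_space \<Rightarrow> 'b::real_normed_vector) \<Rightarrow> bool" where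
  "smooth_bounded f \<longleftrightarrow> smooth f \<and> (\<forall>vs. bounded (range (iterated_derivative vs f)))"

definition lie_bracket ::
  "('a::real_normed_vector \<Rightarrow> 'a) \<Rightarrow> ('a \<Rightarrow> 'a) \<Rightarrow> 'a \<Rightarrow> 'a" where
  "lie_bracket V W x =
     frechet_derivative W (at x) (V x) - frechet_derivative V (at x) (W x)"

text \<open>The drift field \<open>V\<^sub>0\<close> is kept separate from the fields \<open>V\<^sub>1, \<dots>, V\<^sub>d\<close>, which are indexed
  by the coordinate type; \<open>\<omega> i j k\<close> stands for \<open>\<omega>\<^sub>i\<^sub>j\<^sup>k\<close>. Of the functions \<open>\<omega> i j k\<close> themselves only
  smoothness and boundedness is required, not boundedness of their derivatives.\<close>

definition geometric_hypothesis ::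
  "(real^'d \<Rightarrow> real^'d) \<Rightarrow> ('d::finite \<Rightarrow> real^'d \<Rightarrow> real^'d) \<Rightarrow> bool" where
  "geometric_hypothesis V0 V \<longleftrightarrow>
     smooth_bounded V0 \<and> (\<forall>i. smooth_bounded (V i)) \<and>
     (\<forall>x. inj (\<lambda>i. V i x) \<and> independent (range (\<lambda>i. V i x)) \<and>
          span (range (\<lambda>i. V i x)) = UNIV) \<and>
     (\<exists>\<omega> :: 'd \<Rightarrow> 'd \<Rightarrow> 'd \<Rightarrow> real^'d \<Rightarrow> real.
        (\<forall>i j k. smooth (\<omega> i j k) \<and> bounded (range (\<omega> i j k))) \<and>
        (\<forall>i j x. lie_bracket (V i) (V j) x = (\<Sum>k\<in>UNIV. \<omega> i j k x *\<^sub>R V k x)) \<and>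
        (\<forall>i j k x. \<omega> i j k x = - \<omega> i k j x))"

section \<open>Fractional Brownian motion\<close>

text \<open>Constants count as (degenerate) Gaussian variables.\<close>

definition gaussian_variable :: "'w measure \<Rightarrow> ('w \<Rightarrow> real) \<Rightarrow> bool" where
  "gaussian_variable P Y \<longleftrightarrow> Y \<in> borel_measurable P \<and>
     (\<exists>m. (AE w in P. Y w = m) \<or> (\<exists>\<sigma>>0. distributed P lborel Y (normal_density m \<sigma>)))"

text \<open>Processes are indexed by time \<open>t \<ge> 0\<close>; their values at negative times are irrelevant.\<close>

definition gaussian_process :: "'w measure \<Rightarrow> (real \<Rightarrow> 'w \<Rightarrow> real^'d) \<Rightarrow> bool" where
  "gaussian_process P B \<longleftrightarrow>
     (\<forall>F (a :: real \<Rightarrow> real^'d). finite F \<and> F \<subseteq> {0..} \<longrightarrow>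
        gaussian_variable P (\<lambda>w. \<Sum>t\<in>F. a t \<bullet> B t w))"

text \<open>Independence of the coordinates is independence of the whole coordinate paths, as random
  elements of the product space of real functions on the time axis.\<close>

definition fractional_brownian_motion ::
  "'w measure \<Rightarrow> real \<Rightarrow> (real \<Rightarrow> 'w \<Rightarrow> real^'d) \<Rightarrow> bool" where
  "fractional_brownian_motion P H B \<longleftrightarrow>
     prob_space P \<and>
     gaussian_process P B \<and>
     (\<forall>t\<ge>0. \<forall>j. prob_space.expectation P (\<lambda>w. B t w $ j) = 0) \<and>
     prob_space.indep_vars P (\<lambda>j. PiM {0..} (\<lambda>t. borel))
       (\<lambda>j w. \<lambda>t\<in>{0..}. B t w $ j) UNIV \<and>
     (AE w in P. B 0 w = 0) \<and>
     (\<forall>s\<ge>0. \<forall>t\<ge>0. \<forall>j.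
        prob_space.expectation P (\<lambda>w. (B t w $ j - B s w $ j)\<^sup>2) = \<bar>t - s\<bar> powr (2 * H))"

section \<open>Young integrals and the differential equation\<close>

definition holder_on :: "real set \<Rightarrow> real \<Rightarrow> (real \<Rightarrow> 'a::real_normed_vector) \<Rightarrow> bool" where
  "holder_on S \<alpha> f \<longleftrightarrow> (\<exists>K. \<forall>s\<in>S. \<forall>t\<in>S. norm (f t - f s) \<le> K * \<bar>t - s\<bar> powr \<alpha>)"

text \<open>The Young integral of \<open>f\<close> against \<open>g\<close> over \<open>[a,b]\<close>: \<open>f\<close> and \<open>g\<close> are Hoelder continuous with
  exponents adding up to more than 1, and the integral is the limit of the Riemann--Stieltjes
  sums as the mesh tends to 0. The gauge is constant, in contrast to the Henstock--Kurzweil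
  integral.\<close>

definition has_young_integral ::
  "(real \<Rightarrow> 'a::real_normed_vector) \<Rightarrow> (real \<Rightarrow> real) \<Rightarrow> real \<Rightarrow> real \<Rightarrow> 'a \<Rightarrow> bool" where
  "has_young_integral f g a b I \<longleftrightarrow>
     (\<exists>\<alpha>\<in>{0<..1}. \<exists>\<beta>\<in>{0<..1}. \<alpha> + \<beta> > 1 \<and> holder_on {a..b} \<alpha> f \<and> holder_on {a..b} \<beta> g) \<and>
     (\<forall>e>0. \<exists>\<delta>>0. \<forall>p. p tagged_division_of {a..b} \<and> (\<lambda>s. ball s \<delta>) fine p \<longrightarrow>
        norm ((\<Sum>(s, K)\<in>p. (g (Sup K) - g (Inf K)) *\<^sub>R f s) - I) < e)"

definition young_integrable ::
  "(real \<Rightarrow> 'a::real_normed_vector) \<Rightarrow> (real \<Rightarrow> real) \<Rightarrow> real \<Rightarrow> real \<Rightarrow> bool" where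
  "young_integrable f g a b \<longleftrightarrow> (\<exists>I. has_young_integral f g a b I)"

definition young_integral ::
  "(real \<Rightarrow> 'a::real_normed_vector) \<Rightarrow> (real \<Rightarrow> real) \<Rightarrow> real \<Rightarrow> real \<Rightarrow> 'a" where
  "young_integral f g a b = (THE I. has_young_integral f g a b I)"

text \<open>The equation is required almost surely, for all times simultaneously. All paths of \<open>X\<close> are
  taken continuous (not only almost all), so that running suprema of \<open>X\<close> are random variables
  even if the probability space is not complete. No path regularity of \<open>B\<close> is assumed separately:
  almost sure Hoelder continuity of \<open>B\<close> is part of Young integrability.\<close>

definition young_sde_solution ::
  "'w measure \<Rightarrow> (real^'d \<Rightarrow> real^'d) \<Rightarrow> ('d::finite \<Rightarrow> real^'d \<Rightarrow> real^'d) \<Rightarrow>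
   (real \<Rightarrow> 'w \<Rightarrow> real^'d) \<Rightarrow> real^'d \<Rightarrow> (real \<Rightarrow> 'w \<Rightarrow> real^'d) \<Rightarrow> bool" where
  "young_sde_solution P V0 V B x X \<longleftrightarrow>
     (\<forall>t\<ge>0. X t \<in> borel_measurable P) \<and>
     (\<forall>w\<in>space P. continuous_on {0..} (\<lambda>t. X t w)) \<and>
     (AE w in P. \<forall>t\<ge>0.
        (\<forall>i. young_integrable (\<lambda>s. V i (X s w)) (\<lambda>s. B s w $ i) 0 t) \<and>
        X t w = x + integral {0..t} (\<lambda>s. V0 (X s w))
          + (\<Sum>i\<in>UNIV. young_integral (\<lambda>s. V i (X s w)) (\<lambda>s. B s w $ i) 0 t))"

end

theory Submission
  imports Defs
begin

text \<open>Since \<open>C\<close> and \<open>M\<close> are free, it suffices to bound \<open>E exp (Z\<^sup>2 / \<tau>\<^sup>2)\<close> by an absolute constant, where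
  \<open>Z = sup |X| - |x|\<close> and \<open>\<tau> = D exp (3 T) T powr H\<close>: centring such a variable costs only a constant
  factor in \<open>\<tau>\<close>. Fix an exponent \<open>\<gamma>\<close> between \<open>1/2\<close> and \<open>H\<close> and split the increments of \<open>B\<close> over a uniform
  grid into those of a discrete \<open>\<gamma>\<close>-Hoelder path with constant \<open>a\<close> of order \<open>T powr H\<close> and a remainder
  \<open>h\<close>. Young's argument of removing partition points, applied to blocks on which time plus the variation
  of \<open>h\<close> is small, bounds \<open>|X - x|\<close> by a constant times \<open>exp (3 T) (T powr H + |h|)\<close> with the
  \<open>\<ell>\<^sup>1\<close> norm of \<open>h\<close>; the linear growth in \<open>h\<close> is what makes the tails Gaussian. Indeed, the
  \<open>\<ell>\<^sup>1\<close> distance \<open>\<Phi>\<close> of the increments to the set \<open>A\<close> of Hoelder ones satisfies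
  \<open>E exp (\<Phi>\<^sup>2 / (4 \<sigma>\<^sup>2)) P(A) \<le> 1\<close> by Maurey's property \<open>(\<tau>)\<close>, with \<open>\<sigma> = d T powr H\<close> because the
  increments are positively correlated for \<open>H > 1/2\<close>, and \<open>P(A) \<ge> 1/2\<close> by dyadic chaining. Refining
  the grid and Fatou's lemma conclude.\<close>

text \<open>The usual Young estimate for bounded fields grows like the Hoelder constant to the power
  \<open>1 / \<gamma>\<close>, and an exponent above 1 is too large for a Gaussian tail. So the part
  of the driver treated as rough stays on the scale that it reaches with probability at least 1/2,
  and every excess is charged to the perturbation: a block of the path costs a fixed multiple of
  \<open>a\<close>, and the number of blocks is at most proportional to time plus variation. The
  constants must not depend on the mesh, although the \<open>\<ell>\<^sup>1\<close> norm of the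
  increments does; by duality only variances of signed sums enter, and these stay bounded. The grid
  keeps the Gaussian measure finite-dimensional, so that the transport property follows by induction
  on the dimension. Its price is a Young error of order (T/m)^\<open>\<theta>\<close> with
  \<open>\<theta> > 1\<close> in each of \<open>m\<close> steps. The exponent 3 in
  \<open>\<tau>\<close> arises from the length of the blocks, whose inverse is quadratic in
  \<open>a\<close> and costs \<open>exp (2 * T)\<close>, and from comparing the drift with
  \<open>T powr H\<close>, which costs \<open>exp T\<close>.\<close>

section \<open>Discrete Young estimates\<close>

text \<open>Young's argument: some inner point \<open>l\<close> has \<open>W (l + 1) - W (l - 1) \<le> 2 (W (n + 1) - W 0) / n\<close>;
  removing it changes the sum by at most the corresponding term on the right.\<close>

lemma discrete_sewing_removal:
  fixes \<Xi> :: "nat \<Rightarrow> nat \<Rightarrow> 'a::real_normed_vector" and W :: "nat \<Rightarrow> real"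
  assumes "mono W" and "\<theta> > 0" and "L \<ge> 0"
    and "\<And>a b c. a < b \<Longrightarrow> b < c \<Longrightarrow> c \<le> Suc n \<Longrightarrow>
      norm (\<Xi> a c - \<Xi> a b - \<Xi> b c) \<le> L * (W c - W a) powr \<theta>"
  shows "norm (\<Xi> 0 (Suc n) - (\<Sum>k\<le>n. \<Xi> k (Suc k)))
    \<le> L * (\<Sum>r=1..n. (2 / real r) powr \<theta>) * (W (Suc n) - W 0) powr \<theta>"
  using assms
proof (induction n arbitrary: \<Xi> W)
  case 0
  then show ?case by simp
next
  case (Suc n)
  note mono = \<open>mono W\<close> and \<theta> = \<open>\<theta> > 0\<close> and L = \<open>L \<ge> 0\<close> and germ = Suc.prems(4)
  let ?w = "W (Suc (Suc n)) - W 0"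
  have telescope: "(\<Sum>l=1..N. W (Suc l) - W (l - 1)) = W (Suc N) + W N - W 1 - W 0" for N
    by (induction N) auto
  have "\<exists>l\<in>{1..Suc n}. W (Suc l) - W (l - 1) \<le> 2 * ?w / real (Suc n)"
  proof (rule ccontr)
    assume "\<not> ?thesis"
    then have *: "2 * ?w / real (Suc n) < W (Suc l) - W (l - 1)" if "l \<in> {1..Suc n}" for l
      using that by force
    have "(\<Sum>l=1..Suc n. 2 * ?w / real (Suc n)) < (\<Sum>l=1..Suc n. W (Suc l) - W (l - 1))"
      by (rule sum_strict_mono) (use * in auto)
    also have "\<dots> = W (Suc (Suc n)) + W (Suc n) - W 1 - W 0" by (rule telescope)
    also have "\<dots> \<le> 2 * ?w"
      using monoD[OF mono, of "Suc n" "Suc (Suc n)"] monoD[OF mono, of 0 1] by simp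
    finally show False by (simp add: field_simps del: of_nat_Suc)
  qed
  then obtain l where l: "l \<in> {1..Suc n}" "W (Suc l) - W (l - 1) \<le> 2 * ?w / real (Suc n)" by blast
  \<comment> \<open>The increasing enumeration of the points other than \<open>l\<close>. As
    \<open>l\<close> lies strictly between \<open>0\<close> and \<open>n + 2\<close>, both endpoints
    survive the removal.\<close>
  define \<sigma> where "\<sigma> k = (if k < l then k else Suc k)" for k
  have \<sigma>_less: "\<sigma> a < \<sigma> b" if "a < b" for a b using that unfolding \<sigma>_def by presburger
  have \<sigma>_le: "\<sigma> c \<le> Suc (Suc n)" if "c \<le> Suc n" for c using that unfolding \<sigma>_def by presburger
  have \<sigma>0: "\<sigma> 0 = 0" and \<sigma>n: "\<sigma> (Suc n) = Suc (Suc n)" using l by (auto simp: \<sigma>_def)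
  have "mono (W \<circ> \<sigma>)" unfolding mono_def by (auto simp: \<sigma>_def intro!: monoD[OF mono])
  from Suc.IH[OF this \<theta> L, of "\<lambda>a b. \<Xi> (\<sigma> a) (\<sigma> b)"]
  have IH: "norm (\<Xi> 0 (Suc (Suc n)) - (\<Sum>k\<le>n. \<Xi> (\<sigma> k) (\<sigma> (Suc k))))
      \<le> L * (\<Sum>r=1..n. (2 / real r) powr \<theta>) * ?w powr \<theta>"
    using germ[OF \<sigma>_less \<sigma>_less \<sigma>_le] by (simp add: \<sigma>0 \<sigma>n)
  obtain p where p: "l = Suc p" "p \<le> n" using l by (cases l) auto
  \<comment> \<open>Removing \<open>l = p + 1\<close> replaces the terms of the two intervals that
    meet there by the term of their union and keeps all others. The upper limit is generalised for
    the induction.\<close>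
  have "(\<Sum>k\<le>n. \<Xi> (\<sigma> k) (\<sigma> (Suc k))) + \<Xi> p (Suc p) + \<Xi> (Suc p) (Suc (Suc p)) - \<Xi> p (Suc (Suc p))
      = (\<Sum>k\<le>Suc n. \<Xi> k (Suc k))" if "p \<le> n" for n
    using that
  proof (induction n)
    case 0
    then show ?case by (simp add: \<sigma>_def p)
  next
    case (Suc n)
    show ?case
    proof (cases "p \<le> n")
      case True
      then show ?thesis using Suc by (simp add: \<sigma>_def p algebra_simps)
    next
      case False
      then have "p = Suc n" using Suc.prems by simp
      moreover have "(\<Sum>k\<le>n. \<Xi> (\<sigma> k) (\<sigma> (Suc k))) = (\<Sum>k\<le>n. \<Xi> k (Suc k))"
        by (rule sum.cong) (use False in \<open>auto simp: \<sigma>_def p\<close>)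
      ultimately show ?thesis by (simp add: \<sigma>_def p algebra_simps)
    qed
  qed
  from this[OF \<open>p \<le> n\<close>]
  have eq: "\<Xi> 0 (Suc (Suc n)) - (\<Sum>k\<le>Suc n. \<Xi> k (Suc k))
      = (\<Xi> 0 (Suc (Suc n)) - (\<Sum>k\<le>n. \<Xi> (\<sigma> k) (\<sigma> (Suc k))))
        + (\<Xi> p (Suc (Suc p)) - \<Xi> p (Suc p) - \<Xi> (Suc p) (Suc (Suc p)))"
    by (metis (no_types, lifting) add_diff_cancel_left' add_diff_eq diff_add_eq diff_diff_eq2 diff_diff_eq)
  have "norm (\<Xi> p (Suc (Suc p)) - \<Xi> p (Suc p) - \<Xi> (Suc p) (Suc (Suc p)))
      \<le> L * (W (Suc (Suc p)) - W p) powr \<theta>"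
    by (rule germ) (use p in auto)
  also have "\<dots> \<le> L * (2 * ?w / real (Suc n)) powr \<theta>"
    using l(2) p \<theta> L monoD[OF mono, of p "Suc (Suc p)"] by (intro mult_left_mono powr_mono2) auto
  also have "\<dots> = L * (2 / real (Suc n)) powr \<theta> * ?w powr \<theta>"
    using powr_mult[of "2 / real (Suc n)" ?w \<theta>] monoD[OF mono, of 0 "Suc (Suc n)"]
    by (simp add: mult.assoc)
  finally show ?case
    using IH norm_triangle_ineq[of "\<Xi> 0 (Suc (Suc n)) - (\<Sum>k\<le>n. \<Xi> (\<sigma> k) (\<sigma> (Suc k)))"
        "\<Xi> p (Suc (Suc p)) - \<Xi> p (Suc p) - \<Xi> (Suc p) (Suc (Suc p))"]
    unfolding eq by (simp add: algebra_simps)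
qed

text \<open>For \<open>\<theta> > 1\<close> this is 2 to the power \<open>\<theta>\<close> times the
  Riemann zeta value at \<open>\<theta>\<close>, the total cost of all removals. The term
  \<open>r = 0\<close> contributes nothing, since \<open>0 powr - \<theta> = 0\<close>.\<close>

definition sewing_const :: "real \<Rightarrow> real" where
  "sewing_const \<theta> = 2 powr \<theta> * (\<Sum>r. real r powr - \<theta>)"

lemma sewing_const_nonneg: "sewing_const \<theta> \<ge> 0" if "\<theta> > 1" unfolding sewing_const_def
  using that by (intro mult_nonneg_nonneg suminf_nonneg) (auto simp: summable_real_powr_iff)

text \<open>As \<open>\<theta> > 1\<close>, the removal costs form a convergent series, so the bound
  does not depend on the number of points. This is what later allows the mesh to be refined at no
  loss.\<close>

lemma discrete_sewing:
  fixes \<Xi> :: "nat \<Rightarrow> nat \<Rightarrow> 'a::real_normed_vector" and W :: "nat \<Rightarrow> real"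
  assumes "mono W" and \<theta>: "\<theta> > 1" and L: "L \<ge> 0" and n: "n > 0"
    and "\<And>a b c. a < b \<Longrightarrow> b < c \<Longrightarrow> c \<le> n \<Longrightarrow>
      norm (\<Xi> a c - \<Xi> a b - \<Xi> b c) \<le> L * (W c - W a) powr \<theta>"
  shows "norm (\<Xi> 0 n - (\<Sum>k<n. \<Xi> k (Suc k))) \<le> L * sewing_const \<theta> * (W n - W 0) powr \<theta>"
proof -
  obtain m where m: "n = Suc m" using n by (cases n) auto
  have "norm (\<Xi> 0 n - (\<Sum>k<n. \<Xi> k (Suc k)))
    \<le> L * (\<Sum>r=1..m. (2 / real r) powr \<theta>) * (W n - W 0) powr \<theta>"
    using discrete_sewing_removal[of W \<theta> L m \<Xi>] assms by (simp add: m lessThan_Suc_atMost)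
  also have "(\<Sum>r=1..m. (2 / real r) powr \<theta>) = 2 powr \<theta> * (\<Sum>r=1..m. real r powr - \<theta>)"
    by (simp add: sum_distrib_left powr_divide powr_minus_divide)
  also have "\<dots> \<le> sewing_const \<theta>" unfolding sewing_const_def using \<theta>
    by (intro mult_left_mono sum_le_suminf) (auto simp: summable_real_powr_iff)
  finally show ?thesis using L by (simp add: mult_left_mono mult_right_mono)
qed

text \<open>The perturbation \<open>\<eta>\<close> collects the drift, the bounded variation part of the driver and the
  discretisation error. Rescaling by \<open>a\<close> lets one control \<open>ctrl\<close> handle both drivers.\<close>

locale discrete_equation =
  fixes \<sigma> :: "'a::real_normed_vector \<Rightarrow> 'b::real_normed_vector \<Rightarrow> 'a"
    and y \<eta> :: "nat \<Rightarrow> 'a" and G :: "nat \<Rightarrow> 'b" and v :: "nat \<Rightarrow> real"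
    and A a \<gamma> :: real and m :: nat
  assumes A: "A \<ge> 1" and a: "a > 0" and \<gamma>: "1/2 < \<gamma>" "\<gamma> \<le> 1" and m: "m > 0"
    and diff: "\<And>p u w. \<sigma> p (u - w) = \<sigma> p u - \<sigma> p w"
    and bounded: "\<And>p u. norm (\<sigma> p u) \<le> A * norm u"
    and lipschitz: "\<And>p q u. norm (\<sigma> p u - \<sigma> q u) \<le> A * norm (p - q) * norm u"
    and step: "\<And>k. k < m \<Longrightarrow> y (Suc k) = y k + \<sigma> (y k) (G (Suc k) - G k) + \<eta> k"
    and G: "\<And>i j. i \<le> j \<Longrightarrow> j \<le> m \<Longrightarrow> norm (G j - G i) \<le> a * ((real j - real i) / real m) powr \<gamma>"
    and \<eta>: "\<And>k. k < m \<Longrightarrow> norm (\<eta> k) \<le> v k"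
    and v: "\<And>k. v k \<ge> 0"
begin

definition ctrl :: "nat \<Rightarrow> real" where
  "ctrl k = real k / real m + (\<Sum>l<k. v l) / a"

lemma ctrl_diff: "ctrl j - ctrl i = (real j - real i) / real m + (\<Sum>l=i..<j. v l) / a" if "i \<le> j"
proof -
  have "(\<Sum>l=i..<j. v l) = (\<Sum>l<j. v l) - (\<Sum>l<i. v l)"
    using sum_diff_nat_ivl[of 0 i j v] that by (simp add: lessThan_atLeast0)
  then show ?thesis by (simp add: ctrl_def diff_divide_distrib)
qed

lemma mono_ctrl: "mono ctrl"
  by (rule monoI) (use a v in \<open>auto simp: ctrl_def intro!: add_mono divide_right_mono sum_mono2\<close>)

lemma G_ctrl: "i \<le> j \<Longrightarrow> j \<le> m \<Longrightarrow> norm (G j - G i) \<le> a * (ctrl j - ctrl i) powr \<gamma>"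
  using \<gamma> a v by (intro order_trans[OF G] mult_left_mono powr_mono2)
    (auto simp: ctrl_diff sum_nonneg)

lemma \<eta>_ctrl: "i \<le> j \<Longrightarrow> j \<le> m \<Longrightarrow> norm (\<Sum>k=i..<j. \<eta> k) \<le> a * (ctrl j - ctrl i)"
proof -
  assume "i \<le> j" "j \<le> m"
  have "norm (\<Sum>k=i..<j. \<eta> k) \<le> (\<Sum>k=i..<j. v k)" using \<open>j \<le> m\<close> by (intro sum_norm_le \<eta>) auto
  also have "\<dots> \<le> a * ((real j - real i) / real m) + (\<Sum>k=i..<j. v k)" using a \<open>i \<le> j\<close> by simp
  also have "\<dots> = a * (ctrl j - ctrl i)" using a \<open>i \<le> j\<close> by (simp add: ctrl_diff distrib_left)
  finally show ?thesis .
qed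

lemma increment: "i \<le> j \<Longrightarrow> j \<le> m \<Longrightarrow>
    y j - y i = (\<Sum>k=i..<j. \<sigma> (y k) (G (Suc k) - G k)) + (\<Sum>k=i..<j. \<eta> k)"
proof (induction j rule: dec_induct)
  case (step n)
  then have "y (Suc n) = y n + \<sigma> (y n) (G (Suc n) - G n) + \<eta> n"
    by (intro discrete_equation.step[OF discrete_equation_axioms]) auto
  with step show ?case by (simp add: algebra_simps)
qed simp

text \<open>The summand \<open>A\<close> pays for the first-order term of a block; one unit each
  pays for the sewing remainder and for the perturbation \<open>\<eta>\<close>.\<close>

definition "local_const = A + 2"

text \<open>With \<open>q\<close> for the expression under the square, the threshold must satisfy
  \<open>q * ctrl_threshold powr \<gamma> \<le> 1\<close>. Because \<open>\<gamma> > 1/2\<close>,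
  the value 1 / (1 + q^2) suffices: already its square root times \<open>q\<close> is at most 1. Its
  inverse is a quadratic polynomial in \<open>a\<close>, which is easy to compare with an
  exponential of the time.\<close>

definition "ctrl_threshold = 1 / (1 + (A * local_const * sewing_const (2 * \<gamma>) * a)\<^sup>2)"

lemma ctrl_threshold: "0 < ctrl_threshold" "ctrl_threshold \<le> 1"
    "A * local_const * sewing_const (2 * \<gamma>) * a * ctrl_threshold powr \<gamma> \<le> 1"
proof -
  let ?q = "A * local_const * sewing_const (2 * \<gamma>) * a"
  have q: "?q \<ge> 0" using A a \<gamma> sewing_const_nonneg[of "2 * \<gamma>"] by (simp add: local_const_def)
  have pos: "1 + ?q\<^sup>2 > 0" by (smt (verit) zero_le_power2)
  then show 0: "0 < ctrl_threshold" "ctrl_threshold \<le> 1" by (auto simp: ctrl_threshold_def)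
  have "ctrl_threshold powr \<gamma> \<le> ctrl_threshold powr (1/2)" using 0 \<gamma> by (intro powr_mono') auto
  also have "\<dots> = 1 / sqrt (1 + ?q\<^sup>2)"
    using 0 by (simp add: powr_half_sqrt ctrl_threshold_def real_sqrt_divide)
  finally have "?q * ctrl_threshold powr \<gamma> \<le> ?q / sqrt (1 + ?q\<^sup>2)"
    using q by (metis mult_left_mono times_divide_eq_right mult.right_neutral)
  also have "\<dots> \<le> 1" using q pos by (simp add: real_le_rsqrt)
  finally show "?q * ctrl_threshold powr \<gamma> \<le> 1" .
qed

text \<open>Strong induction on the length of the block. The defect of the germ over
  \<open>p < q < r\<close> involves the solution only on a strictly shorter block, where the claim
  is known; this supplies the Hoelder bound of \<open>y\<close> that sewing asks for. The threshold
  makes the remainder at most \<open>a * ?w powr \<gamma>\<close>, so the constant does not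
  deteriorate from one length to the next.\<close>

lemma local_bound:
  assumes "i \<le> j" "j \<le> m" "ctrl j - ctrl i \<le> ctrl_threshold"
  shows "norm (y j - y i) \<le> local_const * a * (ctrl j - ctrl i) powr \<gamma>" using assms
proof (induction "j - i" arbitrary: i j rule: less_induct)
  case less
  show ?case
  proof (cases "i = j")
    case True
    then show ?thesis by simp
  next
    case False
    then have "i < j" using less.prems by simp
    let ?w = "ctrl j - ctrl i"
    have w: "0 \<le> ?w" "?w \<le> 1" using monoD[OF mono_ctrl \<open>i \<le> j\<close>] less.prems ctrl_threshold by auto
    have c: "local_const \<ge> 0" using A by (simp add: local_const_def)
    define \<Xi> where "\<Xi> b c = \<sigma> (y (i + b)) (G (i + c) - G (i + b))" for b c
    have "norm (\<Xi> 0 (j - i) - (\<Sum>k<j - i. \<Xi> k (Suc k)))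
        \<le> (A * local_const * a\<^sup>2) * sewing_const (2 * \<gamma>)
          * (ctrl (i + (j - i)) - ctrl (i + 0)) powr (2 * \<gamma>)"
    proof (rule discrete_sewing)
      show "mono (\<lambda>k. ctrl (i + k))" using mono_ctrl by (simp add: mono_def)
      show "2 * \<gamma> > 1" "A * local_const * a\<^sup>2 \<ge> 0" "j - i > 0" using \<gamma> A c \<open>i < j\<close> by auto
      fix p q r assume pqr: "p < q" "q < r" "r \<le> j - i"
      have mono: "ctrl (i + p) \<le> ctrl (i + q)" "ctrl (i + q) \<le> ctrl (i + r)"
          "ctrl (i + r) \<le> ctrl j" "ctrl i \<le> ctrl (i + p)"
        using pqr by (auto intro!: monoD[OF mono_ctrl])
      \<comment> \<open>The germ is additive in the increment of \<open>G\<close>, so the defect is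
        the change of the field between \<open>p\<close> and \<open>q\<close> applied to the
        increment from \<open>q\<close> to \<open>r\<close>. It is of order
        \<open>2 * \<gamma> > 1\<close> in the control.\<close>
      have "\<Xi> p r - \<Xi> p q - \<Xi> q r
          = \<sigma> (y (i + p)) (G (i + r) - G (i + q)) - \<sigma> (y (i + q)) (G (i + r) - G (i + q))"
        by (simp add: \<Xi>_def diff)
      also have "norm \<dots> \<le> A * norm (y (i + p) - y (i + q)) * norm (G (i + r) - G (i + q))"
        by (rule lipschitz)
      also have "\<dots> \<le> A * (local_const * a * (ctrl (i + r) - ctrl (i + p)) powr \<gamma>)
          * (a * (ctrl (i + r) - ctrl (i + p)) powr \<gamma>)"
      proof (intro mult_mono)
        have "norm (y (i + q) - y (i + p))
            \<le> local_const * a * (ctrl (i + q) - ctrl (i + p)) powr \<gamma>"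
          using pqr less.prems mono by (intro less.hyps) auto
        also have "\<dots> \<le> local_const * a * (ctrl (i + r) - ctrl (i + p)) powr \<gamma>"
          using mono c a \<gamma> by (intro mult_left_mono powr_mono2) auto
        finally show "norm (y (i + p) - y (i + q))
            \<le> local_const * a * (ctrl (i + r) - ctrl (i + p)) powr \<gamma>"
          by (simp add: norm_minus_commute)
        have "norm (G (i + r) - G (i + q)) \<le> a * (ctrl (i + r) - ctrl (i + q)) powr \<gamma>"
          using pqr less.prems by (intro G_ctrl) auto
        also have "\<dots> \<le> a * (ctrl (i + r) - ctrl (i + p)) powr \<gamma>"
          using mono a \<gamma> by (intro mult_left_mono powr_mono2) auto
        finally show "norm (G (i + r) - G (i + q)) \<le> a * (ctrl (i + r) - ctrl (i + p)) powr \<gamma>" .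
      qed (use A a c in auto)
      also have "\<dots> = A * local_const * a\<^sup>2 * (ctrl (i + r) - ctrl (i + p)) powr (2 * \<gamma>)"
        by (simp add: power2_eq_square powr_add[symmetric])
      finally show "norm (\<Xi> p r - \<Xi> p q - \<Xi> q r)
          \<le> A * local_const * a\<^sup>2 * (ctrl (i + r) - ctrl (i + p)) powr (2 * \<gamma>)" .
    qed
    then have sew: "norm (\<Xi> 0 (j - i) - (\<Sum>k<j - i. \<Xi> k (Suc k)))
        \<le> A * local_const * a\<^sup>2 * sewing_const (2 * \<gamma>) * ?w powr (2 * \<gamma>)"
      using \<open>i < j\<close> by simp
    also have "\<dots> = (A * local_const * sewing_const (2 * \<gamma>) * a * ?w powr \<gamma>) * (a * ?w powr \<gamma>)"
      by (simp add: power2_eq_square powr_add[symmetric])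
    also have "\<dots> \<le> 1 * (a * ?w powr \<gamma>)"
    proof (intro mult_right_mono order_trans[OF _ ctrl_threshold(3)] mult_left_mono powr_mono2)
      show "0 \<le> A * local_const * sewing_const (2 * \<gamma>) * a"
        using A c a \<gamma> sewing_const_nonneg[of "2 * \<gamma>"] by simp
    qed (use w a \<gamma> less.prems in auto)
    finally have 1: "norm (\<Xi> 0 (j - i) - (\<Sum>k<j - i. \<Xi> k (Suc k))) \<le> a * ?w powr \<gamma>" by simp
    have "norm (\<Xi> 0 (j - i)) \<le> A * norm (G j - G i)" using bounded \<open>i < j\<close> by (simp add: \<Xi>_def)
    also have "\<dots> \<le> A * (a * ?w powr \<gamma>)" using A G_ctrl less.prems by (intro mult_left_mono) auto
    finally have 2: "norm (\<Xi> 0 (j - i)) \<le> A * (a * ?w powr \<gamma>)" .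
    have "?w \<le> ?w powr \<gamma>" using w \<gamma> powr_mono'[of \<gamma> 1 ?w] by (cases "?w = 0") auto
    then have "a * ?w \<le> a * ?w powr \<gamma>" using a by simp
    with \<eta>_ctrl[OF less.prems(1,2)]
    have 3: "norm (\<Sum>k=i..<j. \<eta> k) \<le> a * ?w powr \<gamma>" by linarith
    have "(\<Sum>k<j - i. \<Xi> k (Suc k)) = (\<Sum>k=i..<j. \<sigma> (y k) (G (Suc k) - G k))"
      unfolding \<Xi>_def using less.prems sum.shift_bounds_nat_ivl[of "\<lambda>k. \<sigma> (y k) (G (Suc k) - G k)" 0 i "j - i"]
      by (simp add: lessThan_atLeast0 add.commute)
    then have "y j - y i = \<Xi> 0 (j - i) - (\<Xi> 0 (j - i) - (\<Sum>k<j - i. \<Xi> k (Suc k))) + (\<Sum>k=i..<j. \<eta> k)"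
      using increment[OF less.prems(1,2)] by simp
    also have "norm \<dots> \<le> A * (a * ?w powr \<gamma>) + a * ?w powr \<gamma> + a * ?w powr \<gamma>"
      using 1 2 3 by (smt (verit) norm_triangle_ineq norm_triangle_ineq4)
    also have "\<dots> = local_const * a * ?w powr \<gamma>" by (simp add: local_const_def algebra_simps)
    finally show ?thesis .
  qed
qed

text \<open>A block together with the step that leaves it uses up more than
  \<open>ctrl_threshold\<close> of the control and costs \<open>(local_const + A) * a\<close> plus
  the perturbation within that step; the summand \<open>1\<close> covers the latter.\<close>

definition "global_const = 1 + (local_const + A) / ctrl_threshold"

text \<open>Blocks are chosen greedily and their cost is charged to the control they consume, which
  makes the bound affine in \<open>ctrl\<close>. The step that leaves a block is estimated by
  itself, because a single \<open>v k\<close> may exceed the threshold. The last block may stay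
  below the threshold; it accounts for the constant \<open>local_const * a\<close>.\<close>

lemma global_bound:
  assumes "i \<le> j" "j \<le> m"
  shows "norm (y j - y i) \<le> local_const * a + global_const * a * (ctrl j - ctrl i)" using assms
proof (induction "j - i" arbitrary: i rule: less_induct)
  case less
  have c: "local_const \<ge> 0" using A by (simp add: local_const_def)
  have gc: "global_const \<ge> 0" using A c ctrl_threshold by (simp add: global_const_def)
  let ?S = "{k. i \<le> k \<and> k \<le> j \<and> ctrl k - ctrl i \<le> ctrl_threshold}"
  \<comment> \<open>The last point reachable from \<open>i\<close> within the threshold. It may be
    \<open>i\<close> itself; the induction progresses through the step to
    \<open>Suc k\<close>.\<close>
  define k where "k = Max ?S"
  have fin: "finite ?S" by (rule finite_subset[of _ "{..j}"]) auto
  have "i \<in> ?S" using less.prems ctrl_threshold by auto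
  then have k: "k \<in> ?S" unfolding k_def using fin by (intro Max_in) auto
  have "norm (y k - y i) \<le> local_const * a * (ctrl k - ctrl i) powr \<gamma>"
    using k less.prems by (intro local_bound) auto
  also have "\<dots> \<le> local_const * a * 1 powr \<gamma>"
    using k ctrl_threshold c a \<gamma> monoD[OF mono_ctrl, of i k]
    by (intro mult_left_mono powr_mono2) auto
  finally have 1: "norm (y k - y i) \<le> local_const * a" by simp
  show ?case
  proof (cases "k = j")
    case True
    then show ?thesis using 1 gc a monoD[OF mono_ctrl less.prems(1)] by (simp add: add_increasing2)
  next
    case False
    then have "k < j" using k by auto
    have "Suc k \<notin> ?S" using Max_ge[OF fin, of "Suc k"] by (auto simp: k_def[symmetric])
    then have big: "ctrl (Suc k) - ctrl i > ctrl_threshold" using k \<open>k < j\<close> by auto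
    have "y (Suc k) - y k = \<sigma> (y k) (G (Suc k) - G k) + \<eta> k" using step \<open>k < j\<close> less.prems by simp
    also have "norm \<dots> \<le> A * a + a * (ctrl (Suc k) - ctrl k)"
    proof (intro norm_triangle_le add_mono)
      have "norm (G (Suc k) - G k) \<le> a * ((real (Suc k) - real k) / real m) powr \<gamma>"
        using \<open>k < j\<close> less.prems by (intro G) auto
      also have "\<dots> \<le> a * 1 powr \<gamma>" using a m \<gamma> by (intro mult_left_mono powr_mono2) auto
      finally show "norm (\<sigma> (y k) (G (Suc k) - G k)) \<le> A * a"
        using A by (intro order_trans[OF bounded] mult_left_mono) auto
      show "norm (\<eta> k) \<le> a * (ctrl (Suc k) - ctrl k)"
        using \<eta>_ctrl[of k "Suc k"] \<open>k < j\<close> less.prems by simp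
    qed
    finally have 2: "norm (y (Suc k) - y k) \<le> A * a + a * (ctrl (Suc k) - ctrl k)" .
    have 3: "norm (y j - y (Suc k)) \<le> local_const * a + global_const * a * (ctrl j - ctrl (Suc k))"
      using k \<open>k < j\<close> less.prems by (intro less.hyps) auto
    define Q where "Q = (local_const + A) / ctrl_threshold"
    define d where "d = ctrl (Suc k) - ctrl i"
    have "local_const + A = Q * ctrl_threshold" using ctrl_threshold by (simp add: Q_def)
    also have "\<dots> \<le> Q * d"
      using big ctrl_threshold c A by (intro mult_left_mono) (auto simp: Q_def d_def)
    finally have "(local_const + A) * a \<le> Q * d * a" using a by (intro mult_right_mono) auto
    moreover have "a * (ctrl (Suc k) - ctrl k) \<le> a * d"
      using a k monoD[OF mono_ctrl, of i k] by (simp add: d_def)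
    moreover have "global_const * a * d = a * d + Q * d * a"
      unfolding global_const_def Q_def by (simp only: distrib_right mult_1 mult.assoc mult.commute[of d a])
    ultimately have 4: "local_const * a + A * a + a * (ctrl (Suc k) - ctrl k) \<le> global_const * a * d"
      by (simp only: distrib_right)
    have 5: "global_const * a * d + global_const * a * (ctrl j - ctrl (Suc k))
        = global_const * a * (ctrl j - ctrl i)"
      unfolding d_def by (simp only: distrib_left[symmetric]) simp
    have "norm (y j - y i) \<le> norm (y j - y (Suc k)) + norm (y (Suc k) - y i)"
      using norm_triangle_ineq[of "y j - y (Suc k)" "y (Suc k) - y i"] by simp
    moreover have "norm (y (Suc k) - y i) \<le> norm (y (Suc k) - y k) + norm (y k - y i)"
      using norm_triangle_ineq[of "y (Suc k) - y k" "y k - y i"] by simp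
    ultimately show ?thesis using 1 2 3 4 5 by linarith
  qed
qed

text \<open>The division by \<open>a\<close> in \<open>ctrl\<close> cancels here, so the variation
  of \<open>\<eta>\<close> enters linearly.\<close>

lemma growth_bound:
  assumes "j \<le> m"
  shows "norm (y j - y 0) \<le> local_const * a + global_const * (a + (\<Sum>k<m. v k))"
proof -
  have "0 \<le> ctrl_threshold" "global_const \<ge> 0"
    using A ctrl_threshold by (auto simp: global_const_def local_const_def)
  moreover have "ctrl j - ctrl 0 \<le> 1 + (\<Sum>k<m. v k) / a"
    using assms monoD[OF mono_ctrl assms] m by (simp add: ctrl_def)
  ultimately have "global_const * a * (ctrl j - ctrl 0) \<le> global_const * a * (1 + (\<Sum>k<m. v k) / a)"
    using a by (intro mult_left_mono) auto
  then show ?thesis using global_bound[of 0 j] assms a by (simp add: algebra_simps)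
qed

end

section \<open>The transport property of the Gaussian measure\<close>

text \<open>Only the extreme points matter: \<open>Sup A + Sup B \<le> 2 * r\<close> and
  \<open>Inf A + Inf B \<ge> - 2 * r\<close>, so the intervals spanned by \<open>A\<close> and
  \<open>B\<close> have total length at most \<open>4 * r\<close>.\<close>

lemma emeasure_sum_interval:
  fixes A B :: "real set"
  assumes "A \<noteq> {}" "B \<noteq> {}" and AB: "\<And>x y. x \<in> A \<Longrightarrow> y \<in> B \<Longrightarrow> \<bar>x + y\<bar> \<le> 2 * r"
  shows "emeasure lborel A + emeasure lborel B \<le> ennreal (4 * r)"
proof -
  obtain x0 y0 where xy0: "x0 \<in> A" "y0 \<in> B" using assms by auto
  have "x \<le> 2 * r - y0" "- 2 * r - y0 \<le> x" if "x \<in> A" for x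
    using AB[OF that xy0(2)] by (auto simp: abs_le_iff)
  then have bdA: "bdd_above A" "bdd_below A" by (meson bdd_aboveI bdd_belowI)+
  have "y \<le> 2 * r - x0" "- 2 * r - x0 \<le> y" if "y \<in> B" for y
    using AB[OF xy0(1) that] by (auto simp: abs_le_iff)
  then have bdB: "bdd_above B" "bdd_below B" by (meson bdd_aboveI bdd_belowI)+
  have "y \<le> 2 * r - Sup A" if "y \<in> B" for y
    using cSup_least[of A "2 * r - y"] AB[OF _ that] assms by (force simp: abs_le_iff)
  then have sup: "Sup B \<le> 2 * r - Sup A" using assms by (intro cSup_least) auto
  have "- 2 * r - Inf A \<le> y" if "y \<in> B" for y
    using cInf_greatest[of A "- 2 * r - y"] AB[OF _ that] assms by (force simp: abs_le_iff)
  then have inf: "- 2 * r - Inf A \<le> Inf B" using assms by (intro cInf_greatest) auto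
  have le: "Inf A \<le> Sup A" "Inf B \<le> Sup B" using cInf_le_cSup bdA bdB assms by auto
  have "emeasure lborel A \<le> emeasure lborel {Inf A..Sup A}"
    by (rule emeasure_mono) (auto intro!: cInf_lower cSup_upper bdA)
  moreover have "emeasure lborel B \<le> emeasure lborel {Inf B..Sup B}"
    by (rule emeasure_mono) (auto intro!: cInf_lower cSup_upper bdB)
  ultimately have "emeasure lborel A + emeasure lborel B \<le> ennreal (Sup A - Inf A) + ennreal (Sup B - Inf B)"
    using le by (intro add_mono) auto
  also have "\<dots> \<le> ennreal (4 * r)"
    using le sup inf by (simp add: ennreal_plus[symmetric] ennreal_leI del: ennreal_plus)
  finally show ?thesis .
qed

lemma nn_integral_layer_cake:
  assumes [measurable]: "f \<in> borel_measurable borel" and "\<And>x. 0 \<le> f x"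
  shows "(\<integral>\<^sup>+x. ennreal (f x) \<partial>lborel)
    = (\<integral>\<^sup>+t. emeasure lborel {x::real. t < f x} * indicator {0::real<..} t \<partial>lborel)"
proof -
  have "(\<integral>\<^sup>+x. ennreal (f x) \<partial>lborel)
      = (\<integral>\<^sup>+x. (\<integral>\<^sup>+t. indicator {t. 0 < t \<and> t < f x} t \<partial>lborel) \<partial>lborel)"
  proof (rule nn_integral_cong)
    fix x
    have "{t. 0 < t \<and> t < f x} = {0<..<f x}" by auto
    then show "ennreal (f x) = (\<integral>\<^sup>+t. indicator {t. 0 < t \<and> t < f x} t \<partial>lborel)"
      using assms(2)[of x] by simp
  qed
  also have "\<dots> = (\<integral>\<^sup>+x. (\<integral>\<^sup>+t. (if 0 < t \<and> t < f x then 1 else 0) \<partial>lborel) \<partial>lborel)"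
    by (intro nn_integral_cong) (auto simp: indicator_def)
  also have "\<dots> = (\<integral>\<^sup>+t. (\<integral>\<^sup>+x. (if 0 < t \<and> t < f x then 1 else 0) \<partial>lborel) \<partial>lborel)"
    by (rule lborel_pair.Fubini'[symmetric]) measurable
  also have "\<dots> = (\<integral>\<^sup>+t. emeasure lborel {x. t < f x} * indicator {0<..} t \<partial>lborel)"
  proof (rule nn_integral_cong)
    fix t
    have "(\<integral>\<^sup>+x. (if 0 < t \<and> t < f x then 1 else 0) \<partial>lborel)
        = (\<integral>\<^sup>+x. indicator {x. 0 < t \<and> t < f x} x \<partial>lborel)"
      by (intro nn_integral_cong) (auto simp: indicator_def)
    also have "\<dots> = emeasure lborel {x. 0 < t \<and> t < f x}" by (rule nn_integral_indicator) measurable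
    finally show "(\<integral>\<^sup>+x. (if 0 < t \<and> t < f x then 1 else 0) \<partial>lborel)
        = emeasure lborel {x. t < f x} * indicator {0<..} t"
      by (auto simp: indicator_def)
  qed
  finally show ?thesis .
qed

text \<open>The superlevel sets of a Gaussian are intervals, so the one-dimensional Brunn--Minkowski
  inequality is only needed for sumsets contained in an interval.\<close>

lemma prekopa_leindler_gaussian:
  fixes p q :: "real \<Rightarrow> real"
  assumes [measurable]: "p \<in> borel_measurable borel" "q \<in> borel_measurable borel"
    and p: "\<And>x. 0 \<le> p x" "\<And>x. p x \<le> 1" "\<And>t. t < 1 \<Longrightarrow> \<exists>x. t < p x"
    and q: "\<And>x. 0 \<le> q x" "\<And>x. q x \<le> 1" "\<And>t. t < 1 \<Longrightarrow> \<exists>x. t < q x"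
    and c: "c > 0"
    and pq: "\<And>x y. p x * q y \<le> c\<^sup>2 * exp (- (x + y)\<^sup>2 / 4)"
  shows "(\<integral>\<^sup>+x. p x \<partial>lborel) + (\<integral>\<^sup>+x. q x \<partial>lborel) \<le> ennreal (2 * c * sqrt (2 * pi))"
proof -
  define h where "h z = c * exp (- z\<^sup>2 / 2)" for z :: real
  have [measurable]: "h \<in> borel_measurable borel" unfolding h_def by measurable
  have h0: "0 \<le> h z" for z using c by (simp add: h_def)
  have level: "emeasure lborel {x. t < p x} + emeasure lborel {x. t < q x}
      \<le> 2 * emeasure lborel {z. t < h z}" if t: "0 < t" for t
  proof (cases "t < 1")
    case False
    then have "{x. t < p x} = {}" "{x. t < q x} = {}"
      using p(2) q(2) by (auto simp: not_less intro: order_trans)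
    then show ?thesis by simp
  next
    case True
    \<comment> \<open>Both factors exceed \<open>t\<close>, so their product exceeds
      \<open>t\<^sup>2\<close>, and the assumed bound on the product is the square of
      \<open>h\<close> at the midpoint.\<close>
    have less: "t < h ((x + y) / 2)" if "t < p x" "t < q y" for x y
    proof -
      have "t\<^sup>2 < p x * q y" using that t by (simp add: power2_eq_square mult_strict_mono)
      also have "\<dots> \<le> c\<^sup>2 * exp (- (x + y)\<^sup>2 / 4)" by (rule pq)
      also have "\<dots> = (h ((x + y) / 2))\<^sup>2"
        by (simp add: h_def power_mult_distrib exp_double[symmetric] power_divide)
      finally show ?thesis using h0 power2_less_imp_less by blast
    qed
    \<comment> \<open>Both superlevel sets are non-empty for every \<open>t < 1\<close> because
      \<open>p\<close> and \<open>q\<close> have the common supremum 1; if only one of them were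
      empty, nothing would bound the length of the other.\<close>
    obtain x0 y0 where "t < p x0" "t < q y0" using p(3) q(3) True by blast
    have h_le: "h z \<le> c" for z using c by (simp add: h_def)
    from less[OF \<open>t < p x0\<close> \<open>t < q y0\<close>] h_le have "t < c" by (rule less_le_trans)
    define r where "r = sqrt (2 * ln (c / t))"
    have r0: "2 * ln (c / t) > 0" "r > 0" using \<open>t < c\<close> t by (auto simp: r_def)
    have h_iff: "t < h z \<longleftrightarrow> \<bar>z\<bar> < r" for z
    proof -
      have "t < h z \<longleftrightarrow> t / c < exp (- z\<^sup>2 / 2)" using c by (simp add: h_def field_simps)
      also have "\<dots> \<longleftrightarrow> ln (t / c) < - z\<^sup>2 / 2"
        using c t by (metis divide_pos_pos exp_less_cancel_iff exp_ln)
      also have "\<dots> \<longleftrightarrow> z\<^sup>2 < 2 * ln (c / t)" using c t by (auto simp: ln_div)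
      also have "\<dots> \<longleftrightarrow> \<bar>z\<bar> < r" unfolding r_def by (metis real_sqrt_abs real_sqrt_less_iff)
      finally show ?thesis .
    qed
    have set: "{z. t < h z} = {-r<..<r}" by (auto simp: h_iff)
    have "emeasure lborel {x. t < p x} + emeasure lborel {x. t < q x} \<le> ennreal (4 * r)"
    proof (rule emeasure_sum_interval)
      fix x y assume "x \<in> {x. t < p x}" "y \<in> {x. t < q x}"
      with less[of x y] show "\<bar>x + y\<bar> \<le> 2 * r" by (simp add: h_iff)
    qed (use \<open>t < p x0\<close> \<open>t < q y0\<close> in auto)
    also have "\<dots> = 2 * emeasure lborel {z. t < h z}"
    proof -
      have "emeasure lborel {z. t < h z} = ennreal (2 * r)" using r0 by (simp add: set)
      then show ?thesis using r0 ennreal_mult[of 2 "2 * r"] by simp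
    qed
    finally show ?thesis .
  qed
  have "(\<integral>\<^sup>+x. p x \<partial>lborel) + (\<integral>\<^sup>+x. q x \<partial>lborel)
      = (\<integral>\<^sup>+t. emeasure lborel {x. t < p x} * indicator {0<..} t
          + emeasure lborel {x. t < q x} * indicator {0<..} t \<partial>lborel)"
    unfolding nn_integral_layer_cake[OF assms(1) p(1)] nn_integral_layer_cake[OF assms(2) q(1)]
    by (rule nn_integral_add[symmetric]) measurable
  also have "\<dots> \<le> (\<integral>\<^sup>+t. 2 * (emeasure lborel {z. t < h z} * indicator {0<..} t) \<partial>lborel)"
    by (intro nn_integral_mono) (use level in \<open>auto simp: indicator_def\<close>)
  also have "\<dots> = 2 * (\<integral>\<^sup>+t. emeasure lborel {z. t < h z} * indicator {0<..} t \<partial>lborel)"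
    by (rule nn_integral_cmult) measurable
  also have "\<dots> = 2 * (\<integral>\<^sup>+z. h z \<partial>lborel)" by (subst nn_integral_layer_cake) (auto simp: h0)
  also have "(\<integral>\<^sup>+z. h z \<partial>lborel) = (\<integral>\<^sup>+z. ennreal (c * sqrt (2 * pi)) * std_normal_density z \<partial>lborel)"
    using c by (intro nn_integral_cong)
      (simp add: h_def std_normal_density_def flip: ennreal_mult)
  also have "\<dots> = ennreal (c * sqrt (2 * pi))"
    using prob_space.emeasure_space_1[OF prob_space_normal_density[of 1 0]]
    by (subst nn_integral_cmult) (auto simp: emeasure_density)
  also have "2 * ennreal (c * sqrt (2 * pi)) = ennreal (2 * c * sqrt (2 * pi))"
    using c ennreal_mult[of 2 "c * sqrt (2 * pi)"] by (simp add: mult.assoc)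
  finally show ?thesis .
qed

text \<open>Multiplied by the two normal densities, the hypothesis becomes that of the
  Prekopa--Leindler inequality, since (x - y)^2 / 4 - x^2 / 2 - y^2 / 2 = - (x + y)^2 / 4. That
  inequality bounds a sum of integrals; the arithmetic-geometric mean inequality turns it into a
  bound on the product.\<close>

lemma gaussian_tau_1d:
  fixes U V :: "real \<Rightarrow> ennreal"
  assumes [measurable]: "U \<in> borel_measurable borel" "V \<in> borel_measurable borel"
    and UV: "\<And>x y. U x * V y \<le> ennreal (exp ((x - y)\<^sup>2 / 4))"
  shows "(\<integral>\<^sup>+x. U x \<partial>std_normal_distribution) * (\<integral>\<^sup>+x. V x \<partial>std_normal_distribution) \<le> 1"
proof (cases "(\<forall>x. U x = 0) \<or> (\<forall>x. V x = 0)")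
  case True
  then show ?thesis by auto
next
  case False
  \<comment> \<open>One point with \<open>V y0 \<noteq> 0\<close> makes \<open>U\<close> finite
    everywhere and bounds \<open>u\<close> times the density, and likewise with the roles exchanged.
    This is why the case of a function vanishing identically is split off.\<close>
  then obtain x0 y0 where x0: "U x0 \<noteq> 0" and y0: "V y0 \<noteq> 0" by auto
  define u v where "u x = enn2real (U x)" and "v x = enn2real (V x)" for x
  have U: "U x = ennreal (u x)" for x
  proof -
    have "U x \<noteq> \<top>" using UV[of x y0] y0 by (auto simp: ennreal_top_mult top_unique)
    then show ?thesis by (simp add: u_def less_top)
  qed
  have V: "V x = ennreal (v x)" for x
  proof -
    have "V x \<noteq> \<top>" using UV[of x0 x] x0 by (auto simp: ennreal_mult_top top_unique)
    then show ?thesis by (simp add: v_def less_top)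
  qed
  have u0: "u x \<ge> 0" and v0: "v x \<ge> 0" for x by (auto simp: u_def v_def)
  have ux0: "u x0 > 0" and vy0: "v y0 > 0" using x0 y0 U V u0 v0
    by (metis ennreal_0 less_eq_real_def)+
  have [measurable]: "u \<in> borel_measurable borel" "v \<in> borel_measurable borel"
    unfolding u_def v_def by measurable
  have uv: "u x * v y \<le> exp ((x - y)\<^sup>2 / 4)" for x y
    using UV[of x y] u0 v0 by (simp add: U V ennreal_mult[symmetric])
  define \<phi> where "\<phi> = std_normal_density"
  have [measurable]: "\<phi> \<in> borel_measurable borel" unfolding \<phi>_def by measurable
  have \<phi>0: "\<phi> x > 0" for x by (simp add: \<phi>_def normal_density_pos)
  have key: "(u x * \<phi> x) * (v y * \<phi> y) \<le> 1 / (2 * pi) * exp (- (x + y)\<^sup>2 / 4)" for x y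
  proof -
    have "(u x * \<phi> x) * (v y * \<phi> y) = (u x * v y) * (\<phi> x * \<phi> y)" by simp
    also have "\<dots> \<le> exp ((x - y)\<^sup>2 / 4) * (\<phi> x * \<phi> y)"
      using uv \<phi>0 by (intro mult_right_mono) (auto simp: less_imp_le)
    also have "\<phi> x * \<phi> y = 1 / (2 * pi) * exp (- x\<^sup>2 / 2 + - y\<^sup>2 / 2)"
      unfolding exp_add by (simp add: \<phi>_def std_normal_density_def)
    also have "exp ((x - y)\<^sup>2 / 4) * \<dots> = 1 / (2 * pi) * exp ((x - y)\<^sup>2 / 4 + (- x\<^sup>2 / 2 + - y\<^sup>2 / 2))"
      unfolding exp_add by simp
    also have "(x - y)\<^sup>2 / 4 + (- x\<^sup>2 / 2 + - y\<^sup>2 / 2) = - (x + y)\<^sup>2 / 4"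
      by (simp add: power2_eq_square field_simps)
    finally show ?thesis .
  qed
  have key': "(u x * \<phi> x) * (v y * \<phi> y) \<le> 1 / (2 * pi)" for x y
    using key[of x y] by (rule order_trans) (auto simp: divide_simps)
  define \<alpha> \<beta> where "\<alpha> = (SUP x. u x * \<phi> x)" and "\<beta> = (SUP x. v x * \<phi> x)"
  have bdu: "bdd_above (range (\<lambda>x. u x * \<phi> x))" using key'[of _ y0] vy0 \<phi>0[of y0]
    by (auto simp: bdd_above_def field_simps intro!: exI[of _ "1 / (2 * pi) / (v y0 * \<phi> y0)"])
  have bdv: "bdd_above (range (\<lambda>x. v x * \<phi> x))" using key'[of x0] ux0 \<phi>0[of x0]
    by (auto simp: bdd_above_def field_simps intro!: exI[of _ "1 / (2 * pi) / (u x0 * \<phi> x0)"])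
  have \<alpha>: "u x * \<phi> x \<le> \<alpha>" and \<beta>: "v x * \<phi> x \<le> \<beta>" for x
    unfolding \<alpha>_def \<beta>_def by (auto intro: cSUP_upper bdu bdv)
  have \<alpha>0: "\<alpha> > 0" using \<alpha>[of x0] ux0 \<phi>0[of x0] by (smt (verit) mult_pos_pos)
  have \<beta>0: "\<beta> > 0" using \<beta>[of y0] vy0 \<phi>0[of y0] by (smt (verit) mult_pos_pos)
  \<comment> \<open>Normalised to supremum 1. The factor \<open>\<alpha> * \<beta>\<close> divided
    out here goes into \<open>c\<close> and is restored in
    \<open>\<alpha> * P' * (\<beta> * Q') \<le> 1\<close>.\<close>
  define p q where "p x = u x * \<phi> x / \<alpha>" and "q x = v x * \<phi> x / \<beta>" for x
  define c where "c = 1 / sqrt (2 * pi * \<alpha> * \<beta>)"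
  have c: "c > 0" using \<alpha>0 \<beta>0 by (simp add: c_def)
  have c2: "c\<^sup>2 = 1 / (2 * pi * \<alpha> * \<beta>)" using \<alpha>0 \<beta>0 by (simp add: c_def power_divide)
  have "(\<integral>\<^sup>+x. p x \<partial>lborel) + (\<integral>\<^sup>+x. q x \<partial>lborel) \<le> ennreal (2 * c * sqrt (2 * pi))"
  proof (rule prekopa_leindler_gaussian)
    show "p \<in> borel_measurable borel" "q \<in> borel_measurable borel"
      unfolding p_def q_def by measurable
    show "0 \<le> p x" "p x \<le> 1" "0 \<le> q x" "q x \<le> 1" for x
      using \<alpha>0 \<beta>0 u0 v0 \<phi>0[of x] \<alpha> \<beta> by (auto simp: p_def q_def less_imp_le)
    show "\<exists>x. t < p x" if "t < 1" for t
    proof -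
      have "\<exists>x. t * \<alpha> < u x * \<phi> x"
        using less_cSUP_iff[OF _ bdu, of "t * \<alpha>"] that \<alpha>0 by (simp add: \<alpha>_def[symmetric])
      then show ?thesis using \<alpha>0 by (simp add: p_def field_simps)
    qed
    show "\<exists>x. t < q x" if "t < 1" for t
    proof -
      have "\<exists>x. t * \<beta> < v x * \<phi> x"
        using less_cSUP_iff[OF _ bdv, of "t * \<beta>"] that \<beta>0 by (simp add: \<beta>_def[symmetric])
      then show ?thesis using \<beta>0 by (simp add: q_def field_simps)
    qed
    show "c > 0" by (rule c)
    show "p x * q y \<le> c\<^sup>2 * exp (- (x + y)\<^sup>2 / 4)" for x y
    proof -
      have "p x * q y = (u x * \<phi> x) * (v y * \<phi> y) / (\<alpha> * \<beta>)" by (simp add: p_def q_def)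
      also have "\<dots> \<le> 1 / (2 * pi) * exp (- (x + y)\<^sup>2 / 4) / (\<alpha> * \<beta>)"
        using \<alpha>0 \<beta>0 by (intro divide_right_mono key) auto
      also have "\<dots> = c\<^sup>2 * exp (- (x + y)\<^sup>2 / 4)" by (simp add: c2)
      finally show ?thesis .
    qed
  qed
  moreover define P Q where "P = (\<integral>\<^sup>+x. p x \<partial>lborel)" and "Q = (\<integral>\<^sup>+x. q x \<partial>lborel)"
  ultimately have PQ: "P + Q \<le> ennreal (2 * c * sqrt (2 * pi))" by simp
  then have "P < \<top>" "Q < \<top>"
    by (metis add_top_left_ennreal add.commute ennreal_less_top less_top neq_top_trans top_add)+
  then obtain P' Q' where P': "P = ennreal P'" "P' \<ge> 0" and Q': "Q = ennreal Q'" "Q' \<ge> 0"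
    by (metis ennreal_enn2real enn2real_nonneg)
  have "P' + Q' \<le> 2 * c * sqrt (2 * pi)"
    using PQ P' Q' c by (simp add: ennreal_plus[symmetric] del: ennreal_plus)
  then have "(P' + Q')\<^sup>2 \<le> (2 * c * sqrt (2 * pi))\<^sup>2" using P' Q' by (intro power_mono) auto
  also have "\<dots> = 4 / (\<alpha> * \<beta>)" using \<alpha>0 \<beta>0 by (simp add: power_mult_distrib c2)
  finally have "P' * Q' \<le> 1 / (\<alpha> * \<beta>)"
    using arith_geo_mean_sqrt[of P' Q'] sum_squares_bound[of P' Q'] by (simp add: power2_sum)
  then have PQ1: "\<alpha> * P' * (\<beta> * Q') \<le> 1" using \<alpha>0 \<beta>0 by (simp add: field_simps)
  have "(\<integral>\<^sup>+x. U x \<partial>std_normal_distribution) = (\<integral>\<^sup>+x. ennreal \<alpha> * p x \<partial>lborel)" using \<alpha>0 u0 \<phi>0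
    by (subst nn_integral_density)
      (auto intro!: nn_integral_cong simp: U p_def \<phi>_def ennreal_mult''[symmetric] normal_density_nonneg mult.commute simp flip: ennreal_mult)
  also have "\<dots> = ennreal (\<alpha> * P')" using \<alpha>0 P' unfolding P_def[symmetric] p_def
    by (subst nn_integral_cmult) (auto simp: ennreal_mult P_def p_def)
  finally have 1: "(\<integral>\<^sup>+x. U x \<partial>std_normal_distribution) = ennreal (\<alpha> * P')" .
  have "(\<integral>\<^sup>+x. V x \<partial>std_normal_distribution) = (\<integral>\<^sup>+x. ennreal \<beta> * q x \<partial>lborel)" using \<beta>0 v0 \<phi>0
    by (subst nn_integral_density)
      (auto intro!: nn_integral_cong simp: V q_def \<phi>_def ennreal_mult''[symmetric] normal_density_nonneg mult.commute simp flip: ennreal_mult)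
  also have "\<dots> = ennreal (\<beta> * Q')" using \<beta>0 Q' unfolding q_def
    by (subst nn_integral_cmult) (auto simp: ennreal_mult Q_def q_def)
  finally have 2: "(\<integral>\<^sup>+x. V x \<partial>std_normal_distribution) = ennreal (\<beta> * Q')" .
  show ?thesis
    unfolding 1 2 using PQ1 \<alpha>0 \<beta>0 P' Q' by (simp add: ennreal_mult[symmetric] ennreal_le_1)
qed

lemma prob_space_std_normal: "prob_space std_normal_distribution"
  by (rule prob_space_normal_density) simp

lemma product_sigma_finite_std_normal: "product_sigma_finite (\<lambda>_. std_normal_distribution)"
  by (intro product_sigma_finite.intro prob_space_imp_sigma_finite prob_space_std_normal)

text \<open>Maurey's property \<open>(\<tau>)\<close> of the standard Gaussian measure.\<close>

lemma gaussian_tau: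
  fixes u v :: "('i \<Rightarrow> real) \<Rightarrow> ennreal"
  assumes "finite I"
    and "u \<in> borel_measurable (PiM I (\<lambda>_. std_normal_distribution))"
    and "v \<in> borel_measurable (PiM I (\<lambda>_. std_normal_distribution))"
    and "\<And>x y. x \<in> extensional I \<Longrightarrow> y \<in> extensional I \<Longrightarrow>
      u x * v y \<le> ennreal (exp ((\<Sum>i\<in>I. (x i - y i)\<^sup>2) / 4))"
  shows "(\<integral>\<^sup>+x. u x \<partial>PiM I (\<lambda>_. std_normal_distribution))
    * (\<integral>\<^sup>+x. v x \<partial>PiM I (\<lambda>_. std_normal_distribution)) \<le> 1"
  using assms
proof (induction I arbitrary: u v rule: finite_induct)
  case empty
  then show ?case by (simp add: PiM_empty nn_integral_count_space_finite)
next
  case (insert i I)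
  let ?N = "\<lambda>_. std_normal_distribution"
  note [measurable] = insert.prems(1,2)
  define U V where "U a = (\<integral>\<^sup>+x. u (x(i := a)) \<partial>PiM I ?N)"
    and "V a = (\<integral>\<^sup>+x. v (x(i := a)) \<partial>PiM I ?N)" for a
  interpret N: product_sigma_finite ?N by (rule product_sigma_finite_std_normal)
  interpret I: sigma_finite_measure "PiM I ?N" by (rule N.sigma_finite[OF insert.hyps(1)])
  have sets: "sets (PiM I ?N \<Otimes>\<^sub>M std_normal_distribution) = sets (PiM I ?N \<Otimes>\<^sub>M borel)"
    by (rule sets_pair_measure_cong) auto
  have upd: "(\<lambda>(a, x). x(i := a)) \<in> (borel \<Otimes>\<^sub>M PiM I ?N) \<rightarrow>\<^sub>M PiM (insert i I) ?N"
    unfolding split_beta' by (rule measurable_fun_upd[where J = I]) (auto intro: measurable_snd)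
  have meas: "(\<lambda>a. \<integral>\<^sup>+x. f (x(i := a)) \<partial>PiM I ?N) \<in> borel_measurable borel"
    if "f \<in> borel_measurable (PiM (insert i I) ?N)" for f :: "_ \<Rightarrow> ennreal"
    using measurable_compose[OF upd that]
    by (intro I.borel_measurable_nn_integral) (simp add: split_beta')
  have upd_a: "(\<lambda>x. f (x(i := a))) \<in> borel_measurable (PiM I ?N)"
    if "f \<in> borel_measurable (PiM (insert i I) ?N)" for f :: "_ \<Rightarrow> ennreal" and a
    using measurable_compose[OF measurable_Pair1' measurable_compose[OF upd that], of a] by simp
  have "(\<integral>\<^sup>+x. u x \<partial>PiM (insert i I) ?N) = (\<integral>\<^sup>+a. U a \<partial>std_normal_distribution)"
    and "(\<integral>\<^sup>+x. v x \<partial>PiM (insert i I) ?N) = (\<integral>\<^sup>+a. V a \<partial>std_normal_distribution)"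
    unfolding U_def V_def using insert.hyps insert.prems
    by (auto intro: N.product_nn_integral_insert_rev)
  moreover have "(\<integral>\<^sup>+a. U a \<partial>std_normal_distribution) * (\<integral>\<^sup>+a. V a \<partial>std_normal_distribution) \<le> 1"
  proof (rule gaussian_tau_1d)
    show "U \<in> borel_measurable borel" "V \<in> borel_measurable borel"
      unfolding U_def V_def using meas insert.prems by auto
    fix a b :: real
    let ?k = "ennreal (exp ((a - b)\<^sup>2 / 4))"
    \<comment> \<open>With the coordinate \<open>i\<close> fixed at \<open>a\<close> and
      \<open>b\<close>, the factor \<open>?k'\<close> removes its share of the distance, so the
      induction hypothesis applies to the sections. Moving it to the other side leaves exactly the
      one-dimensional hypothesis for the partial integrals \<open>U\<close> and
      \<open>V\<close>.\<close>
    let ?k' = "ennreal (exp (- (a - b)\<^sup>2 / 4))"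
    have kk: "?k' * ?k = 1" by (simp add: ennreal_mult[symmetric] exp_add[symmetric])
    have "(\<integral>\<^sup>+x. ?k' * u (x(i := a)) \<partial>PiM I ?N) * (\<integral>\<^sup>+x. v (x(i := b)) \<partial>PiM I ?N) \<le> 1"
    proof (rule insert.IH)
      show "(\<lambda>x. ?k' * u (x(i := a))) \<in> borel_measurable (PiM I ?N)"
        using upd_a[OF insert.prems(1)] by measurable
      show "(\<lambda>x. v (x(i := b))) \<in> borel_measurable (PiM I ?N)" by (rule upd_a[OF insert.prems(2)])
      fix x y :: "'i \<Rightarrow> real" assume "x \<in> extensional I" "y \<in> extensional I"
      then have "x(i := a) \<in> extensional (insert i I)" "y(i := b) \<in> extensional (insert i I)"
        by (auto simp: extensional_def)
      then have "u (x(i := a)) * v (y(i := b))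
          \<le> ennreal (exp ((\<Sum>j\<in>insert i I. ((x(i := a)) j - (y(i := b)) j)\<^sup>2) / 4))"
        by (rule insert.prems(3))
      also have "(\<Sum>j\<in>insert i I. ((x(i := a)) j - (y(i := b)) j)\<^sup>2)
          = (a - b)\<^sup>2 + (\<Sum>j\<in>I. (x j - y j)\<^sup>2)"
        using insert.hyps by (auto intro!: sum.cong)
      finally have "?k' * (u (x(i := a)) * v (y(i := b)))
          \<le> ?k' * ennreal (exp (((a - b)\<^sup>2 + (\<Sum>j\<in>I. (x j - y j)\<^sup>2)) / 4))"
        by (rule mult_left_mono) simp
      also have "\<dots> = ennreal (exp ((\<Sum>j\<in>I. (x j - y j)\<^sup>2) / 4))"
        by (simp add: ennreal_mult[symmetric] exp_add[symmetric] add_divide_distrib)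
      finally show "?k' * u (x(i := a)) * v (y(i := b)) \<le> ennreal (exp ((\<Sum>j\<in>I. (x j - y j)\<^sup>2) / 4))"
        by (simp add: mult.assoc)
    qed
    then have "?k' * U a * V b \<le> 1"
      unfolding U_def V_def using upd_a[OF insert.prems(1)] by (simp add: nn_integral_cmult)
    then have "?k * (?k' * U a * V b) \<le> ?k * 1" by (rule mult_left_mono) simp
    moreover have "?k * (?k' * U a * V b) = U a * V b"
      using kk by (metis mult.assoc mult.commute mult.left_neutral)
    ultimately show "U a * V b \<le> ?k" by simp
  qed
  ultimately show ?case by simp
qed

section \<open>Gaussian spaces\<close>

text \<open>Normalised by its total mass \<open>m\<close>, the weight becomes the density of a
  probability measure under which \<open>Z\<close> is standard normal, by uniqueness of
  characteristic functions. For \<open>m = 0\<close> the weight vanishes almost everywhere.\<close>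

lemma (in prob_space) weighted_normal_law:
  fixes f Z :: "'a \<Rightarrow> real"
  assumes [measurable]: "f \<in> borel_measurable M" "Z \<in> borel_measurable M" "A \<in> sets borel"
    and f: "\<And>w. 0 \<le> f w" "\<And>w. f w \<le> K"
    and char: "\<And>s. (CLINT w|M. of_real (f w) * iexp (s * Z w)) = of_real (m * exp (- s\<^sup>2 / 2))"
  shows "(LINT w|M. f w * indicator A (Z w)) = m * measure std_normal_distribution A"
proof -
  have int_f: "integrable M f" by (rule integrable_const_bound[of _ K]) (use f in auto)
  have m: "(LINT w|M. f w) = m" using char[of 0] by (simp add: of_real_eq_iff del: of_real_mult)
  then have m0: "m \<ge> 0" using f by (metis Bochner_Integration.integral_nonneg)
  show ?thesis
  proof (cases "m = 0")
    case True
    then have "AE w in M. f w = 0" using integral_nonneg_eq_0_iff_AE[OF int_f] f m by auto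
    then have "(LINT w|M. f w * indicator A (Z w)) = (LINT w|M. 0)" by (intro integral_cong_AE) auto
    then show ?thesis using True by simp
  next
    case False
    with m0 have "m > 0" by simp
    define D where "D = density M (\<lambda>w. ennreal (f w / m))"
    have "prob_space D"
    proof
      have "emeasure D (space D) = (\<integral>\<^sup>+w. ennreal (f w / m) \<partial>M)"
        by (simp add: D_def emeasure_density cong: nn_integral_cong)
      also have "\<dots> = ennreal (LINT w|M. f w / m)"
        using int_f f \<open>m > 0\<close> by (intro nn_integral_eq_integral) auto
      finally show "emeasure D (space D) = 1" using m False by simp
    qed
    have [measurable]: "Z \<in> borel_measurable D" by (simp add: D_def)
    interpret D: prob_space D by fact
    have "distr D borel Z = std_normal_distribution"
    proof (rule Levy_uniqueness)
      show "real_distribution (distr D borel Z)" by (rule D.real_distribution_distr) simp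
      show "real_distribution std_normal_distribution"
        using prob_space_std_normal by (simp add: real_distribution_def real_distribution_axioms_def)
      show "char (distr D borel Z) = char std_normal_distribution"
      proof
        fix s
        have "char (distr D borel Z) s = (CLINT w|D. iexp (s * Z w))"
          unfolding char_def by (subst integral_distr) auto
        also have "\<dots> = (CLINT w|M. (f w / m) *\<^sub>R iexp (s * Z w))"
          unfolding D_def using f \<open>m > 0\<close> by (subst integral_density) auto
        also have "\<dots> = (CLINT w|M. of_real (f w) * iexp (s * Z w) / of_real m)"
          by (simp add: scaleR_conv_of_real)
        also have "\<dots> = of_real (exp (- s\<^sup>2 / 2))"
          unfolding integral_divide_zero char using False by simp
        also have "\<dots> = char std_normal_distribution s" by (simp add: char_std_normal_distribution)
        finally show "char (distr D borel Z) s = char std_normal_distribution s" .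
      qed
    qed
    then have "measure std_normal_distribution A = measure (distr D borel Z) A" by simp
    also have "\<dots> = (LINT x|distr D borel Z. indicator A x)" by simp
    also have "\<dots> = (LINT w|D. indicator A (Z w))" by (subst integral_distr) auto
    also have "\<dots> = (LINT w|M. (f w / m) *\<^sub>R indicator A (Z w))"
      unfolding D_def using f \<open>m > 0\<close> by (subst integral_density) auto
    also have "\<dots> = (LINT w|M. f w * indicator A (Z w)) / m" by simp
    finally show ?thesis using False by simp
  qed
qed

lemma iexp_eq: "iexp x = of_real (cos x) + \<i> * of_real (sin x)"
  by (simp add: exp_Euler cos_of_real sin_of_real)

text \<open>The weight \<open>1 + \<psi>\<close> is non-negative, so the uniqueness theorem for characteristic functions of
  measures on the line applies to it.\<close>

lemma (in prob_space) signed_weighted_normal_law: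
  fixes c \<psi> Z :: "'a \<Rightarrow> real"
  assumes [measurable]: "c \<in> borel_measurable M" "\<psi> \<in> borel_measurable M" "Z \<in> borel_measurable M"
      "A \<in> sets borel"
    and c: "\<And>w. 0 \<le> c w" "\<And>w. c w \<le> 1" and \<psi>: "\<And>w. \<bar>\<psi> w\<bar> \<le> 1"
    and char0: "\<And>s. (CLINT w|M. of_real (c w) * iexp (s * Z w)) = of_real (p * exp (- s\<^sup>2 / 2))"
    and char1: "\<And>s. (CLINT w|M. of_real (c w * \<psi> w) * iexp (s * Z w)) = of_real (r * exp (- s\<^sup>2 / 2))"
  shows "integrable M (\<lambda>w. c w * \<psi> w * indicator A (Z w))"
    and "(LINT w|M. c w * \<psi> w * indicator A (Z w)) = r * measure std_normal_distribution A"
proof -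
  have \<psi>1: "0 \<le> 1 + \<psi> w" "1 + \<psi> w \<le> 2" for w using \<psi>[of w] by (auto simp: abs_le_iff)
  have c\<psi>: "\<bar>c w * \<psi> w\<bar> \<le> 1" for w
    using mult_mono[of "\<bar>c w\<bar>" 1 "\<bar>\<psi> w\<bar>" 1] c[of w] \<psi>[of w] by (simp add: abs_mult)
  have int: "integrable M (\<lambda>w. of_real (f w) * iexp (s * Z w))"
    if [measurable]: "f \<in> borel_measurable M" and "\<And>w. \<bar>f w\<bar> \<le> 1" for f :: "'a \<Rightarrow> real" and s
    by (rule integrable_const_bound[of _ 1]) (use that in \<open>auto simp: norm_mult\<close>)
  have int_real: "integrable M (\<lambda>w. f w * indicator A (Z w))"
    if [measurable]: "f \<in> borel_measurable M" and f: "\<And>w. \<bar>f w\<bar> \<le> 1" for f :: "'a \<Rightarrow> real"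
    by (rule integrable_const_bound[of _ 1]) (use f in \<open>auto simp: indicator_def abs_mult\<close>)
  show int\<psi>: "integrable M (\<lambda>w. c w * \<psi> w * indicator A (Z w))" by (rule int_real) (use c\<psi> in auto)
  have "(LINT w|M. (c w * (1 + \<psi> w)) * indicator A (Z w)) = (p + r) * measure std_normal_distribution A"
  proof (rule weighted_normal_law[where K = 2])
    fix s
    have "(CLINT w|M. of_real (c w * (1 + \<psi> w)) * iexp (s * Z w))
        = (CLINT w|M. of_real (c w) * iexp (s * Z w) + of_real (c w * \<psi> w) * iexp (s * Z w))"
      by (simp add: algebra_simps)
    also have "\<dots> = (CLINT w|M. of_real (c w) * iexp (s * Z w))
        + (CLINT w|M. of_real (c w * \<psi> w) * iexp (s * Z w))"
      by (intro Bochner_Integration.integral_add int) (use c c\<psi> in auto)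
    finally show "(CLINT w|M. of_real (c w * (1 + \<psi> w)) * iexp (s * Z w)) = of_real ((p + r) * exp (- s\<^sup>2 / 2))"
      unfolding char0 char1 by (simp add: distrib_right)
  next
    fix w
    show "0 \<le> c w * (1 + \<psi> w)" by (intro mult_nonneg_nonneg c \<psi>1)
    show "c w * (1 + \<psi> w) \<le> 2" using mult_mono[of "c w" 1 "1 + \<psi> w" 2] c[of w] \<psi>1[of w] by simp
  qed measurable
  moreover have "(LINT w|M. c w * indicator A (Z w)) = p * measure std_normal_distribution A"
    by (rule weighted_normal_law[OF _ _ _ c char0]) auto
  moreover have "(LINT w|M. (c w * (1 + \<psi> w)) * indicator A (Z w))
      = (LINT w|M. c w * indicator A (Z w)) + (LINT w|M. c w * \<psi> w * indicator A (Z w))"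
    using Bochner_Integration.integral_add[OF int_real int\<psi>, of c] c by (simp add: algebra_simps)
  ultimately show "(LINT w|M. c w * \<psi> w * indicator A (Z w)) = r * measure std_normal_distribution A"
    by (simp add: algebra_simps)
qed

lemma cos_mult_iexp: "of_real (c * cos t) * iexp x
    = (of_real c * iexp (x + t) + of_real c * iexp (x - t)) * (1 / 2)"
  unfolding iexp_eq cos_add sin_add cos_diff sin_diff by (simp add: complex_eq_iff algebra_simps)

lemma sin_mult_iexp: "of_real (c * sin t) * iexp x
    = (of_real c * iexp (x + t) - of_real c * iexp (x - t)) * (- \<i> / 2)"
  unfolding iexp_eq cos_add sin_add cos_diff sin_diff by (simp add: complex_eq_iff algebra_simps)

text \<open>In the application \<open>c\<close> is the product of the indicators already inserted
  and \<open>\<theta>\<close> the combination of the coordinates still to come. Cosine and sine of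
  \<open>\<theta>\<close> are bounded weights; the hypotheses for \<open>\<theta>\<close> and for
  its negative have the same right-hand side, so the cosine weight has mass \<open>p * q\<close> and
  the sine weight has mass 0.\<close>

lemma (in prob_space) normal_factor_step:
  fixes c Z \<theta> :: "'a \<Rightarrow> real"
  assumes [measurable]: "c \<in> borel_measurable M" "Z \<in> borel_measurable M" "\<theta> \<in> borel_measurable M"
      "A \<in> sets borel"
    and c: "\<And>w. 0 \<le> c w" "\<And>w. c w \<le> 1"
    and char0: "\<And>s. (CLINT w|M. of_real (c w) * iexp (s * Z w)) = of_real (p * exp (- s\<^sup>2 / 2))"
    and char1: "\<And>s. (CLINT w|M. of_real (c w) * iexp (s * Z w + \<theta> w)) = of_real (p * q * exp (- s\<^sup>2 / 2))"
    and char2: "\<And>s. (CLINT w|M. of_real (c w) * iexp (s * Z w - \<theta> w)) = of_real (p * q * exp (- s\<^sup>2 / 2))"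
  shows "(CLINT w|M. of_real (c w * indicator A (Z w)) * iexp (\<theta> w))
    = of_real (p * q * measure std_normal_distribution A)"
proof -
  have int: "integrable M (\<lambda>w. of_real (c w) * iexp (g w))"
    if [measurable]: "g \<in> borel_measurable M" for g :: "'a \<Rightarrow> real"
    by (rule integrable_const_bound[of _ 1]) (use c in \<open>auto simp: norm_mult abs_of_nonneg\<close>)
  have "(CLINT w|M. of_real (c w * cos (\<theta> w)) * iexp (s * Z w)) = of_real ((p * q) * exp (- s\<^sup>2 / 2))" for s
    unfolding cos_mult_iexp integral_mult_left_zero
    by (subst Bochner_Integration.integral_add[OF int int]) (simp_all only: char1 char2, auto)
  from signed_weighted_normal_law[OF _ _ _ _ c _ char0 this, of A]
  have cos: "integrable M (\<lambda>w. c w * cos (\<theta> w) * indicator A (Z w))"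
    "(LINT w|M. c w * cos (\<theta> w) * indicator A (Z w)) = p * q * measure std_normal_distribution A"
    by auto
  have "(CLINT w|M. of_real (c w * sin (\<theta> w)) * iexp (s * Z w)) = of_real (0 * exp (- s\<^sup>2 / 2))" for s
    unfolding sin_mult_iexp integral_mult_left_zero
    by (subst Bochner_Integration.integral_diff[OF int int]) (simp_all only: char1 char2, auto)
  from signed_weighted_normal_law[OF _ _ _ _ c _ char0 this, of A]
  have sin: "integrable M (\<lambda>w. c w * sin (\<theta> w) * indicator A (Z w))"
    "(LINT w|M. c w * sin (\<theta> w) * indicator A (Z w)) = 0" by auto
  have "(CLINT w|M. of_real (c w * indicator A (Z w)) * iexp (\<theta> w))
      = (CLINT w|M. of_real (c w * cos (\<theta> w) * indicator A (Z w))
          + \<i> * of_real (c w * sin (\<theta> w) * indicator A (Z w)))"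
    by (intro Bochner_Integration.integral_cong refl) (simp add: iexp_eq algebra_simps)
  also have "\<dots> = (CLINT w|M. of_real (c w * cos (\<theta> w) * indicator A (Z w)))
      + (CLINT w|M. \<i> * of_real (c w * sin (\<theta> w) * indicator A (Z w)))"
    using cos sin by (intro Bochner_Integration.integral_add integrable_of_real integrable_mult_right)
  also have "\<dots> = of_real (LINT w|M. c w * cos (\<theta> w) * indicator A (Z w))
      + \<i> * of_real (LINT w|M. c w * sin (\<theta> w) * indicator A (Z w))"
    by (simp only: integral_mult_right_zero integral_complex_of_real)
  finally show ?thesis using cos sin by simp
qed

text \<open>Indicators replace the factors of the joint characteristic function one at a time.\<close>

lemma (in prob_space) distr_std_normal_of_char:
  fixes Z :: "'i \<Rightarrow> 'a \<Rightarrow> real"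
  assumes I: "finite I" and Z: "\<And>i. i \<in> I \<Longrightarrow> Z i \<in> borel_measurable M"
    and char: "\<And>a. (CLINT w|M. iexp (\<Sum>i\<in>I. a i * Z i w)) = of_real (exp (- (\<Sum>i\<in>I. (a i)\<^sup>2) / 2))"
  shows "distr M (PiM I (\<lambda>_. std_normal_distribution)) (\<lambda>w. \<lambda>i\<in>I. Z i w)
    = PiM I (\<lambda>_. std_normal_distribution)"
proof -
  interpret N: product_sigma_finite "\<lambda>_. std_normal_distribution"
    by (rule product_sigma_finite_std_normal)
  have partial: "(CLINT w|M. of_real (\<Prod>j\<in>J. indicator (A j) (Z j w)) * iexp (\<Sum>i\<in>I - J. a i * Z i w))
      = of_real ((\<Prod>j\<in>J. measure std_normal_distribution (A j)) * exp (- (\<Sum>i\<in>I - J. (a i)\<^sup>2) / 2))"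
    if "finite J" "J \<subseteq> I" and A: "\<And>j. j \<in> J \<Longrightarrow> A j \<in> sets borel" for J and A :: "'i \<Rightarrow> real set" and a
    using that
  proof (induction J arbitrary: a rule: finite_induct)
    case empty
    show ?case by (simp only: prod.empty Diff_empty of_real_1 mult_1 char)
  next
    case (insert l J)
    let ?c = "\<lambda>w. \<Prod>j\<in>J. indicat_real (A j) (Z j w)"
    define K where "K = I - insert l J"
    let ?\<theta> = "\<lambda>a w. \<Sum>i\<in>K. a i * Z i w"
    let ?p = "\<Prod>j\<in>J. measure std_normal_distribution (A j)"
    let ?q = "\<lambda>a. exp (- (\<Sum>i\<in>K. (a i)\<^sup>2) / 2)"
    have split: "I - J = insert l K" "l \<notin> K" "finite K" using insert I by (auto simp: K_def)
    have [measurable]: "Z j \<in> borel_measurable M" if "j \<in> J" for j using that insert Z by auto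
    have [measurable]: "Z l \<in> borel_measurable M" using insert Z by auto
    have [measurable]: "A l \<in> sets borel" using insert by auto
    have \<theta>_meas: "?\<theta> a \<in> borel_measurable M" for a
      using Z by (intro borel_measurable_sum borel_measurable_times borel_measurable_const) (auto simp: K_def)
    have c_meas: "?c \<in> borel_measurable M"
    proof (rule borel_measurable_prod)
      fix j assume "j \<in> J"
      then have [measurable]: "A j \<in> sets borel" "Z j \<in> borel_measurable M" using insert Z by auto
      show "(\<lambda>w. indicat_real (A j) (Z j w)) \<in> borel_measurable M" by measurable
    qed
    \<comment> \<open>A free coefficient \<open>s\<close> at the index \<open>l\<close> recovers the
      characteristic function of \<open>Z l\<close> jointly with the rest; this is why the induction
      keeps the coefficients arbitrary.\<close>
    have IH: "(CLINT w|M. of_real (?c w) * iexp (s * Z l w + ?\<theta> b w))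
        = of_real (?p * ?q b * exp (- s\<^sup>2 / 2))" for s b
    proof -
      have "(\<Sum>i\<in>I - J. (b(l := s)) i * Z i w) = s * Z l w + ?\<theta> b w" for w
        unfolding split(1) sum.insert[OF split(3,2)] using split(2) by (auto intro!: sum.cong)
      moreover have "(\<Sum>i\<in>I - J. ((b(l := s)) i)\<^sup>2) = s\<^sup>2 + (\<Sum>i\<in>K. (b i)\<^sup>2)"
        unfolding split(1) sum.insert[OF split(3,2)] using split(2) by (auto intro!: sum.cong)
      moreover have "(CLINT w|M. of_real (?c w) * iexp (\<Sum>i\<in>I - J. (b(l := s)) i * Z i w))
          = of_real (?p * exp (- (\<Sum>i\<in>I - J. ((b(l := s)) i)\<^sup>2) / 2))"
        using insert.prems by (intro insert.IH) auto
      moreover have "exp (- (s\<^sup>2 + (\<Sum>i\<in>K. (b i)\<^sup>2)) / 2) = ?q b * exp (- s\<^sup>2 / 2)"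
        by (simp add: exp_add[symmetric] field_simps)
      ultimately show ?thesis by (simp only: mult.assoc)
    qed
    have "(CLINT w|M. of_real (?c w * indicator (A l) (Z l w)) * iexp (?\<theta> a w))
        = of_real (?p * ?q a * measure std_normal_distribution (A l))"
    proof (rule normal_factor_step)
      show "0 \<le> ?c w" "?c w \<le> 1" for w by (auto intro!: prod_nonneg prod_le_1)
      show "(CLINT w|M. of_real (?c w) * iexp (s * Z l w)) = of_real (?p * exp (- s\<^sup>2 / 2))" for s
        using IH[of s "\<lambda>_. 0"] by simp
      show "(CLINT w|M. of_real (?c w) * iexp (s * Z l w + ?\<theta> a w)) = of_real (?p * ?q a * exp (- s\<^sup>2 / 2))" for s
        by (rule IH)
      show "(CLINT w|M. of_real (?c w) * iexp (s * Z l w - ?\<theta> a w)) = of_real (?p * ?q a * exp (- s\<^sup>2 / 2))" for s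
        using IH[of s "\<lambda>i. - a i"] by (simp add: sum_negf)
    qed (use c_meas \<theta>_meas in auto)
    then show ?case using insert.hyps unfolding K_def by (simp add: mult_ac)
  qed
  have meas: "(\<lambda>w. \<lambda>i\<in>I. Z i w) \<in> M \<rightarrow>\<^sub>M PiM I (\<lambda>_. std_normal_distribution)"
    using Z by (intro measurable_restrict) simp
  show ?thesis
  proof (rule N.PiM_eqI[OF I])
    fix A :: "'i \<Rightarrow> real set"
    assume A: "\<And>i. i \<in> I \<Longrightarrow> A i \<in> sets std_normal_distribution"
    have "emeasure (distr M (PiM I (\<lambda>_. std_normal_distribution)) (\<lambda>w. \<lambda>i\<in>I. Z i w)) (Pi\<^sub>E I A)
        = emeasure M ((\<lambda>w. \<lambda>i\<in>I. Z i w) -` Pi\<^sub>E I A \<inter> space M)"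
      using A I by (intro emeasure_distr[OF meas] sets_PiM_I_finite) auto
    also have "\<dots> = ennreal (LINT w|M. indicator ((\<lambda>w. \<lambda>i\<in>I. Z i w) -` Pi\<^sub>E I A \<inter> space M) w)"
      by (simp add: emeasure_eq_measure)
    also have "(LINT w|M. indicator ((\<lambda>w. \<lambda>i\<in>I. Z i w) -` Pi\<^sub>E I A \<inter> space M) w)
        = (LINT w|M. (\<Prod>j\<in>I. indicat_real (A j) (Z j w)))"
    proof (intro Bochner_Integration.integral_cong refl)
      fix w assume w: "w \<in> space M"
      show "indicator ((\<lambda>w. \<lambda>i\<in>I. Z i w) -` Pi\<^sub>E I A \<inter> space M) w = (\<Prod>j\<in>I. indicat_real (A j) (Z j w))"
      proof (cases "\<forall>j\<in>I. Z j w \<in> A j")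
        case True
        then show ?thesis using w by (auto simp: indicator_def PiE_def)
      next
        case False
        then obtain j where j: "j \<in> I" "Z j w \<notin> A j" by blast
        then have "(\<lambda>i\<in>I. Z i w) \<notin> Pi\<^sub>E I A" by (auto simp: PiE_def Pi_def)
        moreover have "(\<Prod>j\<in>I. indicat_real (A j) (Z j w)) = 0"
          using j by (intro prod_zero[OF I] bexI[of _ j]) (simp_all add: indicator_def)
        ultimately show ?thesis by (simp only: indicator_def) simp
      qed
    qed
    also have "\<dots> = (\<Prod>j\<in>I. measure std_normal_distribution (A j))"
    proof -
      have "complex_of_real (LINT w|M. (\<Prod>j\<in>I. indicat_real (A j) (Z j w)))
          = (CLINT w|M. of_real (\<Prod>j\<in>I. indicator (A j) (Z j w)))"
        by (rule integral_complex_of_real[symmetric])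
      also have "\<dots> = of_real (\<Prod>j\<in>I. measure std_normal_distribution (A j))"
        using partial[OF I, of A] A by simp
      finally show ?thesis by (simp only: of_real_eq_iff)
    qed
    also have "ennreal \<dots> = (\<Prod>i\<in>I. emeasure std_normal_distribution (A i))"
      using finite_measure.emeasure_eq_measure[OF prob_space.finite_measure[OF prob_space_std_normal]]
      by (simp add: prod_ennreal measure_nonneg)
    finally show "emeasure (distr M (PiM I (\<lambda>_. std_normal_distribution)) (\<lambda>w. \<lambda>i\<in>I. Z i w)) (Pi\<^sub>E I A)
        = (\<Prod>i\<in>I. emeasure std_normal_distribution (A i))" .
  qed simp
qed

text \<open>The condition \<open>char\<close> prescribes the characteristic function at the argument
  1 only, but \<open>S\<close> is a linear space, so it determines the joint law of every finite
  family in \<open>S\<close>. Elements of variance 0 are included.\<close>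

locale gaussian_space = prob_space M for M :: "'a measure" +
  fixes S :: "('a \<Rightarrow> real) set"
  assumes add: "Y \<in> S \<Longrightarrow> Z \<in> S \<Longrightarrow> (\<lambda>w. Y w + Z w) \<in> S"
    and scale: "Y \<in> S \<Longrightarrow> (\<lambda>w. r * Y w) \<in> S"
    and zero: "(\<lambda>w. 0) \<in> S"
    and meas: "Y \<in> S \<Longrightarrow> Y \<in> borel_measurable M"
    and square_integrable: "Y \<in> S \<Longrightarrow> integrable M (\<lambda>w. (Y w)\<^sup>2)"
    and char: "Y \<in> S \<Longrightarrow> (CLINT w|M. iexp (Y w)) = of_real (exp (- (LINT w|M. (Y w)\<^sup>2) / 2))"
begin

lemma sum_mem: "(\<And>i. i \<in> I \<Longrightarrow> Y i \<in> S) \<Longrightarrow> (\<lambda>w. \<Sum>i\<in>I. a i * Y i w) \<in> S"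
proof (induction I rule: infinite_finite_induct)
  case (insert i I)
  then show ?case by (simp add: add scale)
qed (simp_all add: zero)

lemma integrable_product:
  assumes "Y \<in> S" "Z \<in> S"
  shows "integrable M (\<lambda>w. Y w * Z w)"
proof (rule Bochner_Integration.integrable_bound)
  show "integrable M (\<lambda>w. (Y w)\<^sup>2 + (Z w)\<^sup>2)" using assms square_integrable by simp
  show "(\<lambda>w. Y w * Z w) \<in> borel_measurable M" using assms meas by simp
  show "AE w in M. norm (Y w * Z w) \<le> norm ((Y w)\<^sup>2 + (Z w)\<^sup>2)"
  proof (rule AE_I2)
    fix w
    have "2 * \<bar>Y w\<bar> * \<bar>Z w\<bar> \<le> (Y w)\<^sup>2 + (Z w)\<^sup>2" using sum_squares_bound[of "\<bar>Y w\<bar>" "\<bar>Z w\<bar>"] by simp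
    moreover have "0 \<le> \<bar>Y w\<bar> * \<bar>Z w\<bar>" by simp
    ultimately have "\<bar>Y w\<bar> * \<bar>Z w\<bar> \<le> (Y w)\<^sup>2 + (Z w)\<^sup>2" by linarith
    then show "norm (Y w * Z w) \<le> norm ((Y w)\<^sup>2 + (Z w)\<^sup>2)" by (simp add: abs_mult)
  qed
qed

section \<open>Orthonormal coordinates in a Gaussian space\<close>

definition orthonormal :: "nat \<Rightarrow> (nat \<Rightarrow> 'a \<Rightarrow> real) \<Rightarrow> bool" where
  "orthonormal r Z \<longleftrightarrow> (\<forall>i<r. Z i \<in> S) \<and>
    (\<forall>i<r. \<forall>j<r. (LINT w|M. Z i w * Z j w) = (if i = j then 1 else 0))"

lemma orthonormalD:
  assumes "orthonormal r Z"
  shows "i < r \<Longrightarrow> Z i \<in> S"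
    and "i < r \<Longrightarrow> j < r \<Longrightarrow> (LINT w|M. Z i w * Z j w) = (if i = j then 1 else 0)"
  using assms by (auto simp: orthonormal_def)

lemma integral_square_orthonormal:
  assumes "orthonormal r Z"
  shows "(LINT w|M. (\<Sum>i<r. a i * Z i w)\<^sup>2) = (\<Sum>i<r. (a i)\<^sup>2)"
proof -
  note Z = orthonormalD(1)[OF assms] and ortho = orthonormalD(2)[OF assms]
  have "(LINT w|M. (\<Sum>i<r. a i * Z i w)\<^sup>2) = (LINT w|M. (\<Sum>i<r. \<Sum>j<r. (a i * a j) * (Z i w * Z j w)))"
    by (simp add: power2_eq_square sum_product algebra_simps)
  also have "\<dots> = (\<Sum>i<r. LINT w|M. (\<Sum>j<r. (a i * a j) * (Z i w * Z j w)))"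
    by (rule Bochner_Integration.integral_sum)
      (auto intro!: Bochner_Integration.integrable_sum integrable_mult_right integrable_product Z)
  also have "\<dots> = (\<Sum>i<r. \<Sum>j<r. LINT w|M. (a i * a j) * (Z i w * Z j w))"
    by (intro sum.cong refl Bochner_Integration.integral_sum)
      (auto intro!: integrable_mult_right integrable_product Z)
  also have "\<dots> = (\<Sum>i<r. \<Sum>j<r. (a i * a j) * (LINT w|M. Z i w * Z j w))" by simp
  also have "\<dots> = (\<Sum>i<r. \<Sum>j<r. if i = j then (a i)\<^sup>2 else 0)"
    by (intro sum.cong refl) (auto simp: ortho power2_eq_square)
  also have "\<dots> = (\<Sum>i<r. (a i)\<^sup>2)" by (simp add: sum.delta)
  finally show ?thesis .
qed

text \<open>Gram--Schmidt up to null sets. A residual of variance 0 adds no new vector, so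
  degenerate covariances are allowed and \<open>r\<close> may be smaller than the number of
  variables.\<close>

lemma orthonormal_basis:
  assumes "finite F" "F \<subseteq> S"
  shows "\<exists>r Z. orthonormal r Z \<and> (\<forall>Y\<in>F. \<exists>c. AE w in M. Y w = (\<Sum>i<r. c i * Z i w))" using assms
proof (induction F rule: finite_induct)
  case empty
  then show ?case by (intro exI[of _ 0]) (auto simp: orthonormal_def)
next
  case (insert Y F)
  then obtain r Z where basis: "orthonormal r Z"
    and F: "\<forall>Y\<in>F. \<exists>c. AE w in M. Y w = (\<Sum>i<r. c i * Z i w)" by blast
  note Z = orthonormalD(1)[OF basis] and ortho = orthonormalD(2)[OF basis]
  define c where "c i = (LINT w|M. Y w * Z i w)" for i
  define R where "R w = Y w - (\<Sum>i<r. c i * Z i w)" for w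
  have Y: "Y \<in> S" using insert by auto
  have "(\<lambda>w. (-1) * (\<Sum>i<r. c i * Z i w)) \<in> S" using Z by (intro scale sum_mem) auto
  from add[OF Y this] have R: "R \<in> S" unfolding R_def by (simp add: algebra_simps)
  have R_ortho: "(LINT w|M. R w * Z j w) = 0" if "j < r" for j
  proof -
    have "(LINT w|M. R w * Z j w) = (LINT w|M. Y w * Z j w - (\<Sum>i<r. c i * (Z i w * Z j w)))"
      by (simp add: R_def algebra_simps sum_distrib_right sum_distrib_left)
    also have "\<dots> = (LINT w|M. Y w * Z j w) - (LINT w|M. (\<Sum>i<r. c i * (Z i w * Z j w)))"
      using Y Z that by (intro Bochner_Integration.integral_diff Bochner_Integration.integrable_sum
          integrable_mult_right integrable_product) auto
    also have "(LINT w|M. (\<Sum>i<r. c i * (Z i w * Z j w))) = (\<Sum>i<r. LINT w|M. c i * (Z i w * Z j w))"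
      using Z that by (intro Bochner_Integration.integral_sum integrable_mult_right integrable_product) auto
    also have "\<dots> = (\<Sum>i<r. c i * (LINT w|M. Z i w * Z j w))" by simp
    also have "(\<Sum>i<r. c i * (LINT w|M. Z i w * Z j w)) = (\<Sum>i<r. if i = j then c j else 0)"
      using that by (intro sum.cong) (auto simp: ortho)
    finally show ?thesis using that by (simp add: c_def)
  qed
  define n where "n = (LINT w|M. (R w)\<^sup>2)"
  have n0: "n \<ge> 0" unfolding n_def by simp
  show ?case
  proof (cases "n = 0")
    case True
    then have "AE w in M. (R w)\<^sup>2 = 0"
      using integral_nonneg_eq_0_iff_AE[OF square_integrable[OF R]] by (simp add: n_def)
    then have "AE w in M. Y w = (\<Sum>i<r. c i * Z i w)" by eventually_elim (simp add: R_def)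
    then show ?thesis using basis F by (intro exI[of _ r] exI[of _ Z]) auto
  next
    case False
    with n0 have n: "n > 0" by simp
    define Z' where "Z' i = (if i = r then (\<lambda>w. 1 / sqrt n * R w) else Z i)" for i
    have Z': "Z' i \<in> S" if "i < Suc r" for i
      using that Z R scale[of R "1 / sqrt n"] by (auto simp: Z'_def less_Suc_eq)
    have "(LINT w|M. Z' i w * Z' j w) = (if i = j then 1 else 0)" if ij: "i < Suc r" "j < Suc r" for i j
    proof -
      consider "i < r" "j < r" | "i = r" "j < r" | "i < r" "j = r" | "i = r" "j = r"
        using ij by (auto simp: less_Suc_eq)
      then show ?thesis
      proof cases
        case 4
        then have "(LINT w|M. Z' i w * Z' j w) = (LINT w|M. 1 / n * (R w)\<^sup>2)"
          using n by (intro Bochner_Integration.integral_cong) (auto simp: Z'_def power2_eq_square)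
        then show ?thesis using n 4 by (simp add: n_def[symmetric])
      next
        case 2
        then have "(LINT w|M. Z' i w * Z' j w) = (LINT w|M. 1 / sqrt n * (R w * Z j w))"
          by (simp add: Z'_def mult.assoc)
        then show ?thesis using 2 R_ortho by (simp only: integral_mult_right_zero) auto
      next
        case 3
        then have "(LINT w|M. Z' i w * Z' j w) = (LINT w|M. 1 / sqrt n * (R w * Z i w))"
          by (simp add: Z'_def mult_ac)
        then show ?thesis using 3 R_ortho by (simp only: integral_mult_right_zero) auto
      qed (use ortho in \<open>auto simp: Z'_def\<close>)
    qed
    moreover have "\<exists>c. AE w in M. X w = (\<Sum>i<Suc r. c i * Z' i w)" if "X \<in> insert Y F" for X
    proof (cases "X = Y")
      case True
      have "X w = (\<Sum>i<Suc r. (c(r := sqrt n)) i * Z' i w)" for w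
        using n by (simp add: True Z'_def R_def)
      then show ?thesis by blast
    next
      case False
      then obtain c' where c': "AE w in M. X w = (\<Sum>i<r. c' i * Z i w)"
        using F \<open>X \<in> insert Y F\<close> by auto
      have "(\<Sum>i<Suc r. (c'(r := 0)) i * Z' i w) = (\<Sum>i<r. c' i * Z i w)" for w by (simp add: Z'_def)
      then have "AE w in M. X w = (\<Sum>i<Suc r. (c'(r := 0)) i * Z' i w)" using c' by simp
      then show ?thesis by blast
    qed
    ultimately show ?thesis
      using Z' by (intro exI[of _ "Suc r"] exI[of _ Z']) (auto simp: orthonormal_def)
  qed
qed

text \<open>The map \<open>L\<close> from orthonormal coordinates to the family \<open>Y\<close> is \<open>\<sigma>\<close>-Lipschitz from the
  Euclidean to the \<open>\<ell>\<^sup>1\<close> norm, by duality between \<open>\<ell>\<^sup>1\<close> and sign vectors.\<close>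

lemma distance_exponential_moment:
  fixes Y :: "'j \<Rightarrow> 'a \<Rightarrow> real" and \<Phi> :: "('j \<Rightarrow> real) \<Rightarrow> real"
  assumes J: "finite J" and Y: "\<And>j. j \<in> J \<Longrightarrow> Y j \<in> S" and \<sigma>: "\<sigma> > 0"
    and cov: "\<And>\<epsilon>. (\<And>j. \<bar>\<epsilon> j\<bar> \<le> 1) \<Longrightarrow> (LINT w|M. (\<Sum>j\<in>J. \<epsilon> j * Y j w)\<^sup>2) \<le> \<sigma>\<^sup>2"
    and A: "A \<in> sets (PiM J (\<lambda>_. borel))"
    and \<Phi>: "\<Phi> \<in> borel_measurable (PiM J (\<lambda>_. borel))" "\<And>y. 0 \<le> \<Phi> y"
      "\<And>y a. y \<in> extensional J \<Longrightarrow> a \<in> A \<Longrightarrow> \<Phi> y \<le> (\<Sum>j\<in>J. \<bar>y j - a j\<bar>)"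
  shows "(\<integral>\<^sup>+w. ennreal (exp ((\<Phi> (\<lambda>j\<in>J. Y j w))\<^sup>2 / (4 * \<sigma>\<^sup>2))) \<partial>M)
    * emeasure M {w\<in>space M. (\<lambda>j\<in>J. Y j w) \<in> A} \<le> 1"
proof -
  let ?N = "\<lambda>_::nat. std_normal_distribution"
  have "finite (Y ` J)" "Y ` J \<subseteq> S" using J Y by auto
  from orthonormal_basis[OF this] obtain r Z where basis: "orthonormal r Z"
    and "\<forall>X\<in>Y ` J. \<exists>c. AE w in M. X w = (\<Sum>i<r. c i * Z i w)" by blast
  note Z = orthonormalD(1)[OF basis]
  have "\<forall>j\<in>J. \<exists>c. AE w in M. Y j w = (\<Sum>i<r. c i * Z i w)" using \<open>\<forall>X\<in>Y ` J. _ X\<close> by simp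
  then obtain c where c: "\<And>j. j \<in> J \<Longrightarrow> AE w in M. Y j w = (\<Sum>i<r. c j i * Z i w)" by metis
  have Z_meas: "Z i \<in> borel_measurable M" if "i < r" for i using Z[OF that] meas by simp
  have law: "distr M (PiM {..<r} ?N) (\<lambda>w. \<lambda>i\<in>{..<r}. Z i w) = PiM {..<r} ?N"
  proof (rule distr_std_normal_of_char)
    fix a
    have "(\<lambda>w. \<Sum>i<r. a i * Z i w) \<in> S" using Z by (intro sum_mem) auto
    from char[OF this] show "(CLINT w|M. iexp (\<Sum>i<r. a i * Z i w)) = of_real (exp (- (\<Sum>i<r. (a i)\<^sup>2) / 2))"
      by (simp only: integral_square_orthonormal[OF basis])
  qed (use Z_meas in auto)
  define L where "L x = (\<lambda>j\<in>J. \<Sum>i<r. c j i * x i)" for x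
  have L_meas: "L \<in> PiM {..<r} ?N \<rightarrow>\<^sub>M PiM J (\<lambda>_. borel)" unfolding L_def
  proof (rule measurable_restrict)
    fix j
    have "(\<lambda>x. x i) \<in> borel_measurable (PiM {..<r} ?N)" if "i < r" for i
      using measurable_component_singleton[of i "{..<r}" ?N] that by simp
    then show "(\<lambda>x. \<Sum>i<r. c j i * x i) \<in> borel_measurable (PiM {..<r} ?N)"
      by (intro borel_measurable_sum borel_measurable_times borel_measurable_const) auto
  qed
  have Z'_meas: "(\<lambda>w. \<lambda>i\<in>{..<r}. Z i w) \<in> M \<rightarrow>\<^sub>M PiM {..<r} ?N"
    using Z_meas by (intro measurable_restrict) simp
  have YL: "AE w in M. (\<lambda>j\<in>J. Y j w) = L (\<lambda>i\<in>{..<r}. Z i w)"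
  proof -
    have "AE w in M. \<forall>j\<in>J. Y j w = (\<Sum>i<r. c j i * Z i w)" using c J by (intro AE_finite_allI) auto
    then show ?thesis by eventually_elim (auto simp: L_def fun_eq_iff intro!: sum.cong)
  qed
  have lip: "(\<Sum>j\<in>J. \<bar>L x j - L y j\<bar>)\<^sup>2 \<le> \<sigma>\<^sup>2 * (\<Sum>i<r. (x i - y i)\<^sup>2)" for x y
  proof -
    define \<epsilon> where "\<epsilon> j = sgn (L x j - L y j)" for j
    have \<epsilon>: "\<bar>\<epsilon> j\<bar> \<le> 1" for j by (simp add: \<epsilon>_def sgn_if)
    have "(\<Sum>j\<in>J. \<bar>L x j - L y j\<bar>) = (\<Sum>j\<in>J. \<epsilon> j * (\<Sum>i<r. c j i * (x i - y i)))"
      by (intro sum.cong refl)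
        (simp add: \<epsilon>_def L_def abs_sgn right_diff_distrib sum_subtractf mult.commute)
    also have "\<dots> = (\<Sum>i<r. (\<Sum>j\<in>J. \<epsilon> j * c j i) * (x i - y i))"
      by (simp add: sum_distrib_left sum_distrib_right mult.assoc sum.swap[of _ J])
    finally have "(\<Sum>j\<in>J. \<bar>L x j - L y j\<bar>)\<^sup>2
        \<le> (\<Sum>i<r. (\<Sum>j\<in>J. \<epsilon> j * c j i)\<^sup>2) * (\<Sum>i<r. (x i - y i)\<^sup>2)"
      by (simp add: Cauchy_Schwarz_ineq_sum)
    \<comment> \<open>Orthonormality turns the squared Euclidean norm of the coefficients into the
      variance of a signed sum of the \<open>Y j\<close>, to which \<open>cov\<close>
      applies.\<close>
    also have "(\<Sum>i<r. (\<Sum>j\<in>J. \<epsilon> j * c j i)\<^sup>2) = (LINT w|M. (\<Sum>i<r. (\<Sum>j\<in>J. \<epsilon> j * c j i) * Z i w)\<^sup>2)"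
      by (rule integral_square_orthonormal[OF basis, symmetric])
    also have "\<dots> = (LINT w|M. (\<Sum>j\<in>J. \<epsilon> j * Y j w)\<^sup>2)"
    proof (rule integral_cong_AE)
      show "AE w in M. (\<Sum>i<r. (\<Sum>j\<in>J. \<epsilon> j * c j i) * Z i w)\<^sup>2 = (\<Sum>j\<in>J. \<epsilon> j * Y j w)\<^sup>2"
      proof -
        have "AE w in M. \<forall>j\<in>J. Y j w = (\<Sum>i<r. c j i * Z i w)"
          using c J by (intro AE_finite_allI) auto
        then show ?thesis
          by eventually_elim (simp add: sum_distrib_left sum_distrib_right mult.assoc sum.swap[of _ J])
      qed
      have [measurable]: "Y j \<in> borel_measurable M" if "j \<in> J" for j using Y that meas by simp
      show "(\<lambda>w. (\<Sum>j\<in>J. \<epsilon> j * Y j w)\<^sup>2) \<in> borel_measurable M" by measurable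
      show "(\<lambda>w. (\<Sum>i<r. (\<Sum>j\<in>J. \<epsilon> j * c j i) * Z i w)\<^sup>2) \<in> borel_measurable M"
        using Z_meas by (intro borel_measurable_power borel_measurable_sum borel_measurable_times borel_measurable_const) auto
    qed
    also have "\<dots> \<le> \<sigma>\<^sup>2" using \<epsilon> by (rule cov)
    finally show ?thesis by (simp add: mult_right_mono sum_nonneg)
  qed
  \<comment> \<open>The transport property is applied to the exponential of the squared distance and
    to the indicator of \<open>A\<close>, both pulled back by \<open>L\<close>. Where the indicator
    is 1, \<open>\<Phi>\<close> is at most the distance of the two images, and the Lipschitz bound
    makes the exponents match.\<close>
  let ?u = "\<lambda>x. ennreal (exp ((\<Phi> (L x))\<^sup>2 / (4 * \<sigma>\<^sup>2)))"
  let ?v = "\<lambda>x. indicator A (L x) :: ennreal"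
  have u_meas: "?u \<in> borel_measurable (PiM {..<r} ?N)"
    using measurable_compose[OF L_meas \<Phi>(1)] by measurable
  have v_meas: "?v \<in> borel_measurable (PiM {..<r} ?N)"
    using measurable_compose[OF L_meas borel_measurable_indicator[OF A]] .
  have "(\<integral>\<^sup>+x. ?u x \<partial>PiM {..<r} ?N) * (\<integral>\<^sup>+x. ?v x \<partial>PiM {..<r} ?N) \<le> 1"
  proof (rule gaussian_tau[OF _ u_meas v_meas])
    fix x y :: "nat \<Rightarrow> real"
    show "?u x * ?v y \<le> ennreal (exp ((\<Sum>i<r. (x i - y i)\<^sup>2) / 4))"
    proof (cases "L y \<in> A")
      case True
      have "\<Phi> (L x) \<le> (\<Sum>j\<in>J. \<bar>L x j - L y j\<bar>)" by (rule \<Phi>(3)[OF _ True]) (simp add: L_def)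
      then have "(\<Phi> (L x))\<^sup>2 \<le> \<sigma>\<^sup>2 * (\<Sum>i<r. (x i - y i)\<^sup>2)"
        using \<Phi>(2) lip by (meson order_trans power_mono)
      then have "(\<Phi> (L x))\<^sup>2 / (4 * \<sigma>\<^sup>2) \<le> (\<Sum>i<r. (x i - y i)\<^sup>2) / 4"
        using \<sigma> by (simp add: field_simps)
      then show ?thesis using True by (auto intro!: ennreal_leI)
    qed simp
  qed simp
  moreover have law_integral: "(\<integral>\<^sup>+x. g x \<partial>PiM {..<r} ?N) = (\<integral>\<^sup>+w. g (\<lambda>i\<in>{..<r}. Z i w) \<partial>M)"
    if "g \<in> borel_measurable (PiM {..<r} ?N)" for g
    using nn_integral_distr[OF Z'_meas, of g] that by (simp add: law)
  moreover have "(\<integral>\<^sup>+x. ?u x \<partial>PiM {..<r} ?N)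
      = (\<integral>\<^sup>+w. ennreal (exp ((\<Phi> (\<lambda>j\<in>J. Y j w))\<^sup>2 / (4 * \<sigma>\<^sup>2))) \<partial>M)"
    unfolding law_integral[OF u_meas]
    by (rule nn_integral_cong_AE) (use YL in eventually_elim, simp)
  moreover have "(\<integral>\<^sup>+x. ?v x \<partial>PiM {..<r} ?N) = emeasure M {w\<in>space M. (\<lambda>j\<in>J. Y j w) \<in> A}"
  proof -
    have "(\<lambda>w. \<lambda>j\<in>J. Y j w) \<in> M \<rightarrow>\<^sub>M PiM J (\<lambda>_. borel)"
      using Y meas by (intro measurable_restrict) auto
    from measurable_sets[OF this A]
    have sets: "{w\<in>space M. (\<lambda>j\<in>J. Y j w) \<in> A} \<in> sets M"
      by (simp add: vimage_def Int_def conj_commute)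
    have "(\<integral>\<^sup>+x. ?v x \<partial>PiM {..<r} ?N) = (\<integral>\<^sup>+w. indicator {w\<in>space M. (\<lambda>j\<in>J. Y j w) \<in> A} w \<partial>M)"
      unfolding law_integral[OF v_meas]
      by (rule nn_integral_cong_AE) (use YL AE_space in \<open>eventually_elim, auto simp: indicator_def\<close>)
    then show ?thesis using sets by simp
  qed
  ultimately show ?thesis by simp
qed

end

section \<open>Fractional Brownian motion on a uniform grid\<close>

text \<open>Both endpoints are moved inwards to even indices at the cost of at most one edge each,
  and the path \<open>b (2 * k)\<close> is treated in the same way: its level \<open>r\<close> is
  level \<open>r + 1\<close> of \<open>b\<close>, so \<open>D\<close> becomes \<open>D * l\<close>.
  Hence at most two edges of every level are used.\<close>

lemma dyadic_chaining:
  fixes b :: "nat \<Rightarrow> 'a::real_normed_vector"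
  assumes "D \<ge> 0" and l: "l > 1"
    and "\<And>r k. (k + 1) * 2 ^ r \<le> N \<Longrightarrow> norm (b ((k + 1) * 2 ^ r) - b (k * 2 ^ r)) \<le> D * l ^ r"
    and "i \<le> j" "j \<le> N" "j - i \<le> 2 ^ s"
  shows "norm (b j - b i) \<le> 2 * D * (\<Sum>r\<le>s. l ^ r)" using assms(1) assms(3-)
proof (induction s arbitrary: b D N i j)
  case 0
  then consider "i = j" | "j = i + 1" by force
  then show ?case using "0.prems"(2)[of i 0] 0 by cases auto
next
  case (Suc s)
  \<comment> \<open>The left end is rounded up and the right end down; if they cross, then
    \<open>i = j\<close>.\<close>
  define i' j' where "i' = (i + 1) div 2" and "j' = j div 2"
  have D: "D \<ge> 0" by fact
  have edge: "norm (b (k + 1) - b k) \<le> D" if "k + 1 \<le> N" for k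
    using Suc.prems(2)[of k 0] that by simp
  show ?case
  proof (cases "i' \<le> j'")
    case False
    then have "i = j" using Suc.prems(3) by (simp add: i'_def j'_def)
    then show ?thesis using D l by (simp add: sum_nonneg)
  next
    case True
    have "norm (b (2 * j') - b (2 * i')) \<le> 2 * (D * l) * (\<Sum>r\<le>s. l ^ r)"
    proof (rule Suc.IH[of "D * l" "N div 2" "\<lambda>k. b (2 * k)" i' j'])
      show "0 \<le> D * l" using D l by simp
      show "norm (b (2 * ((k + 1) * 2 ^ r)) - b (2 * (k * 2 ^ r))) \<le> D * l * l ^ r"
        if "(k + 1) * 2 ^ r \<le> N div 2" for r k
      proof -
        have "(k + 1) * 2 ^ Suc r \<le> N" using that by simp
        from Suc.prems(2)[OF this] show ?thesis by (simp add: mult_ac)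
      qed
      show "i' \<le> j'" by fact
      show "j' \<le> N div 2" using Suc.prems(4) by (simp add: j'_def div_le_mono)
      show "j' - i' \<le> 2 ^ s" using Suc.prems(5) by (simp add: i'_def j'_def)
    qed
    moreover have "norm (b j - b (2 * j')) \<le> D"
    proof -
      have "j = 2 * j' \<or> j = 2 * j' + 1" unfolding j'_def by linarith
      then show ?thesis
      proof
        assume "j = 2 * j' + 1"
        then show ?thesis using edge[of "2 * j'"] Suc.prems(4) by simp
      qed (use D in simp)
    qed
    moreover have "norm (b (2 * i') - b i) \<le> D"
    proof -
      have "2 * i' \<le> N" using True Suc.prems(4) by (simp add: i'_def j'_def)
      have "2 * i' = i \<or> 2 * i' = i + 1" unfolding i'_def by linarith
      then show ?thesis
      proof
        assume "2 * i' = i + 1"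
        then show ?thesis using edge[of i] \<open>2 * i' \<le> N\<close> by simp
      qed (use D in simp)
    qed
    moreover have "norm (b j - b i)
        \<le> norm (b j - b (2 * j')) + (norm (b (2 * j') - b (2 * i')) + norm (b (2 * i') - b i))"
      using norm_triangle_ineq[of "b j - b (2 * j')" "b (2 * j') - b i"]
        norm_triangle_ineq[of "b (2 * j') - b (2 * i')" "b (2 * i') - b i"] by simp
    ultimately have "norm (b j - b i) \<le> 2 * D + 2 * (D * l) * (\<Sum>r\<le>s. l ^ r)" by linarith
    also have "\<dots> = 2 * D * (\<Sum>r\<le>Suc s. l ^ r)"
      by (subst sum.atMost_Suc_shift) (simp add: sum_distrib_left algebra_simps)
    finally show ?thesis .
  qed
qed

text \<open>With ratio \<open>2 powr \<gamma>\<close> the geometric sum is dominated by its last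
  term, which is comparable to \<open>(real j - real i) powr \<gamma>\<close> by the minimality of
  the level \<open>s\<close>. In the constant, one factor \<open>2 powr \<gamma>\<close> comes from
  the sum and one from that comparison.\<close>

lemma dyadic_chaining_holder:
  fixes b :: "nat \<Rightarrow> 'a::real_normed_vector"
  assumes D: "D \<ge> 0" and \<gamma>: "\<gamma> > 0"
    and level: "\<And>r k. (k + 1) * 2 ^ r \<le> N \<Longrightarrow>
      norm (b ((k + 1) * 2 ^ r) - b (k * 2 ^ r)) \<le> D * (2 powr \<gamma>) ^ r"
    and ij: "i \<le> j" "j \<le> N"
  shows "norm (b j - b i) \<le> 2 * (2 powr \<gamma>)\<^sup>2 / (2 powr \<gamma> - 1) * D * (real j - real i) powr \<gamma>"
proof (cases "i = j")
  case True
  then show ?thesis by simp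
next
  case False
  let ?l = "2 powr \<gamma>"
  have l: "?l > 1" using \<gamma> by simp
  define s where "s = (LEAST s. j - i \<le> 2 ^ s)"
  have s: "j - i \<le> 2 ^ s" unfolding s_def by (rule LeastI[of _ "j - i"]) (simp add: less_imp_le)
  have "?l ^ s \<le> ?l * (real j - real i) powr \<gamma>"
  proof (cases s)
    case 0
    have "1 \<le> (real j - real i) powr \<gamma>" using False ij \<gamma> by (intro ge_one_powr_ge_zero) auto
    then show ?thesis using l 0 mult_mono[of 1 ?l 1 "(real j - real i) powr \<gamma>"] by simp
  next
    case (Suc t)
    then have "\<not> j - i \<le> 2 ^ t" unfolding s_def by (metis lessI not_less_Least)
    then have "2 ^ t + i \<le> j" using ij by simp
    then have "real (2 ^ t + i) \<le> real j" by (simp only: of_nat_le_iff)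
    then have "(2::real) ^ t \<le> real j - real i" by simp
    then have "(2 ^ t) powr \<gamma> \<le> (real j - real i) powr \<gamma>" using \<gamma> by (intro powr_mono2) auto
    moreover have "(2 ^ t) powr \<gamma> = ?l ^ t"
      by (simp add: powr_powr powr_realpow[symmetric] mult.commute)
    ultimately show ?thesis using l Suc by simp
  qed
  have "norm (b j - b i) \<le> 2 * D * (\<Sum>r\<le>s. ?l ^ r)" by (rule dyadic_chaining[OF D l level ij s])
  also have "(\<Sum>r\<le>s. ?l ^ r) = (?l ^ Suc s - 1) / (?l - 1)"
    unfolding lessThan_Suc_atMost[symmetric] using l by (intro geometric_sum) auto
  finally have "norm (b j - b i) \<le> 2 * D * ((?l ^ Suc s - 1) / (?l - 1))" .
  also have "\<dots> \<le> 2 * D * (?l * (?l * (real j - real i) powr \<gamma>) / (?l - 1))"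
  proof (intro mult_left_mono divide_right_mono)
    have "?l ^ Suc s \<le> ?l * (?l * (real j - real i) powr \<gamma>)"
      using \<open>?l ^ s \<le> ?l * (real j - real i) powr \<gamma>\<close> l by simp
    then show "?l ^ Suc s - 1 \<le> ?l * (?l * (real j - real i) powr \<gamma>)" by linarith
  qed (use D l in auto)
  finally show ?thesis by (simp add: power2_eq_square mult_ac)
qed

text \<open>Midpoint convexity of the power. With \<open>p = 2 * H\<close> this is where
  \<open>H > 1/2\<close> enters the correlation of the increments. The case \<open>n = 1\<close> is
  separate because the left point is then 0.\<close>

lemma powr_second_difference:
  fixes p h :: real and n :: nat
  assumes "p \<ge> 1" "n \<ge> 1" "h > 0"
  shows "2 * (h * real n) powr p \<le> (h * (real n + 1)) powr p + (h * (real n - 1)) powr p"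
proof (cases "n = 1")
  case True
  have "2 \<le> 2 powr p" using assms powr_mono[of 1 p 2] by simp
  then show ?thesis using True assms by (simp add: powr_mult)
next
  case False
  then have "h * (real n - 1) > 0" "h * (real n + 1) > 0" using assms by auto
  from convex_onD[OF powr_convex[OF assms(1)], of "1/2" "h * (real n - 1)" "h * (real n + 1)"] this
  have "((1 / 2) * (h * (real n - 1)) + (1 / 2) * (h * (real n + 1))) powr p
      \<le> (1 / 2) * (h * (real n - 1)) powr p + (1 / 2) * (h * (real n + 1)) powr p"
    by simp
  moreover have "(1 / 2) * (h * (real n - 1)) + (1 / 2) * (h * (real n + 1)) = h * real n"
    by (simp add: algebra_simps)
  ultimately show ?thesis by simp
qed

lemma sum_power_two_le:
  assumes "m > 0"
  shows "(\<Sum>r | 2 ^ r \<le> m. (2::real) ^ r) \<le> 2 * real m"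
proof -
  have fin: "finite {r. (2::nat) ^ r \<le> m}"
    by (rule finite_subset[of _ "{..m}"]) (auto intro: order_trans[OF less_imp_le[OF less_exp]])
  define p where "p = Max {r. (2::nat) ^ r \<le> m}"
  have "0 \<in> {r. (2::nat) ^ r \<le> m}" using assms by simp
  then have "p \<in> {r. (2::nat) ^ r \<le> m}" unfolding p_def using Max_in[OF fin] by blast
  then have p: "(2::nat) ^ p \<le> m" by simp
  have "(\<Sum>r | 2 ^ r \<le> m. (2::real) ^ r) \<le> (\<Sum>r<Suc p. (2::real) ^ r)"
    by (rule sum_mono2) (use Max_ge[OF fin] in \<open>auto simp: p_def less_Suc_eq_le\<close>)
  also have "\<dots> = 2 * 2 ^ p - 1" by (subst geometric_sum) auto
  also have "\<dots> \<le> 2 * real m"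
  proof -
    have "(2::real) ^ p \<le> real m" using p by (metis of_nat_le_iff of_nat_numeral of_nat_power)
    then show ?thesis by linarith
  qed
  finally show ?thesis .
qed

section \<open>Moments, tails and characteristic functions of Gaussian variables\<close>

context prob_space
begin

lemma gaussian_variable_cases:
  assumes "gaussian_variable M Y" "expectation Y = 0"
  shows "(AE w in M. Y w = 0) \<or> (\<exists>\<sigma>>0. distributed M lborel Y (normal_density 0 \<sigma>))"
proof -
  from assms(1) obtain m
    where m: "(AE w in M. Y w = m) \<or> (\<exists>\<sigma>>0. distributed M lborel Y (normal_density m \<sigma>))"
      and [measurable]: "Y \<in> borel_measurable M" by (auto simp: gaussian_variable_def)
  have "m = 0"
  proof (cases "AE w in M. Y w = m")
    case True
    then have "expectation Y = expectation (\<lambda>w. m)" by (intro integral_cong_AE) auto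
    then show ?thesis using assms(2) prob_space by simp
  next
    case False
    then show ?thesis using m assms(2) normal_distributed_expectation by metis
  qed
  then show ?thesis using m by simp
qed

lemma gaussian_variable_integrable:
  assumes "gaussian_variable M Y"
  shows "integrable M Y"
proof -
  from assms obtain m
    where m: "(AE w in M. Y w = m) \<or> (\<exists>\<sigma>>0. distributed M lborel Y (normal_density m \<sigma>))"
      and [measurable]: "Y \<in> borel_measurable M" by (auto simp: gaussian_variable_def)
  from m show ?thesis
  proof
    assume "AE w in M. Y w = m"
    then show ?thesis by (subst integrable_cong_AE[of _ _ "\<lambda>_. m"]) auto
  next
    assume "\<exists>\<sigma>>0. distributed M lborel Y (normal_density m \<sigma>)"
    then obtain \<sigma> where "\<sigma> > 0" and D: "distributed M lborel Y (normal_density m \<sigma>)" by auto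
    then show ?thesis
      using integrable_normal_moment_nz_1[of \<sigma> m] by (intro distributed_integrable_var[OF D]) auto
  qed
qed

text \<open>The quotient of factorials is the double factorial (2k - 1)!!. Expressing the moment
  through the variance covers the degenerate case as well.\<close>

lemma gaussian_variable_moments:
  assumes Y: "gaussian_variable M Y" "expectation Y = 0" and k: "k > 0"
  shows "integrable M (\<lambda>w. Y w ^ (2 * k))"
    and "expectation (\<lambda>w. Y w ^ (2 * k)) = fact (2 * k) / (2 ^ k * fact k) * expectation (\<lambda>w. (Y w)\<^sup>2) ^ k"
proof -
  have [measurable]: "Y \<in> borel_measurable M" using Y by (simp add: gaussian_variable_def)
  have "integrable M (\<lambda>w. Y w ^ (2 * k)) \<and>
    expectation (\<lambda>w. Y w ^ (2 * k)) = fact (2 * k) / (2 ^ k * fact k) * expectation (\<lambda>w. (Y w)\<^sup>2) ^ k"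
    using gaussian_variable_cases[OF Y]
  proof
    assume "AE w in M. Y w = 0"
    then have ae: "AE w in M. Y w ^ (2 * k) = 0" "AE w in M. (Y w)\<^sup>2 = 0"
      using k by (auto simp: power_0_left)
    have "integrable M (\<lambda>w. Y w ^ (2 * k))"
      using ae by (subst integrable_cong_AE[of _ _ "\<lambda>_. 0"]) auto
    moreover have "expectation (\<lambda>w. Y w ^ (2 * k)) = expectation (\<lambda>w. 0)"
      using ae by (intro integral_cong_AE) auto
    moreover have "expectation (\<lambda>w. (Y w)\<^sup>2) = expectation (\<lambda>w. 0)"
      using ae by (intro integral_cong_AE) auto
    ultimately show ?thesis using k by simp
  next
    assume "\<exists>\<sigma>>0. distributed M lborel Y (normal_density 0 \<sigma>)"
    then obtain \<sigma> where \<sigma>: "\<sigma> > 0" and D: "distributed M lborel Y (normal_density 0 \<sigma>)" by auto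
    have moment: "integrable M (\<lambda>w. Y w ^ (2 * n)) \<and> expectation (\<lambda>w. Y w ^ (2 * n)) = fact (2 * n) / ((2 / \<sigma>\<^sup>2) ^ n * fact n)" for n
      using normal_moment_even[OF \<sigma>, of 0 n]
        distributed_integral[OF D, of "\<lambda>x. x ^ (2 * n)"] distributed_integrable[OF D, of "\<lambda>x. x ^ (2 * n)"]
      by (simp add: has_bochner_integral_iff)
    have "expectation (\<lambda>w. (Y w)\<^sup>2) = \<sigma>\<^sup>2" using moment[of 1] \<sigma> by (simp add: eval_nat_numeral)
    then show ?thesis using moment[of k] by (simp add: power_divide)
  qed
  then show "integrable M (\<lambda>w. Y w ^ (2 * k))"
    and "expectation (\<lambda>w. Y w ^ (2 * k)) = fact (2 * k) / (2 ^ k * fact k) * expectation (\<lambda>w. (Y w)\<^sup>2) ^ k"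
    by auto
qed

lemma gaussian_variable_char:
  assumes Y: "gaussian_variable M Y" "expectation Y = 0"
  shows "(CLINT w|M. iexp (Y w)) = of_real (exp (- expectation (\<lambda>w. (Y w)\<^sup>2) / 2))"
proof -
  have [measurable]: "Y \<in> borel_measurable M" using Y by (simp add: gaussian_variable_def)
  show ?thesis using gaussian_variable_cases[OF Y]
  proof
    assume ae: "AE w in M. Y w = 0"
    have "(CLINT w|M. iexp (Y w)) = (CLINT w|M. 1)" using ae by (intro integral_cong_AE) auto
    moreover have "expectation (\<lambda>w. (Y w)\<^sup>2) = expectation (\<lambda>w. 0)"
      using ae by (intro integral_cong_AE) auto
    ultimately show ?thesis by (simp add: prob_space)
  next
    assume "\<exists>\<sigma>>0. distributed M lborel Y (normal_density 0 \<sigma>)"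
    then obtain \<sigma> where \<sigma>: "\<sigma> > 0" and D: "distributed M lborel Y (normal_density 0 \<sigma>)" by auto
    have var: "expectation (\<lambda>w. (Y w)\<^sup>2) = \<sigma>\<^sup>2" using normal_distributed_variance[OF \<sigma> D] Y(2) by simp
    have "distributed M lborel (\<lambda>w. Y w / \<sigma>) std_normal_density"
      using D normal_standard_normal_convert[OF \<sigma>, of Y 0] by simp
    then have "distr M lborel (\<lambda>w. Y w / \<sigma>) = std_normal_distribution"
      by (rule distributed_distr_eq_density)
    moreover have "distr M borel (\<lambda>w. Y w / \<sigma>) = distr M lborel (\<lambda>w. Y w / \<sigma>)"
      by (rule distr_cong) auto
    ultimately have law: "distr M borel (\<lambda>w. Y w / \<sigma>) = std_normal_distribution" by simp
    have "(CLINT w|M. iexp (Y w)) = char (distr M borel (\<lambda>w. Y w / \<sigma>)) \<sigma>"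
      unfolding char_def using \<sigma> by (subst integral_distr) auto
    then show ?thesis by (simp add: law char_std_normal_distribution var)
  qed
qed

text \<open>Markov's inequality for an even power. A polynomial tail of high enough order outweighs
  the number of dyadic edges in the union bound.\<close>

lemma gaussian_variable_tail:
  assumes Y: "gaussian_variable M Y" "expectation Y = 0" and k: "k > 0" and r: "r > 0"
  shows "prob {w\<in>space M. \<bar>Y w\<bar> > r}
    \<le> fact (2 * k) / (2 ^ k * fact k) * expectation (\<lambda>w. (Y w)\<^sup>2) ^ k / r ^ (2 * k)"
proof -
  have [measurable]: "Y \<in> borel_measurable M" using Y by (simp add: gaussian_variable_def)
  have pow: "Y w ^ (2 * k) = \<bar>Y w\<bar> ^ (2 * k)" for w by (simp add: power_even_abs)
  have "prob {w\<in>space M. \<bar>Y w\<bar> > r} \<le> prob {w\<in>space M. r ^ (2 * k) \<le> Y w ^ (2 * k)}"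
    using r by (intro finite_measure_mono) (auto simp: pow intro!: power_mono)
  also have "\<dots> \<le> expectation (\<lambda>w. Y w ^ (2 * k)) / r ^ (2 * k)"
    using r gaussian_variable_moments[OF Y k]
    by (intro integral_Markov_inequality_measure[where A = "{}"]) auto
  finally show ?thesis using gaussian_variable_moments[OF Y k] by simp
qed

end

section \<open>The Gaussian space of a fractional Brownian motion\<close>

locale fractional_brownian =
  fixes P :: "'w measure" and H :: real and B :: "real \<Rightarrow> 'w \<Rightarrow> real^'d::finite"
  assumes fbm: "fractional_brownian_motion P H B" and H: "1/2 < H" "H < 1"
begin

sublocale prob_space P using fbm by (simp add: fractional_brownian_motion_def)

definition span_B :: "('w \<Rightarrow> real) set" where
  "span_B = {\<lambda>w. \<Sum>t\<in>F. a t \<bullet> B t w | F a. finite F \<and> F \<subseteq> {0..}}"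

lemma span_B_gaussian: "Y \<in> span_B \<Longrightarrow> gaussian_variable P Y"
  using fbm by (auto simp: span_B_def fractional_brownian_motion_def gaussian_process_def)

lemma coordinate_in_span_B: "t \<ge> 0 \<Longrightarrow> (\<lambda>w. B t w $ j) \<in> span_B" unfolding span_B_def
  by (intro CollectI exI[of _ "{t}"] exI[of _ "\<lambda>_. axis j 1"]) (auto simp: inner_axis')

lemma span_B_add:
  assumes "Y \<in> span_B" "Z \<in> span_B"
  shows "(\<lambda>w. Y w + Z w) \<in> span_B"
proof -
  obtain F a where Y: "Y = (\<lambda>w. \<Sum>t\<in>F. a t \<bullet> B t w)" "finite F" "F \<subseteq> {0..}"
    using assms(1) by (auto simp: span_B_def)
  obtain G b where Z: "Z = (\<lambda>w. \<Sum>t\<in>G. b t \<bullet> B t w)" "finite G" "G \<subseteq> {0..}"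
    using assms(2) by (auto simp: span_B_def)
  define c where "c t = (if t \<in> F then a t else 0) + (if t \<in> G then b t else 0)" for t
  have "(\<Sum>t\<in>F \<union> G. c t \<bullet> B t w) = Y w + Z w" for w
  proof -
    have "(\<Sum>t\<in>F \<union> G. c t \<bullet> B t w)
        = (\<Sum>t\<in>F \<union> G. if t \<in> F then a t \<bullet> B t w else 0) + (\<Sum>t\<in>F \<union> G. if t \<in> G then b t \<bullet> B t w else 0)"
      unfolding sum.distrib[symmetric] by (intro sum.cong) (auto simp: c_def inner_add_left)
    also have "(\<Sum>t\<in>F \<union> G. if t \<in> F then a t \<bullet> B t w else 0) = Y w"
      unfolding Y using Y Z by (intro sum.mono_neutral_cong_right) auto
    also have "(\<Sum>t\<in>F \<union> G. if t \<in> G then b t \<bullet> B t w else 0) = Z w"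
      unfolding Z using Y Z by (intro sum.mono_neutral_cong_right) auto
    finally show ?thesis .
  qed
  then show ?thesis
    unfolding span_B_def using Y Z by (intro CollectI exI[of _ "F \<union> G"] exI[of _ c]) auto
qed

lemma span_B_scale:
  assumes "Y \<in> span_B"
  shows "(\<lambda>w. r * Y w) \<in> span_B"
proof -
  obtain F a where Y: "Y = (\<lambda>w. \<Sum>t\<in>F. a t \<bullet> B t w)" "finite F" "F \<subseteq> {0..}"
    using assms by (auto simp: span_B_def)
  then show ?thesis unfolding span_B_def
    by (intro CollectI exI[of _ F] exI[of _ "\<lambda>t. r *\<^sub>R a t"]) (auto simp: sum_distrib_left)
qed

lemma span_B_mean:
  assumes "Y \<in> span_B"
  shows "expectation Y = 0"
proof -
  obtain F a where Y: "Y = (\<lambda>w. \<Sum>t\<in>F. a t \<bullet> B t w)" "finite F" "F \<subseteq> {0..}"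
    using assms by (auto simp: span_B_def)
  have int: "integrable P (\<lambda>w. B t w $ j)" if "t \<in> F" for t j
    using that Y coordinate_in_span_B span_B_gaussian gaussian_variable_integrable by blast
  have "expectation Y = (\<Sum>t\<in>F. \<Sum>j\<in>UNIV. a t $ j * expectation (\<lambda>w. B t w $ j))"
    unfolding Y inner_vec_def inner_real_def
    using int by (subst Bochner_Integration.integral_sum) (auto intro!: Bochner_Integration.integrable_sum sum.cong simp: Bochner_Integration.integral_sum)
  also have "\<dots> = 0"
    using Y fbm by (intro sum.neutral ballI) (auto simp: fractional_brownian_motion_def)
  finally show ?thesis .
qed

sublocale gaussian_space P span_B
proof
  show "(\<lambda>w. 0) \<in> span_B" unfolding span_B_def by (intro CollectI exI[of _ "{}"]) auto
  fix Y assume Y: "Y \<in> span_B"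
  note g = span_B_gaussian[OF Y] span_B_mean[OF Y]
  show "Y \<in> borel_measurable P" using g by (simp add: gaussian_variable_def)
  show "integrable P (\<lambda>w. (Y w)\<^sup>2)" using gaussian_variable_moments(1)[OF g, of 1] by simp
  show "(CLINT w|P. iexp (Y w)) = of_real (exp (- expectation (\<lambda>w. (Y w)\<^sup>2) / 2))"
    by (rule gaussian_variable_char[OF g])
qed (auto intro: span_B_add span_B_scale)

lemma increment_in_span_B: "s \<ge> 0 \<Longrightarrow> t \<ge> 0 \<Longrightarrow> (\<lambda>w. B t w $ j - B s w $ j) \<in> span_B"
  using add[OF coordinate_in_span_B scale[OF coordinate_in_span_B, of _ "-1"], of t s j j] by simp

lemma increment_variance:
  "s \<ge> 0 \<Longrightarrow> t \<ge> 0 \<Longrightarrow> expectation (\<lambda>w. (B t w $ j - B s w $ j)\<^sup>2) = \<bar>t - s\<bar> powr (2 * H)"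
  using fbm by (simp add: fractional_brownian_motion_def)

text \<open>Polarisation writes the product of two disjoint increments as half of a signed
  combination of four squared increments. Their variances combine to a second difference of the
  power \<open>2 * H\<close> at the lag \<open>l - k\<close>.\<close>

lemma increment_covariance_nonneg:
  assumes h: "h > 0" and kl: "k < l"
  shows "expectation (\<lambda>w. (B (h * real (Suc k)) w $ j - B (h * real k) w $ j)
    * (B (h * real (Suc l)) w $ j - B (h * real l) w $ j)) \<ge> 0"
proof -
  let ?b = "\<lambda>n w. B (h * real n) w $ j"
  have pos: "h * real n \<ge> 0" for n using h by simp
  have int: "integrable P (\<lambda>w. (?b n w - ?b n' w)\<^sup>2)" for n n'
    by (rule square_integrable[OF increment_in_span_B[OF pos pos]])
  have var: "expectation (\<lambda>w. (?b n w - ?b n' w)\<^sup>2) = (h * (real n - real n')) powr (2 * H)" if "n' \<le> n" for n n'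
    using increment_variance[OF pos[of n'] pos[of n], of j] that h by (simp add: right_diff_distrib)
  have "expectation (\<lambda>w. (?b (Suc k) w - ?b k w) * (?b (Suc l) w - ?b l w))
      = expectation (\<lambda>w. ((?b (Suc l) w - ?b k w)\<^sup>2 + (?b l w - ?b (Suc k) w)\<^sup>2
          - (?b (Suc l) w - ?b (Suc k) w)\<^sup>2 - (?b l w - ?b k w)\<^sup>2) / 2)"
    by (intro Bochner_Integration.integral_cong refl) (simp add: power2_eq_square algebra_simps)
  also have "\<dots> = ((h * (real (Suc l) - real k)) powr (2 * H) + (h * (real l - real (Suc k))) powr (2 * H)
      - (h * (real (Suc l) - real (Suc k))) powr (2 * H) - (h * (real l - real k)) powr (2 * H)) / 2"
    using kl by (simp add: int var del: of_nat_Suc)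
  also have "\<dots> \<ge> 0"
  proof -
    define n where "n = l - k"
    have "n \<ge> 1" using kl by (simp add: n_def)
    have "real l = real k + real n" using kl by (simp add: n_def of_nat_diff)
    then have n: "real (Suc l) - real k = real n + 1" "real l - real (Suc k) = real n - 1"
        "real (Suc l) - real (Suc k) = real n" "real l - real k = real n" by simp_all
    show ?thesis unfolding n using powr_second_difference[of "2 * H" n h] H h \<open>n \<ge> 1\<close> by simp
  qed
  finally show ?thesis .
qed

section \<open>Increments over a uniform grid\<close>

definition grid_increment :: "real \<Rightarrow> nat \<Rightarrow> nat \<times> 'd \<Rightarrow> 'w \<Rightarrow> real" where
  "grid_increment T m = (\<lambda>(k, j) w. B (T / real m * real (Suc k)) w $ j - B (T / real m * real k) w $ j)"

lemma grid_increment_in_span_B: "T > 0 \<Longrightarrow> grid_increment T m p \<in> span_B"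
  by (cases p) (auto simp: grid_increment_def intro!: increment_in_span_B)

lemma B_measurable: "t \<ge> 0 \<Longrightarrow> B t \<in> borel_measurable P" using meas[OF coordinate_in_span_B]
  by (subst borel_measurable_euclidean_space) (auto simp: Basis_vec_def inner_axis)

text \<open>The length \<open>x\<close> is relative to \<open>T\<close>, so \<open>T\<close> scales
  out. A moment with \<open>q * (H - \<gamma>) \<ge> 1\<close> gives a bound of order
  \<open>x\<^sup>2\<close>; as there are about 1 / x dyadic edges of that length, the union bound
  sums to a constant over \<open>K\<close>.\<close>

lemma increment_tail:
  assumes q: "q > 0" "1 \<le> real q * (H - \<gamma>)" and T: "T > 0" and x: "0 < x" "x \<le> 1"
    and K: "K \<ge> 1" and st: "s \<ge> 0" "t \<ge> 0" "\<bar>t - s\<bar> = T * x"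
  shows "prob {w\<in>space P. \<bar>B t w $ j - B s w $ j\<bar> > K * T powr H * x powr \<gamma>}
    \<le> fact (2 * q) / (2 ^ q * fact q) * x\<^sup>2 / K"
proof -
  let ?c = "fact (2 * q) / (2 ^ q * fact q) :: real"
  let ?r = "K * T powr H * x powr \<gamma>"
  have Y: "(\<lambda>w. B t w $ j - B s w $ j) \<in> span_B" using st increment_in_span_B by simp
  have r: "?r > 0" using K T x by simp
  have pw: "(a powr b) ^ n = a powr (b * real n)" if "a > 0" for a b :: real and n
    using that by (simp add: powr_powr flip: powr_realpow)
  have "prob {w\<in>space P. \<bar>B t w $ j - B s w $ j\<bar> > ?r}
      \<le> ?c * expectation (\<lambda>w. (B t w $ j - B s w $ j)\<^sup>2) ^ q / ?r ^ (2 * q)"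
    by (rule gaussian_variable_tail[OF span_B_gaussian[OF Y] span_B_mean[OF Y] q(1) r])
  also have "expectation (\<lambda>w. (B t w $ j - B s w $ j)\<^sup>2) ^ q
      = T powr (2 * H * real q) * x powr (2 * H * real q)"
    using st T x by (simp add: increment_variance powr_mult pw power_mult_distrib)
  also have "?r ^ (2 * q) = K ^ (2 * q) * (T powr (2 * H * real q) * x powr (2 * \<gamma> * real q))"
    using T x by (simp add: power_mult_distrib pw mult_ac)
  also have "?c * (T powr (2 * H * real q) * x powr (2 * H * real q))
        / (K ^ (2 * q) * (T powr (2 * H * real q) * x powr (2 * \<gamma> * real q)))
      = ?c * (x powr (2 * H * real q) / x powr (2 * \<gamma> * real q)) / K ^ (2 * q)"
    using T by simp
  also have "x powr (2 * H * real q) / x powr (2 * \<gamma> * real q) = x powr (2 * (real q * (H - \<gamma>)))"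
    using x by (simp add: powr_diff[symmetric] algebra_simps)
  also have "?c * x powr (2 * (real q * (H - \<gamma>))) / K ^ (2 * q) \<le> ?c * x powr 2 / K ^ 1"
  proof (intro frac_le mult_left_mono powr_mono')
    show "K ^ 1 \<le> K ^ (2 * q)" using K q by (intro power_increasing) auto
  qed (use x q K in auto)
  finally show ?thesis using x by (simp add: powr_numeral)
qed

definition grid_holder :: "real \<Rightarrow> real \<Rightarrow> real \<Rightarrow> nat \<Rightarrow> 'w \<Rightarrow> bool" where
  "grid_holder a \<gamma> T m w \<longleftrightarrow> (\<forall>i j. i \<le> j \<and> j \<le> m \<longrightarrow>
    norm (B (T / real m * real j) w - B (T / real m * real i) w) \<le> a * ((real j - real i) / real m) powr \<gamma>)"

text \<open>A union bound over all dyadic edges and all coordinates; outside the bad event chaining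
  applies. Only dyadic intervals contained in the grid are used, so \<open>m\<close> can be any
  positive number, and \<open>\<kappa>\<close> is uniform in \<open>T\<close> and
  \<open>m\<close>.\<close>

lemma grid_holder_probability:
  assumes \<gamma>: "0 < \<gamma>" "\<gamma> < H"
  shows "\<exists>\<kappa>>0. \<forall>T>0. \<forall>m>0. 1 / 2 \<le>
    prob {w\<in>space P. grid_holder (\<kappa> * T powr H) \<gamma> T m w}"
proof -
  define q where "q = nat \<lceil>1 / (H - \<gamma>)\<rceil>"
  have "1 / (H - \<gamma>) \<le> real q" unfolding q_def by linarith
  then have q: "1 \<le> real q * (H - \<gamma>)" using \<gamma> by (simp add: field_simps)
  then have q0: "q > 0" by (cases q) auto
  define c :: real where "c = fact (2 * q) / (2 ^ q * fact q)"
  define N where "N = real CARD('d)"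
  \<comment> \<open>The failure probability will be at most \<open>2 * (N * c) / K\<close>, which
    this value keeps below 1/2.\<close>
  define K where "K = 1 + 4 * N * c"
  define L where "L = 2 * (2 powr \<gamma>)\<^sup>2 / (2 powr \<gamma> - 1)"
  have c: "c > 0" by (simp add: c_def)
  have N: "N > 0" by (simp add: N_def)
  have K: "K \<ge> 1" using c N by (simp add: K_def)
  have "(1::real) < 2 powr \<gamma>" using \<gamma> by simp
  then have L: "L > 0" unfolding L_def by (intro divide_pos_pos) auto
  show ?thesis
  proof (intro exI[of _ "L * N * K"] conjI allI impI)
    show "L * N * K > 0" using L N K by simp
    fix T :: real and m :: nat assume T: "T > 0" and m: "m > 0"
    define h where "h = T / real m"
    have h: "h > 0" using T m by (simp add: h_def)
    \<comment> \<open>An element \<open>((r, k), j)\<close> stands for the \<open>j\<close>-th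
      coordinate over the interval from \<open>k * 2 ^ r\<close> to
      \<open>(k + 1) * 2 ^ r\<close>.\<close>
    define I where "I = (SIGMA r:{r. 2 ^ r \<le> m}. {..<m div 2 ^ r}) \<times> (UNIV :: 'd set)"
    define bad where "bad p = {w\<in>space P.
      \<bar>B (h * real ((snd (fst p) + 1) * 2 ^ fst (fst p))) w $ snd p
        - B (h * real (snd (fst p) * 2 ^ fst (fst p))) w $ snd p\<bar>
        > K * T powr H * (2 ^ fst (fst p) / real m) powr \<gamma>}" for p :: "(nat \<times> nat) \<times> 'd"
    define good where "good = {w\<in>space P. \<forall>i j. i \<le> j \<and> j \<le> m \<longrightarrow>
      norm (B (h * real j) w - B (h * real i) w)
        \<le> L * N * K * T powr H * ((real j - real i) / real m) powr \<gamma>}"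
    have fin_r: "finite {r. (2::nat) ^ r \<le> m}"
      by (rule finite_subset[of _ "{..m}"]) (auto intro: order_trans[OF less_imp_le[OF less_exp]])
    then have fin: "finite I" unfolding I_def by auto
    have B_meas: "B (h * real n) \<in> borel_measurable P" for n using h by (intro B_measurable) simp
    have coord_meas: "(\<lambda>w. B (h * real n) w $ j) \<in> borel_measurable P" for n j
      using h by (intro meas coordinate_in_span_B) simp
    have bad_sets: "bad p \<in> sets P" for p unfolding bad_def
      by (intro borel_measurable_less borel_measurable_abs borel_measurable_diff borel_measurable_const coord_meas)
    have good_sets: "good \<in> sets P" unfolding good_def
      by (intro sets.sets_Collect_countable_All sets.sets_Collect_imp sets.sets_Collect_const
          borel_measurable_le measurable_compose[OF _ borel_measurable_norm] borel_measurable_diff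
          borel_measurable_const B_meas)
    have bad_prob: "prob (bad p) \<le> c * (2 ^ fst (fst p) / real m)\<^sup>2 / K" if "p \<in> I" for p
    proof -
      obtain r k j where p: "p = ((r, k), j)" by (metis prod.exhaust)
      have r: "2 ^ r \<le> m" using that by (simp add: p I_def)
      then have "(2::real) ^ r \<le> real m" by (metis of_nat_le_iff of_nat_numeral of_nat_power)
      then show ?thesis unfolding p bad_def c_def fst_conv snd_conv using h T m
        by (intro increment_tail[OF q0 q T _ _ K]) (auto simp: h_def field_simps)
    qed
    have "prob (\<Union>p\<in>I. bad p) \<le> (\<Sum>p\<in>I. prob (bad p))"
      using bad_sets by (intro finite_measure_subadditive_finite fin) auto
    also have "\<dots> \<le> (\<Sum>p\<in>I. c * (2 ^ fst (fst p) / real m)\<^sup>2 / K)" by (intro sum_mono bad_prob)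
    also have "\<dots> = (\<Sum>r | 2 ^ r \<le> m. \<Sum>k<m div 2 ^ r. \<Sum>j\<in>(UNIV::'d set). c * (2 ^ r / real m)\<^sup>2 / K)"
      unfolding I_def sum.cartesian_product' by (subst sum.Sigma[OF fin_r]) (auto simp: split_beta')
    also have "\<dots> = (\<Sum>r | 2 ^ r \<le> m. real (m div 2 ^ r) * N * (c * (2 ^ r / real m)\<^sup>2 / K))"
      by (simp add: N_def mult_ac)
    also have "\<dots> \<le> (\<Sum>r | 2 ^ r \<le> m. N * c / K / real m * 2 ^ r)"
    proof (rule sum_mono)
      fix r
      have "real (m div 2 ^ r) \<le> real m / 2 ^ r"
        using of_nat_div_le_of_nat[of m "2 ^ r", where 'a = real] by simp
      then have "real (m div 2 ^ r) * (N * (c * (2 ^ r / real m)\<^sup>2 / K))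
          \<le> real m / 2 ^ r * (N * (c * (2 ^ r / real m)\<^sup>2 / K))"
        using N c K by (intro mult_right_mono) auto
      also have "\<dots> = N * c / K / real m * 2 ^ r" using m by (simp add: power2_eq_square mult_ac)
      finally show "real (m div 2 ^ r) * N * (c * (2 ^ r / real m)\<^sup>2 / K) \<le> N * c / K / real m * 2 ^ r"
        by (simp add: mult.assoc)
    qed
    also have "\<dots> = N * c / K / real m * (\<Sum>r | 2 ^ r \<le> m. 2 ^ r)" by (simp add: sum_distrib_left)
    also have "\<dots> \<le> N * c / K / real m * (2 * real m)"
      using N c K m by (intro mult_left_mono sum_power_two_le) auto
    also have "\<dots> = 2 * (N * c) / K" using m by simp
    also have "\<dots> \<le> 1 / 2" using K by (simp add: pos_divide_le_eq) (simp add: K_def)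
    finally have bad_le: "prob (\<Union>p\<in>I. bad p) \<le> 1 / 2" .
    have "space P - (\<Union>p\<in>I. bad p) \<subseteq> good"
    proof
      fix w assume w: "w \<in> space P - (\<Union>p\<in>I. bad p)"
      let ?b = "\<lambda>k. B (h * real k) w"
      let ?D = "N * K * T powr H / real m powr \<gamma>"
      have level: "norm (?b ((k + 1) * 2 ^ r) - ?b (k * 2 ^ r)) \<le> ?D * (2 powr \<gamma>) ^ r"
        if kr: "(k + 1) * 2 ^ r \<le> m" for k r
      proof -
        have "k + 1 \<le> m div 2 ^ r" using kr by (simp add: less_eq_div_iff_mult_less_eq)
        moreover have "2 ^ r \<le> m" using kr by (metis le_add2 mult.commute mult.right_neutral mult_le_mono2 order_trans)
        ultimately have "((r, k), j) \<in> I" for j by (simp add: I_def)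
        then have "w \<notin> bad ((r, k), j)" for j using w by blast
        then have coord: "\<bar>(?b ((k + 1) * 2 ^ r) - ?b (k * 2 ^ r)) $ j\<bar> \<le> K * T powr H * (2 ^ r / real m) powr \<gamma>" for j
          using w by (simp add: bad_def not_less)
        have "norm (?b ((k + 1) * 2 ^ r) - ?b (k * 2 ^ r))
            \<le> (\<Sum>j\<in>UNIV. \<bar>(?b ((k + 1) * 2 ^ r) - ?b (k * 2 ^ r)) $ j\<bar>)"
          by (rule norm_le_l1_cart)
        also have "\<dots> \<le> (\<Sum>j\<in>(UNIV::'d set). K * T powr H * (2 ^ r / real m) powr \<gamma>)"
          by (intro sum_mono coord)
        also have "\<dots> = ?D * (2 powr \<gamma>) ^ r"
          using m by (simp add: N_def powr_divide powr_powr mult.commute flip: powr_realpow)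
        finally show ?thesis .
      qed
      have "norm (?b j - ?b i) \<le> L * N * K * T powr H * ((real j - real i) / real m) powr \<gamma>"
        if "i \<le> j" "j \<le> m" for i j
      proof -
        have "norm (?b j - ?b i) \<le> L * ?D * (real j - real i) powr \<gamma>"
          unfolding L_def using \<gamma> N K that level by (intro dyadic_chaining_holder) auto
        also have "\<dots> = L * N * K * T powr H * ((real j - real i) / real m) powr \<gamma>"
          using that m by (simp add: powr_divide)
        finally show ?thesis .
      qed
      then show "w \<in> good" using w by (simp add: good_def)
    qed
    then have "prob (space P - (\<Union>p\<in>I. bad p)) \<le> prob good" by (intro finite_measure_mono good_sets)
    moreover have "prob (space P - (\<Union>p\<in>I. bad p)) = 1 - prob (\<Union>p\<in>I. bad p)"
      using bad_sets fin by (intro prob_compl) auto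
    ultimately show "1 / 2 \<le> prob {w\<in>space P. grid_holder (L * N * K * T powr H) \<gamma> T m w}"
      using bad_le unfolding good_def h_def grid_holder_def by linarith
  qed
qed

text \<open>Within one coordinate the covariances are non-negative, so the variance of a signed sum
  is largest when all coefficients are 1; that sum telescopes to \<open>B T - B 0\<close>, of
  variance \<open>T powr (2 * H)\<close>. Cauchy--Schwarz over the coordinates contributes the
  square of \<open>CARD('d)\<close>. The bound is the same for every mesh.\<close>

lemma grid_increment_covariance:
  assumes T: "T > 0" and m: "m > 0" and \<epsilon>: "\<And>p. \<bar>\<epsilon> p\<bar> \<le> 1"
  shows "expectation (\<lambda>w. (\<Sum>p\<in>{..<m} \<times> UNIV. \<epsilon> p * grid_increment T m p w)\<^sup>2)
    \<le> (real CARD('d) * T powr H)\<^sup>2"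
proof -
  let ?h = "T / real m"
  have h: "?h > 0" using T m by simp
  let ?D = "\<lambda>j k w. grid_increment T m (k, j) w"
  have int: "integrable P (\<lambda>w. ?D j k w * ?D j' l w)" for j j' k l
    by (intro integrable_product grid_increment_in_span_B T)
  have cov: "0 \<le> expectation (\<lambda>w. ?D j k w * ?D j l w)" for j k l
  proof -
    consider "k < l" | "k = l" | "l < k" by linarith
    then show ?thesis
    proof cases
      case 1
      then show ?thesis using increment_covariance_nonneg[OF h 1, of j] by (simp add: grid_increment_def)
    next
      case 2
      then show ?thesis by simp
    next
      case 3
      then show ?thesis using increment_covariance_nonneg[OF h 3, of j] by (simp add: grid_increment_def mult.commute)
    qed
  qed
  have expand: "expectation (\<lambda>w. (\<Sum>k<m. e k * ?D j k w)\<^sup>2)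
      = (\<Sum>k<m. \<Sum>l<m. e k * e l * expectation (\<lambda>w. ?D j k w * ?D j l w))" for e :: "nat \<Rightarrow> real" and j
  proof -
    have "expectation (\<lambda>w. (\<Sum>k<m. e k * ?D j k w)\<^sup>2)
        = expectation (\<lambda>w. (\<Sum>k<m. (\<Sum>l<m. (e k * e l) * (?D j k w * ?D j l w))))"
      by (simp add: power2_eq_square sum_product algebra_simps)
    also have "\<dots> = (\<Sum>k<m. expectation (\<lambda>w. (\<Sum>l<m. (e k * e l) * (?D j k w * ?D j l w))))"
      by (intro Bochner_Integration.integral_sum Bochner_Integration.integrable_sum integrable_mult_right int)
    also have "\<dots> = (\<Sum>k<m. \<Sum>l<m. expectation (\<lambda>w. (e k * e l) * (?D j k w * ?D j l w)))"
      by (intro sum.cong refl Bochner_Integration.integral_sum integrable_mult_right int)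
    finally show ?thesis by simp
  qed
  have coord: "expectation (\<lambda>w. (\<Sum>k<m. \<epsilon> (k, j) * ?D j k w)\<^sup>2) \<le> T powr (2 * H)" for j
  proof -
    have "expectation (\<lambda>w. (\<Sum>k<m. \<epsilon> (k, j) * ?D j k w)\<^sup>2)
        \<le> (\<Sum>k<m. \<Sum>l<m. 1 * 1 * expectation (\<lambda>w. ?D j k w * ?D j l w))"
      unfolding expand
    proof (intro sum_mono mult_right_mono cov)
      fix k l
      have "\<bar>\<epsilon> (k, j)\<bar> * \<bar>\<epsilon> (l, j)\<bar> \<le> 1 * 1" using \<epsilon> by (intro mult_mono) auto
      then show "\<epsilon> (k, j) * \<epsilon> (l, j) \<le> 1 * 1" by (simp add: abs_mult[symmetric])
    qed
    also have "\<dots> = expectation (\<lambda>w. (\<Sum>k<m. 1 * ?D j k w)\<^sup>2)" by (rule expand[symmetric])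
    also have "\<dots> = expectation (\<lambda>w. (B T w $ j - B 0 w $ j)\<^sup>2)"
    proof -
      have "(\<Sum>k<n. ?D j k w) = B (?h * real n) w $ j - B 0 w $ j" for n w
        by (induction n) (auto simp: grid_increment_def)
      from this[of _ m] show ?thesis using m by simp
    qed
    also have "\<dots> = T powr (2 * H)" using increment_variance[of 0 T j] T by simp
    finally show ?thesis .
  qed
  have meas: "(\<lambda>w. ?D j k w) \<in> borel_measurable P" for j k
    by (intro meas grid_increment_in_span_B T)
  have int_sq: "integrable P (\<lambda>w. (\<Sum>k<m. \<epsilon> (k, j) * ?D j k w)\<^sup>2)" for j
    by (intro square_integrable sum_mem grid_increment_in_span_B T)
  have "expectation (\<lambda>w. (\<Sum>p\<in>{..<m} \<times> UNIV. \<epsilon> p * grid_increment T m p w)\<^sup>2)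
      \<le> expectation (\<lambda>w. real CARD('d) * (\<Sum>j\<in>UNIV. (\<Sum>k<m. \<epsilon> (k, j) * ?D j k w)\<^sup>2))"
  proof (rule integral_mono)
    show "integrable P (\<lambda>w. (\<Sum>p\<in>{..<m} \<times> UNIV. \<epsilon> p * grid_increment T m p w)\<^sup>2)"
      by (intro square_integrable sum_mem grid_increment_in_span_B T)
    show "integrable P (\<lambda>w. real CARD('d) * (\<Sum>j\<in>UNIV. (\<Sum>k<m. \<epsilon> (k, j) * ?D j k w)\<^sup>2))"
      by (intro integrable_mult_right Bochner_Integration.integrable_sum int_sq)
    fix w
    have "(\<Sum>p\<in>{..<m} \<times> UNIV. \<epsilon> p * grid_increment T m p w) = (\<Sum>k<m. \<Sum>j\<in>UNIV. \<epsilon> (k, j) * ?D j k w)"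
      by (simp add: sum.cartesian_product split_beta')
    also have "\<dots> = (\<Sum>j\<in>UNIV. \<Sum>k<m. \<epsilon> (k, j) * ?D j k w)" by (rule sum.swap)
    finally show "(\<Sum>p\<in>{..<m} \<times> UNIV. \<epsilon> p * grid_increment T m p w)\<^sup>2
        \<le> real CARD('d) * (\<Sum>j\<in>UNIV. (\<Sum>k<m. \<epsilon> (k, j) * ?D j k w)\<^sup>2)"
      using sum_squared_le_sum_of_squares[of "\<lambda>j. \<Sum>k<m. \<epsilon> (k, j) * ?D j k w" UNIV]
      by (simp add: mult.commute)
  qed
  also have "\<dots> = real CARD('d) * (\<Sum>j\<in>UNIV. expectation (\<lambda>w. (\<Sum>k<m. \<epsilon> (k, j) * ?D j k w)\<^sup>2))"
    using int_sq by simp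
  also have "\<dots> \<le> real CARD('d) * (\<Sum>j\<in>(UNIV::'d set). T powr (2 * H))"
    by (intro mult_left_mono sum_mono coord) auto
  also have "\<dots> = (real CARD('d) * T powr H)\<^sup>2"
    by (simp add: power_mult_distrib power2_eq_square powr_add[symmetric])
  finally show ?thesis .
qed

end

section \<open>Young integral equations\<close>

lemma partition_tagged_division:
  fixes x :: "nat \<Rightarrow> real"
  assumes "\<And>k. k < n \<Longrightarrow> x k < x (Suc k)" "n > 0"
  shows "((\<lambda>k. (x k, {x k..x (Suc k)})) ` {..<n}) tagged_division_of {x 0..x n}" using assms(2,1)
proof (induction n rule: nat_induct_non_zero)
  case 1
  then show ?case
    using tagged_division_of_self_real[of "x 0" "x 0" "x 1"] by (simp add: lessThan_Suc)
next
  case (Suc n)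
  have "x 0 \<le> x m" if "m \<le> n" for m using that
  proof (induction m)
    case (Suc m)
    then show ?case using Suc.prems \<open>\<And>k. k < Suc n \<Longrightarrow> x k < x (Suc k)\<close>[of m] by simp
  qed simp
  then have le: "x 0 \<le> x n" by simp
  have "((\<lambda>k. (x k, {x k..x (Suc k)})) ` {..<n}) tagged_division_of {x 0..x n}"
    by (rule Suc.IH) (simp add: Suc.prems)
  moreover have "{(x n, {x n..x (Suc n)})} tagged_division_of {x n..x (Suc n)}"
    using Suc.prems[of n] by (intro tagged_division_of_self_real) auto
  moreover have "interior {x 0..x n} \<inter> interior {x n..x (Suc n)} = {}" by simp
  ultimately have "((\<lambda>k. (x k, {x k..x (Suc k)})) ` {..<n} \<union> {(x n, {x n..x (Suc n)})})
      tagged_division_of ({x 0..x n} \<union> {x n..x (Suc n)})"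
    by (rule tagged_division_Un)
  moreover have "{x 0..x n} \<union> {x n..x (Suc n)} = {x 0..x (Suc n)}" using le Suc.prems[of n] by auto
  ultimately show ?case by (simp add: lessThan_Suc)
qed

definition fine_partition :: "real \<Rightarrow> real \<Rightarrow> real \<Rightarrow> nat \<Rightarrow> (nat \<Rightarrow> real) \<Rightarrow> bool" where
  "fine_partition \<delta> a b n x \<longleftrightarrow>
    n > 0 \<and> x 0 = a \<and> x n = b \<and> (\<forall>k<n. x k < x (Suc k) \<and> x (Suc k) - x k < \<delta>)"

text \<open>\<open>has_young_integral\<close> quantifies over sets of tagged intervals, whereas
  sewing works with sums over consecutive points; partitions tagged at left endpoints translate
  between the two.\<close>

lemma has_young_integral_partition:
  assumes "has_young_integral f g a b I" "e > 0"
  shows "\<exists>\<delta>>0. \<forall>n x. fine_partition \<delta> a b n x \<longrightarrow>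
    norm ((\<Sum>k<n. (g (x (Suc k)) - g (x k)) *\<^sub>R f (x k)) - I) < e"
proof -
  obtain \<delta> where \<delta>: "\<delta> > 0" and I: "\<And>p. p tagged_division_of {a..b} \<Longrightarrow> (\<lambda>s. ball s \<delta>) fine p \<Longrightarrow>
      norm ((\<Sum>(s, K)\<in>p. (g (Sup K) - g (Inf K)) *\<^sub>R f s) - I) < e"
    using assms by (auto simp: has_young_integral_def)
  show ?thesis
  proof (intro exI[of _ \<delta>] conjI allI impI \<delta>)
    fix n :: nat and x :: "nat \<Rightarrow> real"
    assume "fine_partition \<delta> a b n x"
    then have n: "n > 0" and ends: "x 0 = a" "x n = b" and less: "\<And>k. k < n \<Longrightarrow> x k < x (Suc k)"
      and mesh: "\<And>k. k < n \<Longrightarrow> x (Suc k) - x k < \<delta>" by (auto simp: fine_partition_def)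
    let ?h = "\<lambda>k. (x k, {x k..x (Suc k)})"
    have mono: "x i < x j" if "i < j" "j \<le> n" for i j using that
    proof (induction j)
      case (Suc j)
      then show ?case using less[of j] by (cases "i = j") (auto simp: less_Suc_eq)
    qed simp
    \<comment> \<open>The division is a set, so its sum agrees with the indexed sum only if no
      tagged interval repeats.\<close>
    have inj: "inj_on ?h {..<n}"
    proof (rule inj_onI)
      fix i j assume "i \<in> {..<n}" "j \<in> {..<n}" "?h i = ?h j"
      then show "i = j" using mono[of i j] mono[of j i] by (cases i j rule: linorder_cases) auto
    qed
    have "(?h ` {..<n}) tagged_division_of {a..b}"
      using partition_tagged_division[of n x] less n ends by simp
    moreover have "{x k..x (Suc k)} \<subseteq> ball (x k) \<delta>" if "k < n" for k
      using mesh[OF that] by (auto simp: dist_real_def)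
    then have "(\<lambda>s. ball s \<delta>) fine (?h ` {..<n})" by (auto simp: fine_def)
    ultimately have "norm ((\<Sum>(s, K)\<in>?h ` {..<n}. (g (Sup K) - g (Inf K)) *\<^sub>R f s) - I) < e"
      by (rule I)
    also have "(\<Sum>(s, K)\<in>?h ` {..<n}. (g (Sup K) - g (Inf K)) *\<^sub>R f s)
        = (\<Sum>k<n. (g (x (Suc k)) - g (x k)) *\<^sub>R f (x k))"
      using less by (subst sum.reindex[OF inj]) (auto intro!: sum.cong simp: less_imp_le)
    finally show "norm ((\<Sum>k<n. (g (x (Suc k)) - g (x k)) *\<^sub>R f (x k)) - I) < e" .
  qed
qed

text \<open>Balls of constant radius form a gauge, so by Cousin's lemma some division is fine for
  both tolerances, and its sum lies close to \<open>I\<close> and to \<open>J\<close>.\<close>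

lemma has_young_integral_unique:
  assumes "has_young_integral f g a b I" "has_young_integral f g a b J"
  shows "I = J"
proof (rule ccontr)
  assume "I \<noteq> J"
  define e where "e = norm (I - J) / 2"
  have e: "e > 0" using \<open>I \<noteq> J\<close> by (simp add: e_def)
  obtain \<delta> where "\<delta> > 0"
    and I: "\<And>p. p tagged_division_of {a..b} \<Longrightarrow> (\<lambda>s. ball s \<delta>) fine p \<Longrightarrow>
      norm ((\<Sum>(s, K)\<in>p. (g (Sup K) - g (Inf K)) *\<^sub>R f s) - I) < e"
    using assms(1) e by (auto simp: has_young_integral_def)
  obtain \<delta>' where "\<delta>' > 0"
    and J: "\<And>p. p tagged_division_of {a..b} \<Longrightarrow> (\<lambda>s. ball s \<delta>') fine p \<Longrightarrow>
      norm ((\<Sum>(s, K)\<in>p. (g (Sup K) - g (Inf K)) *\<^sub>R f s) - J) < e"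
    using assms(2) e by (auto simp: has_young_integral_def)
  have "gauge (\<lambda>s::real. ball s (min \<delta> \<delta>'))" using \<open>\<delta> > 0\<close> \<open>\<delta>' > 0\<close> by (intro gauge_ball) auto
  then obtain p where p: "p tagged_division_of {a..b}" "(\<lambda>s. ball s (min \<delta> \<delta>')) fine p"
    by (rule fine_division_exists_real)
  have "(\<lambda>s. ball s \<delta>) fine p" "(\<lambda>s. ball s \<delta>') fine p"
    using p(2) by (auto simp: fine_def subset_iff)
  with I[OF p(1)] J[OF p(1)] show False
    using norm_triangle_ineq4[of "(\<Sum>(s, K)\<in>p. (g (Sup K) - g (Inf K)) *\<^sub>R f s) - I"
        "(\<Sum>(s, K)\<in>p. (g (Sup K) - g (Inf K)) *\<^sub>R f s) - J"] by (simp add: e_def norm_minus_commute)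
qed

lemma young_integral_eq: "has_young_integral f g a b I \<Longrightarrow> young_integral f g a b = I"
  unfolding young_integral_def by (rule the_equality) (auto intro: has_young_integral_unique)

lemma has_young_integral_singleton:
  assumes "has_young_integral f g a a I"
  shows "I = 0"
proof (rule has_young_integral_unique[OF assms])
  have "(\<Sum>(s, K)\<in>p. (g (Sup K) - g (Inf K)) *\<^sub>R f s) = 0" if "p tagged_division_of {a..a}" for p
  proof (rule sum.neutral, clarify)
    fix s K assume "(s, K) \<in> p"
    then have "s \<in> K" "K \<subseteq> {a}" using tagged_division_ofD[OF that] by auto
    then have "K = {a}" by auto
    then show "(g (Sup K) - g (Inf K)) *\<^sub>R f s = 0" by simp
  qed
  then show "has_young_integral f g a a 0"
    using assms unfolding has_young_integral_def by (auto intro: exI[of _ 1])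
qed

text \<open>Sewing for the germ \<open>(g (x b) - g (x a)) *\<^sub>R f (x a)\<close> with time
  itself as the control. The defect over three points is the product of an increment of
  \<open>f\<close> and one of \<open>g\<close>, hence of order
  \<open>\<alpha> + \<beta> > 1\<close>, and the bound is uniform in \<open>n\<close>.\<close>

lemma young_riemann_sum_bound:
  fixes f :: "real \<Rightarrow> 'a::real_normed_vector" and g :: "real \<Rightarrow> real"
  assumes \<theta>: "\<alpha> + \<beta> > 1" "\<alpha> > 0" "\<beta> > 0" and K: "Kf \<ge> 0" "Kg \<ge> 0" and st: "s < t" and n: "n > 0"
    and f: "\<And>u v. u \<in> {s..t} \<Longrightarrow> v \<in> {s..t} \<Longrightarrow> norm (f u - f v) \<le> Kf * \<bar>u - v\<bar> powr \<alpha>"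
    and g: "\<And>u v. u \<in> {s..t} \<Longrightarrow> v \<in> {s..t} \<Longrightarrow> \<bar>g u - g v\<bar> \<le> Kg * \<bar>u - v\<bar> powr \<beta>"
    and x: "\<And>k. x k = s + (t - s) * (real k / real n)"
  shows "norm ((\<Sum>k<n. (g (x (Suc k)) - g (x k)) *\<^sub>R f (x k)) - (g t - g s) *\<^sub>R f s)
    \<le> Kf * Kg * sewing_const (\<alpha> + \<beta>) * (t - s) powr (\<alpha> + \<beta>)"
proof -
  define \<Xi> where "\<Xi> a b = (g (x b) - g (x a)) *\<^sub>R f (x a)" for a b
  have mono: "x i \<le> x j" if "i \<le> j" for i j
    unfolding x using that st n by (intro add_left_mono mult_left_mono divide_right_mono) auto
  have ends: "x 0 = s" "x n = t" using n by (auto simp: x)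
  have mem: "x k \<in> {s..t}" if "k \<le> n" for k using mono[of 0 k] mono[of k n] that ends by simp
  have "norm (\<Xi> 0 n - (\<Sum>k<n. \<Xi> k (Suc k)))
      \<le> (Kf * Kg) * sewing_const (\<alpha> + \<beta>) * (x n - x 0) powr (\<alpha> + \<beta>)"
  proof (rule discrete_sewing)
    show "mono x" using mono by (simp add: mono_def)
    fix a b c assume abc: "a < b" "b < c" "c \<le> n"
    have le: "x a \<le> x b" "x b \<le> x c" using abc by (auto intro: mono)
    have "\<Xi> a c - \<Xi> a b - \<Xi> b c = (g (x c) - g (x b)) *\<^sub>R (f (x a) - f (x b))"
      by (simp add: \<Xi>_def algebra_simps)
    also have "norm \<dots> = norm (f (x a) - f (x b)) * \<bar>g (x c) - g (x b)\<bar>" by simp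
    also have "\<dots> \<le> (Kf * \<bar>x a - x b\<bar> powr \<alpha>) * (Kg * \<bar>x c - x b\<bar> powr \<beta>)"
      using abc K by (intro mult_mono f g mem) auto
    also have "\<dots> \<le> (Kf * (x c - x a) powr \<alpha>) * (Kg * (x c - x a) powr \<beta>)"
      using le K \<theta> by (intro mult_mono mult_left_mono powr_mono2) auto
    also have "\<dots> = Kf * Kg * (x c - x a) powr (\<alpha> + \<beta>)" by (simp add: powr_add)
    finally show "norm (\<Xi> a c - \<Xi> a b - \<Xi> b c) \<le> Kf * Kg * (x c - x a) powr (\<alpha> + \<beta>)" .
  qed (use \<theta> K n in auto)
  then show ?thesis by (simp add: \<Xi>_def ends norm_minus_commute)
qed

text \<open>Preceded by a partition of \<open>{0..s}\<close>, a partition of \<open>{s..t}\<close>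
  becomes one of \<open>{0..t}\<close>. Subtracting the sum over \<open>{0..s}\<close> shows that
  fine Riemann sums over \<open>{s..t}\<close> are close to \<open>It - Is\<close>, and these obey
  the sewing bound.\<close>

lemma young_integral_increment:
  fixes f :: "real \<Rightarrow> 'a::real_normed_vector" and g :: "real \<Rightarrow> real"
  assumes Is: "has_young_integral f g 0 s Is" and It: "has_young_integral f g 0 t It"
    and \<theta>: "\<alpha> + \<beta> > 1" "\<alpha> > 0" "\<beta> > 0" and K: "Kf \<ge> 0" "Kg \<ge> 0" and st: "0 \<le> s" "s \<le> t" "t \<le> T"
    and f: "\<And>u v. u \<in> {0..T} \<Longrightarrow> v \<in> {0..T} \<Longrightarrow> norm (f u - f v) \<le> Kf * \<bar>u - v\<bar> powr \<alpha>"
    and g: "\<And>u v. u \<in> {0..T} \<Longrightarrow> v \<in> {0..T} \<Longrightarrow> \<bar>g u - g v\<bar> \<le> Kg * \<bar>u - v\<bar> powr \<beta>"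
  shows "norm (It - Is - (g t - g s) *\<^sub>R f s) \<le> Kf * Kg * sewing_const (\<alpha> + \<beta>) * (t - s) powr (\<alpha> + \<beta>)"
proof (cases "s = t")
  case True
  then show ?thesis using has_young_integral_unique[OF Is] It by simp
next
  case False
  then have "s < t" using st by simp
  show ?thesis
  proof (rule field_le_epsilon)
    fix e :: real assume "e > 0"
    then have e2: "e / 2 > 0" by simp
    obtain \<delta>1 where \<delta>1: "\<delta>1 > 0" and Is': "\<And>n x. fine_partition \<delta>1 0 s n x \<Longrightarrow>
        norm ((\<Sum>k<n. (g (x (Suc k)) - g (x k)) *\<^sub>R f (x k)) - Is) < e / 2"
      using has_young_integral_partition[OF Is e2] by blast
    obtain \<delta>2 where \<delta>2: "\<delta>2 > 0" and It': "\<And>n x. fine_partition \<delta>2 0 t n x \<Longrightarrow>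
        norm ((\<Sum>k<n. (g (x (Suc k)) - g (x k)) *\<^sub>R f (x k)) - It) < e / 2"
      using has_young_integral_partition[OF It e2] by blast
    define \<delta> where "\<delta> = min \<delta>1 \<delta>2"
    have \<delta>: "\<delta> > 0" using \<delta>1 \<delta>2 by (simp add: \<delta>_def)
    obtain n :: nat where "t / \<delta> < real n" using reals_Archimedean2 by blast
    moreover have "t / \<delta> > 0" using \<delta> \<open>s < t\<close> st by simp
    ultimately have n: "n > 0" by (intro gr0I) auto
    with \<open>t / \<delta> < real n\<close> have tn: "t / real n < \<delta>"
      using \<delta> by (simp add: pos_divide_less_eq mult.commute)
    define x where "x k = s + (t - s) * (real k / real n)" for k
    have x_step: "x (Suc k) = x k + (t - s) / real n" for k using n by (simp add: x_def field_simps)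
    have x_ends: "x 0 = s" "x n = t" using n by (auto simp: x_def)
    have x_less: "x k < x (Suc k)" for k using \<open>s < t\<close> n by (simp add: x_step)
    have x_mesh: "x (Suc k) - x k < \<delta>" for k
    proof -
      have "(t - s) / real n \<le> t / real n" using st by (intro divide_right_mono) auto
      then show ?thesis using tn by (simp add: x_step)
    qed
    let ?R = "\<Sum>k<n. (g (x (Suc k)) - g (x k)) *\<^sub>R f (x k)"
    have R: "norm (?R - (g t - g s) *\<^sub>R f s) \<le> Kf * Kg * sewing_const (\<alpha> + \<beta>) * (t - s) powr (\<alpha> + \<beta>)"
      by (rule young_riemann_sum_bound[OF \<theta> K \<open>s < t\<close> n]) (use st in \<open>auto simp: x_def intro!: f g\<close>)
    have "norm (?R - (It - Is)) \<le> e"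
    \<comment> \<open>A \<open>fine_partition\<close> has strictly increasing points, so there is
      none of the degenerate interval at 0.\<close>
    proof (cases "s = 0")
      case True
      then have "Is = 0" using Is has_young_integral_singleton by blast
      moreover have "norm (?R - It) < e / 2"
        using n x_ends True x_less x_mesh by (intro It') (auto simp: fine_partition_def \<delta>_def)
      ultimately show ?thesis using \<open>e > 0\<close> by simp
    next
      case False
      then have s: "s > 0" using st by simp
      define z where "z k = s * (real k / real n)" for k
      have z_step: "z (Suc k) = z k + s / real n" for k using n by (simp add: z_def field_simps)
      have z_ends: "z 0 = 0" "z n = s" using n by (auto simp: z_def)
      have z_less: "z k < z (Suc k)" for k using s n by (simp add: z_step)
      have z_mesh: "z (Suc k) - z k < \<delta>" for k
      proof -
        have "s / real n \<le> t / real n" using st by (intro divide_right_mono) auto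
        then show ?thesis using tn by (simp add: z_step)
      qed
      \<comment> \<open>The points up to index \<open>n\<close> follow \<open>z\<close>, the later
        ones follow \<open>x\<close>; at index \<open>n\<close> both prescriptions give
        \<open>s\<close>.\<close>
      define y where "y k = (if k \<le> n then z k else x (k - n))" for k
      have y_shift: "y (n + k) = x k" for k using z_ends x_ends by (auto simp: y_def)
      have y_cases: "(y k = z k \<and> y (Suc k) = z (Suc k)) \<or> (\<exists>l. y k = x l \<and> y (Suc k) = x (Suc l))" for k
      proof (cases "k < n")
        case False
        then have "k = n + (k - n)" "Suc k = n + Suc (k - n)" by auto
        then show ?thesis using y_shift[of "k - n"] y_shift[of "Suc (k - n)"] by metis
      qed (simp add: y_def)
      let ?S = "\<Sum>k<n. (g (z (Suc k)) - g (z k)) *\<^sub>R f (z k)"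
      have "norm ((\<Sum>k<n + n. (g (y (Suc k)) - g (y k)) *\<^sub>R f (y k)) - It) < e / 2"
      proof (rule It')
        have "y 0 = 0" "y (n + n) = t" using y_shift[of n] x_ends z_ends by (auto simp: y_def)
        moreover have "y k < y (Suc k)" for k using y_cases[of k] x_less z_less by auto
        moreover have "y (Suc k) - y k < \<delta>2" for k
        proof -
          have "y (Suc k) - y k < \<delta>" using y_cases[of k] x_mesh z_mesh by auto
          then show ?thesis by (simp add: \<delta>_def)
        qed
        ultimately show "fine_partition \<delta>2 0 t (n + n) y" using n by (simp add: fine_partition_def)
      qed
      also have "(\<Sum>k<n + n. (g (y (Suc k)) - g (y k)) *\<^sub>R f (y k)) = ?S + ?R"
      proof -
        have "(\<Sum>k<n + n. (g (y (Suc k)) - g (y k)) *\<^sub>R f (y k))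
            = (\<Sum>k<n. (g (y (Suc k)) - g (y k)) *\<^sub>R f (y k))
              + (\<Sum>k<n. (g (y (n + Suc k)) - g (y (n + k))) *\<^sub>R f (y (n + k)))"
        proof -
          have "sum h {..<n + m} = sum h {..<n} + (\<Sum>k<m. h (n + k))" for h :: "nat \<Rightarrow> 'a" and m
            by (induction m) (simp_all add: add.assoc)
          then show ?thesis by simp
        qed
        also have "(\<Sum>k<n. (g (y (Suc k)) - g (y k)) *\<^sub>R f (y k)) = ?S"
          by (intro sum.cong) (auto simp: y_def)
        finally show ?thesis by (simp only: y_shift)
      qed
      finally have 1: "norm (?S + ?R - It) < e / 2" .
      have 2: "norm (?S - Is) < e / 2"
        using n z_ends z_less z_mesh by (intro Is') (auto simp: fine_partition_def \<delta>_def)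
      have "norm (?R - (It - Is)) = norm ((?S + ?R - It) - (?S - Is))"
        by (rule arg_cong[of _ _ norm]) simp
      then show ?thesis using 1 2 norm_triangle_ineq4[of "?S + ?R - It" "?S - Is"] by linarith
    qed
    moreover have "norm (It - Is - (g t - g s) *\<^sub>R f s)
        = norm ((?R - (g t - g s) *\<^sub>R f s) - (?R - (It - Is)))"
      by (rule arg_cong[of _ _ norm]) simp
    ultimately show "norm (It - Is - (g t - g s) *\<^sub>R f s)
        \<le> Kf * Kg * sewing_const (\<alpha> + \<beta>) * (t - s) powr (\<alpha> + \<beta>) + e"
      using R norm_triangle_ineq4[of "?R - (g t - g s) *\<^sub>R f s" "?R - (It - Is)"] by linarith
  qed
qed

lemma holder_onE:
  assumes "holder_on S \<alpha> f"
  obtains K where "K \<ge> 0" "\<And>u v. u \<in> S \<Longrightarrow> v \<in> S \<Longrightarrow> norm (f u - f v) \<le> K * \<bar>u - v\<bar> powr \<alpha>"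
proof -
  from assms obtain K where K: "\<And>s t. s \<in> S \<Longrightarrow> t \<in> S \<Longrightarrow> norm (f t - f s) \<le> K * \<bar>t - s\<bar> powr \<alpha>"
    by (auto simp: holder_on_def)
  show ?thesis
  proof (rule that[of "\<bar>K\<bar>"])
    fix u v assume "u \<in> S" "v \<in> S"
    then have "norm (f u - f v) \<le> K * \<bar>u - v\<bar> powr \<alpha>" by (rule K[rotated])
    also have "\<dots> \<le> \<bar>K\<bar> * \<bar>u - v\<bar> powr \<alpha>" by (intro mult_right_mono) auto
    finally show "norm (f u - f v) \<le> \<bar>K\<bar> * \<bar>u - v\<bar> powr \<alpha>" .
  qed simp
qed

section \<open>Solutions along a single path\<close>

definition young_path_solution ::
  "('a::euclidean_space \<Rightarrow> 'a) \<Rightarrow> ('d::finite \<Rightarrow> 'a \<Rightarrow> 'a) \<Rightarrow> (real \<Rightarrow> real^'d) \<Rightarrow> 'a \<Rightarrow> (real \<Rightarrow> 'a) \<Rightarrow> bool" where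
  "young_path_solution V0 V b x X \<longleftrightarrow> (\<forall>t\<ge>0.
    (\<forall>i. young_integrable (\<lambda>s. V i (X s)) (\<lambda>s. b s $ i) 0 t) \<and>
    X t = x + integral {0..t} (\<lambda>s. V0 (X s))
      + (\<Sum>i\<in>UNIV. young_integral (\<lambda>s. V i (X s)) (\<lambda>s. b s $ i) 0 t))"

text \<open>The Hoelder exponents hidden in \<open>young_integrable\<close> may vary with the
  coordinate and with the path, so \<open>\<theta>\<close> and \<open>C\<close> are obtained for the
  path at hand. What matters is \<open>\<theta> i > 1\<close>: the Young error over one of
  \<open>m\<close> equal steps is then small compared with 1 / m.\<close>

lemma young_equation_step:
  fixes b :: "real \<Rightarrow> real^'d::finite"
  assumes sol: "young_path_solution V0 V b x X"
    and cont: "continuous_on {0..} X" "continuous_on UNIV V0"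
    and bound: "\<And>y. norm (V0 y) \<le> A" and T: "T > 0"
  obtains C \<theta> :: "'d \<Rightarrow> real" where "\<And>i. \<theta> i > 1" "\<And>i. C i \<ge> 0"
    and "\<And>s t. 0 \<le> s \<Longrightarrow> s \<le> t \<Longrightarrow> t \<le> T \<Longrightarrow>
      norm (X t - X s - (\<Sum>i\<in>UNIV. (b t $ i - b s $ i) *\<^sub>R V i (X s)))
        \<le> A * (t - s) + (\<Sum>i\<in>UNIV. C i * (t - s) powr \<theta> i)"
proof -
  note eq = sol[unfolded young_path_solution_def, rule_format]
  define J where "J i t = young_integral (\<lambda>s. V i (X s)) (\<lambda>s. b s $ i) 0 t" for i t
  have J: "has_young_integral (\<lambda>s. V i (X s)) (\<lambda>s. b s $ i) 0 t (J i t)" if t: "t \<ge> 0" for i t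
  proof -
    obtain I where I: "has_young_integral (\<lambda>s. V i (X s)) (\<lambda>s. b s $ i) 0 t I"
      using eq[OF t] unfolding young_integrable_def by blast
    then show ?thesis unfolding J_def young_integral_eq[OF I] .
  qed
  let ?Q = "\<lambda>i C \<theta>. \<theta> > 1 \<and> C \<ge> 0 \<and> (\<forall>s t. 0 \<le> s \<longrightarrow> s \<le> t \<longrightarrow> t \<le> T \<longrightarrow>
      norm (J i t - J i s - (b t $ i - b s $ i) *\<^sub>R V i (X s)) \<le> C * (t - s) powr \<theta>)"
  have "\<exists>C \<theta>. ?Q i C \<theta>" for i
  proof -
    obtain \<alpha> \<beta> where ab: "\<alpha> \<in> {0<..1}" "\<beta> \<in> {0<..1}" "\<alpha> + \<beta> > 1"
      and f: "holder_on {0..T} \<alpha> (\<lambda>s. V i (X s))" and g: "holder_on {0..T} \<beta> (\<lambda>s. b s $ i)"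
      using J[of T i] T by (auto simp: has_young_integral_def)
    obtain Kf where Kf: "Kf \<ge> 0" "\<And>u v. u \<in> {0..T} \<Longrightarrow> v \<in> {0..T} \<Longrightarrow> norm (V i (X u) - V i (X v)) \<le> Kf * \<bar>u - v\<bar> powr \<alpha>"
      using holder_onE[OF f] by blast
    obtain Kg where Kg: "Kg \<ge> 0" "\<And>u v. u \<in> {0..T} \<Longrightarrow> v \<in> {0..T} \<Longrightarrow> norm (b u $ i - b v $ i) \<le> Kg * \<bar>u - v\<bar> powr \<beta>"
      using holder_onE[OF g] by blast
    show ?thesis
      using young_integral_increment[OF J J ab(3) _ _ Kf(1) Kg(1) _ _ _ Kf(2) Kg(2)[unfolded real_norm_def]]
        ab Kf(1) Kg(1) sewing_const_nonneg[OF ab(3)]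
      by (intro exI[of _ "Kf * Kg * sewing_const (\<alpha> + \<beta>)"] exI[of _ "\<alpha> + \<beta>"]) auto
  qed
  then have "\<forall>i. \<exists>C \<theta>. ?Q i C \<theta>" ..
  from choice[OF this] obtain C where "\<forall>i. \<exists>\<theta>. ?Q i (C i) \<theta>" ..
  from choice[OF this] obtain \<theta> where "\<forall>i. ?Q i (C i) (\<theta> i)" ..
  then have C: "\<And>i. \<theta> i > 1" "\<And>i. C i \<ge> 0"
    and step: "\<And>i s t. 0 \<le> s \<Longrightarrow> s \<le> t \<Longrightarrow> t \<le> T \<Longrightarrow>
      norm (J i t - J i s - (b t $ i - b s $ i) *\<^sub>R V i (X s)) \<le> C i * (t - s) powr \<theta> i"
    by blast+
  show ?thesis
  proof (rule that[OF C])
    fix s t assume st: "0 \<le> s" "s \<le> t" "t \<le> T"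
    have "continuous_on {0..t} (\<lambda>u. V0 (X u))"
      by (intro continuous_on_compose2[OF cont(2)] continuous_on_subset[OF cont(1)]) auto
    then have int: "(\<lambda>u. V0 (X u)) integrable_on {0..t}" by (rule integrable_continuous_real)
    have "integral {0..s} (\<lambda>u. V0 (X u)) + integral {s..t} (\<lambda>u. V0 (X u)) = integral {0..t} (\<lambda>u. V0 (X u))"
      using st by (intro Henstock_Kurzweil_Integration.integral_combine int) auto
    then have "X t - X s - (\<Sum>i\<in>UNIV. (b t $ i - b s $ i) *\<^sub>R V i (X s))
        = integral {s..t} (\<lambda>u. V0 (X u))
          + (\<Sum>i\<in>UNIV. J i t - J i s - (b t $ i - b s $ i) *\<^sub>R V i (X s))"
      using eq[of s] eq[of t] st unfolding J_def[symmetric] sum_subtractf by (simp add: algebra_simps)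
    also have "norm \<dots> \<le> A * (t - s) + (\<Sum>i\<in>UNIV. C i * (t - s) powr \<theta> i)"
    proof (rule norm_triangle_le, rule add_mono)
      show "norm (\<Sum>i\<in>UNIV. J i t - J i s - (b t $ i - b s $ i) *\<^sub>R V i (X s))
          \<le> (\<Sum>i\<in>UNIV. C i * (t - s) powr \<theta> i)"
        by (intro sum_norm_le step st)
      show "norm (integral {s..t} (\<lambda>u. V0 (X u))) \<le> A * (t - s)"
        using st by (intro integral_bound continuous_on_subset[OF \<open>continuous_on {0..t} (\<lambda>u. V0 (X u))\<close>] bound) auto
    qed
    finally show "norm (X t - X s - (\<Sum>i\<in>UNIV. (b t $ i - b s $ i) *\<^sub>R V i (X s)))
        \<le> A * (t - s) + (\<Sum>i\<in>UNIV. C i * (t - s) powr \<theta> i)" .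
  qed
qed

lemma young_equation_initial:
  assumes sol: "young_path_solution V0 V b x X"
  shows "X 0 = x"
proof -
  note eq = sol[unfolded young_path_solution_def, rule_format, of 0, simplified]
  have "young_integral (\<lambda>s. V i (X s)) (\<lambda>s. b s $ i) 0 0 = 0" for i
  proof -
    obtain I where I: "has_young_integral (\<lambda>s. V i (X s)) (\<lambda>s. b s $ i) 0 0 I"
      using eq unfolding young_integrable_def by blast
    then show ?thesis using young_integral_eq[OF I] has_young_integral_singleton[OF I] by simp
  qed
  then show ?thesis using eq by simp
qed

section \<open>Sub-Gaussian random variables\<close>

text \<open>For a centred variable the linear term integrates to 0, so the moment generating
  function is controlled by an exponential square moment.\<close>

lemma exp_le_add_exp_square: "exp x \<le> x + exp (x\<^sup>2)" for x :: real
proof -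
  consider "x \<ge> 1" | "0 \<le> x" "x \<le> 1" | "x \<le> 0" by linarith
  then show ?thesis
  proof cases
    case 1
    then have "x \<le> x\<^sup>2" by (simp add: power2_eq_square)
    then have "exp x \<le> exp (x\<^sup>2)" by simp
    then show ?thesis using 1 by linarith
  next
    case 2
    then have "exp x \<le> 1 + x + x\<^sup>2" by (intro exp_bound)
    moreover have "1 + x\<^sup>2 \<le> exp (x\<^sup>2)" by (rule exp_ge_add_one_self)
    ultimately show ?thesis by linarith
  next
    case 3
    define y where "y = - x"
    have y: "y \<ge> 0" using 3 by (simp add: y_def)
    \<comment> \<open>The factor \<open>1 + y\<close> brings the exponential below 1 and turns the
      polynomial \<open>1 - y + y\<^sup>2\<close> into \<open>1 + y ^ 3\<close>.\<close>
    have "exp (- y) * (1 + y) \<le> exp (- y) * exp y"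
      using exp_ge_add_one_self[of y] by (intro mult_left_mono) auto
    also have "\<dots> = 1" by (simp add: exp_minus)
    also have "\<dots> \<le> 1 + y ^ 3" using y by simp
    also have "\<dots> = (1 - y + y\<^sup>2) * (1 + y)" by (simp add: power2_eq_square power3_eq_cube algebra_simps)
    finally have "exp (- y) \<le> 1 - y + y\<^sup>2" by (rule mult_right_le_imp_le) (use y in simp)
    then have "exp x \<le> 1 + x + x\<^sup>2" by (simp add: y_def)
    moreover have "1 + x\<^sup>2 \<le> exp (x\<^sup>2)" by (rule exp_ge_add_one_self)
    ultimately show ?thesis by linarith
  qed
qed

text \<open>Convexity between 0 and \<open>u\<close>; the factor \<open>p\<close> in front is what
  yields a bound quadratic in \<open>s\<close> for small \<open>s\<close> below.\<close>

lemma exp_scaled_le: "exp (p * u) \<le> 1 + p * (exp u - 1)" if "0 \<le> p" "p \<le> 1" for p u :: real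
proof -
  have "exp ((1 - p) *\<^sub>R 0 + p *\<^sub>R u) \<le> (1 - p) * exp 0 + p * exp u"
    by (rule convex_onD[OF exp_convex]) (use that in auto)
  then show ?thesis by (simp add: right_diff_distrib)
qed

text \<open>The mean is controlled by the second moment, and centring replaces
  \<open>\<tau>\<^sup>2\<close> by \<open>2 * \<tau>\<^sup>2\<close> and \<open>K\<close> by
  \<open>K * exp K\<close>. A bound on the moment generating function with exponent quadratic in
  \<open>s\<close> then gives the tail by Chernoff's method.\<close>

lemma (in prob_space) subgaussian_centered_tail:
  fixes Z :: "'a \<Rightarrow> real"
  assumes [measurable]: "Z \<in> borel_measurable M" and \<tau>: "\<tau> > 0"
    and K: "(\<integral>\<^sup>+w. ennreal (exp ((Z w)\<^sup>2 / \<tau>\<^sup>2)) \<partial>M) \<le> ennreal K"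
  shows "integrable M Z"
    and "l \<ge> 0 \<Longrightarrow> prob {w\<in>space M. Z w - expectation Z \<ge> l}
      \<le> exp (- (l\<^sup>2 / (4 * (2 * (K * exp K) + 1) * \<tau>\<^sup>2)))"
proof -
  have K1: "K \<ge> 1"
  proof -
    have "1 = (\<integral>\<^sup>+w. 1 \<partial>M)" by (simp add: emeasure_space_1)
    also have "\<dots> \<le> (\<integral>\<^sup>+w. ennreal (exp ((Z w)\<^sup>2 / \<tau>\<^sup>2)) \<partial>M)"
      by (intro nn_integral_mono) (simp add: ennreal_ge_1)
    also note K
    finally show ?thesis by (simp add: ennreal_ge_1)
  qed
  have int_exp: "integrable M (\<lambda>w. exp ((Z w)\<^sup>2 / \<tau>\<^sup>2))"
    using K by (intro integrableI_nonneg) (auto intro: le_less_trans)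
  have E_exp: "expectation (\<lambda>w. exp ((Z w)\<^sup>2 / \<tau>\<^sup>2)) \<le> K"
    using K K1 int_exp by (simp add: nn_integral_eq_integral)
  have sq: "(Z w)\<^sup>2 \<le> \<tau>\<^sup>2 * exp ((Z w)\<^sup>2 / \<tau>\<^sup>2)" for w
  proof -
    have "(Z w)\<^sup>2 / \<tau>\<^sup>2 \<le> exp ((Z w)\<^sup>2 / \<tau>\<^sup>2)" using exp_ge_add_one_self[of "(Z w)\<^sup>2 / \<tau>\<^sup>2"] by linarith
    then show ?thesis using \<tau> by (simp add: field_simps)
  qed
  have int_sq: "integrable M (\<lambda>w. (Z w)\<^sup>2)"
    by (rule Bochner_Integration.integrable_bound[of _ "\<lambda>w. \<tau>\<^sup>2 * exp ((Z w)\<^sup>2 / \<tau>\<^sup>2)"])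
      (use int_exp sq in auto)
  show int: "integrable M Z" using int_sq by (rule square_integrable_imp_integrable[rotated]) simp
  define \<mu> where "\<mu> = expectation Z"
  have "expectation (\<lambda>w. (Z w)\<^sup>2) \<le> expectation (\<lambda>w. \<tau>\<^sup>2 * exp ((Z w)\<^sup>2 / \<tau>\<^sup>2))"
    using int_sq int_exp sq by (intro integral_mono) auto
  also have "\<dots> \<le> \<tau>\<^sup>2 * K" using E_exp by (simp add: mult_left_mono)
  finally have "expectation (\<lambda>w. (Z w)\<^sup>2) \<le> \<tau>\<^sup>2 * K" .
  moreover have "0 \<le> variance Z" by (rule Bochner_Integration.integral_nonneg) simp
  ultimately have "\<mu>\<^sup>2 \<le> \<tau>\<^sup>2 * K" using variance_eq[OF int int_sq] by (simp add: \<mu>_def)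
  then have \<mu>: "\<mu>\<^sup>2 / \<tau>\<^sup>2 \<le> K" using \<tau> by (simp add: field_simps)
  define Y where "Y w = Z w - \<mu>" for w
  define K' where "K' = K * exp K"
  have K'1: "K' \<ge> 1" using K1 mult_mono[of 1 K 1 "exp K"] by (simp add: K'_def)
  have [measurable]: "Y \<in> borel_measurable M" unfolding Y_def by measurable
  have Y_exp: "exp ((Y w)\<^sup>2 / (2 * \<tau>\<^sup>2)) \<le> exp K * exp ((Z w)\<^sup>2 / \<tau>\<^sup>2)" for w
  proof -
    have "(Y w)\<^sup>2 \<le> 2 * (Z w)\<^sup>2 + 2 * \<mu>\<^sup>2"
      using zero_le_power2[of "Z w + \<mu>"] by (simp add: Y_def power2_eq_square algebra_simps)
    then have "(Y w)\<^sup>2 / (2 * \<tau>\<^sup>2) \<le> (2 * (Z w)\<^sup>2 + 2 * \<mu>\<^sup>2) / (2 * \<tau>\<^sup>2)"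
      by (intro divide_right_mono) auto
    also have "\<dots> = (Z w)\<^sup>2 / \<tau>\<^sup>2 + \<mu>\<^sup>2 / \<tau>\<^sup>2" using \<tau> by (simp add: add_divide_distrib)
    also have "\<dots> \<le> K + (Z w)\<^sup>2 / \<tau>\<^sup>2" using \<mu> by linarith
    finally show ?thesis by (simp add: exp_add[symmetric])
  qed
  have int_Y: "integrable M (\<lambda>w. exp ((Y w)\<^sup>2 / (2 * \<tau>\<^sup>2)))"
    by (rule Bochner_Integration.integrable_bound[of _ "\<lambda>w. exp K * exp ((Z w)\<^sup>2 / \<tau>\<^sup>2)"])
      (use int_exp Y_exp in auto)
  have "expectation (\<lambda>w. exp ((Y w)\<^sup>2 / (2 * \<tau>\<^sup>2))) \<le> expectation (\<lambda>w. exp K * exp ((Z w)\<^sup>2 / \<tau>\<^sup>2))"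
    using int_Y int_exp Y_exp by (intro integral_mono) auto
  also have "\<dots> \<le> K'" using E_exp by (simp add: K'_def mult.commute)
  finally have E_Y: "expectation (\<lambda>w. exp ((Y w)\<^sup>2 / (2 * \<tau>\<^sup>2))) \<le> K'" .
  have "Y = (\<lambda>w. Z w - \<mu>)" by (simp add: Y_def fun_eq_iff)
  then have mean_Y: "expectation Y = 0" "integrable M Y"
    using int by (simp_all add: \<mu>_def prob_space)
  \<comment> \<open>With \<open>p = 2 * s\<^sup>2 * \<tau>\<^sup>2\<close>, both regimes below end
    with an exponent of at most \<open>p * K' + s\<^sup>2 * \<tau>\<^sup>2\<close>, which is
    \<open>b * s\<^sup>2 * \<tau>\<^sup>2\<close>.\<close>
  define b where "b = 2 * K' + 1"
  have mgf: "integrable M (\<lambda>w. exp (s * Y w)) \<and> expectation (\<lambda>w. exp (s * Y w)) \<le> exp (b * s\<^sup>2 * \<tau>\<^sup>2)" for s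
  proof -
    have young: "exp (s * Y w) \<le> exp (s\<^sup>2 * \<tau>\<^sup>2 / 2) * exp ((Y w)\<^sup>2 / (2 * \<tau>\<^sup>2))" for w
    proof -
      have "0 \<le> (s * \<tau> - Y w / \<tau>)\<^sup>2" by simp
      then have "s * Y w \<le> s\<^sup>2 * \<tau>\<^sup>2 / 2 + (Y w)\<^sup>2 / (2 * \<tau>\<^sup>2)"
        using \<tau> by (simp add: power2_diff power_mult_distrib power_divide)
      then show ?thesis by (simp add: exp_add[symmetric])
    qed
    have int_s: "integrable M (\<lambda>w. exp (s * Y w))"
      by (rule Bochner_Integration.integrable_bound[of _ "\<lambda>w. exp (s\<^sup>2 * \<tau>\<^sup>2 / 2) * exp ((Y w)\<^sup>2 / (2 * \<tau>\<^sup>2))"])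
        (use int_Y young in auto)
    define p where "p = 2 * s\<^sup>2 * \<tau>\<^sup>2"
    have p0: "p \<ge> 0" by (simp add: p_def)
    have "expectation (\<lambda>w. exp (s * Y w)) \<le> exp (b * s\<^sup>2 * \<tau>\<^sup>2)"
    \<comment> \<open>For small \<open>s\<close> the vanishing mean removes the term linear in
      \<open>s\<close>. For large \<open>s\<close> the quadratic exponent outweighs the constant
      \<open>K'\<close>, so the bound \<open>young\<close> is sharp enough.\<close>
    proof (cases "p \<le> 1")
      case True
      have "exp (s * Y w) \<le> s * Y w + (1 + p * (exp ((Y w)\<^sup>2 / (2 * \<tau>\<^sup>2)) - 1))" for w
      proof -
        have "exp ((s * Y w)\<^sup>2) = exp (p * ((Y w)\<^sup>2 / (2 * \<tau>\<^sup>2)))"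
          using \<tau> by (simp add: p_def power_mult_distrib)
        then show ?thesis
          using exp_le_add_exp_square[of "s * Y w"] exp_scaled_le[OF p0 True, of "(Y w)\<^sup>2 / (2 * \<tau>\<^sup>2)"]
          by linarith
      qed
      then have "expectation (\<lambda>w. exp (s * Y w))
          \<le> expectation (\<lambda>w. s * Y w + (1 + p * (exp ((Y w)\<^sup>2 / (2 * \<tau>\<^sup>2)) - 1)))"
        using int_s int_Y mean_Y by (intro integral_mono) auto
      also have "\<dots> = 1 + p * (expectation (\<lambda>w. exp ((Y w)\<^sup>2 / (2 * \<tau>\<^sup>2))) - 1)"
        using int_Y mean_Y by (simp add: prob_space)
      also have "\<dots> \<le> 1 + p * K'" using E_Y p0 by (intro add_left_mono mult_left_mono) auto
      also have "\<dots> \<le> exp (p * K')" by (rule exp_ge_add_one_self)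
      also have "\<dots> \<le> exp (b * s\<^sup>2 * \<tau>\<^sup>2)" by (simp add: p_def b_def algebra_simps)
      finally show ?thesis .
    next
      case False
      have "expectation (\<lambda>w. exp (s * Y w))
          \<le> expectation (\<lambda>w. exp (s\<^sup>2 * \<tau>\<^sup>2 / 2) * exp ((Y w)\<^sup>2 / (2 * \<tau>\<^sup>2)))"
        using int_s int_Y young by (intro integral_mono) auto
      also have "\<dots> \<le> exp (s\<^sup>2 * \<tau>\<^sup>2 / 2) * K'" using E_Y by simp
      also have "K' \<le> exp K'" using exp_ge_add_one_self[of K'] by linarith
      also have "exp K' \<le> exp (p * K')" using False K'1 by simp
      also have "exp (s\<^sup>2 * \<tau>\<^sup>2 / 2) * exp (p * K') = exp (s\<^sup>2 * \<tau>\<^sup>2 / 2 + p * K')"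
        by (simp add: exp_add)
      also have "\<dots> \<le> exp (b * s\<^sup>2 * \<tau>\<^sup>2)" by (simp add: p_def b_def algebra_simps)
      finally show ?thesis by simp
    qed
    with int_s show ?thesis by simp
  qed
  assume l: "l \<ge> 0"
  have b: "b > 0" using K'1 by (simp add: b_def)
  \<comment> \<open>The minimiser of \<open>b * s\<^sup>2 * \<tau>\<^sup>2 - s * l\<close>.\<close>
  define s where "s = l / (2 * b * \<tau>\<^sup>2)"
  have s: "s \<ge> 0" using l b by (simp add: s_def)
  have "prob {w\<in>space M. Z w - expectation Z \<ge> l} \<le> prob {w\<in>space M. exp (s * Y w) \<ge> exp (s * l)}"
    using s by (intro finite_measure_mono) (auto simp: Y_def \<mu>_def mult_left_mono)
  also have "\<dots> \<le> expectation (\<lambda>w. exp (s * Y w)) / exp (s * l)"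
    using mgf by (intro integral_Markov_inequality_measure[where A = "{}"]) auto
  also have "\<dots> \<le> exp (b * s\<^sup>2 * \<tau>\<^sup>2) / exp (s * l)" using mgf by (intro divide_right_mono) auto
  also have "\<dots> = exp (b * s\<^sup>2 * \<tau>\<^sup>2 - s * l)" by (simp add: exp_diff)
  also have "b * s\<^sup>2 * \<tau>\<^sup>2 - s * l = - (l\<^sup>2 / (4 * b * \<tau>\<^sup>2))"
    using b \<tau> by (simp add: s_def field_simps power2_eq_square)
  finally show "prob {w\<in>space M. Z w - expectation Z \<ge> l}
      \<le> exp (- (l\<^sup>2 / (4 * (2 * (K * exp K) + 1) * \<tau>\<^sup>2)))"
    by (simp add: b_def K'_def)
qed

section \<open>Exponential moments of the running supremum\<close>

text \<open>The lists \<open>[]\<close> and \<open>[v]\<close> give bounds on \<open>f\<close> and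
  on each directional derivative. Expanding a direction in the basis bounds the operator norm of the
  derivative, and the mean value inequality does the rest.\<close>

lemma smooth_bounded_lipschitz:
  fixes f :: "'a::euclidean_space \<Rightarrow> 'b::real_normed_vector"
  assumes "smooth_bounded f"
  obtains A where "\<And>x. norm (f x) \<le> A" "\<And>x y. norm (f x - f y) \<le> A * norm (x - y)"
    "continuous_on UNIV f"
proof -
  have diff: "f differentiable (at x)" for x
    using assms unfolding smooth_bounded_def smooth_def by (metis iterated_derivative.simps(1))
  let ?f' = "\<lambda>x. frechet_derivative f (at x)"
  have f': "(f has_derivative ?f' x) (at x)" for x using diff frechet_derivative_works by blast
  have bdd: "bounded (range (iterated_derivative vs f))" for vs
    using assms by (simp add: smooth_bounded_def)
  obtain A0 where A0: "\<And>x. norm (f x) \<le> A0" using bdd[of "[]"] by (auto simp: bounded_iff)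
  have "\<forall>v. \<exists>c. \<forall>x. norm (?f' x v) \<le> c" using bdd[of "[_]"] by (auto simp: bounded_iff)
  from choice[OF this] obtain c where c: "\<And>v x. norm (?f' x v) \<le> c v" by blast
  define A1 where "A1 = (\<Sum>v\<in>Basis. c v)"
  have c0: "c v \<ge> 0" for v using c[of undefined v] norm_ge_zero order_trans by blast
  have A1: "A1 \<ge> 0" unfolding A1_def by (intro sum_nonneg c0)
  have onorm: "onorm (?f' x) \<le> A1" for x
  proof (rule onorm_bound[OF A1])
    fix u
    have lin: "linear (?f' x)" by (rule has_derivative_linear[OF f'])
    have "?f' x u = ?f' x (\<Sum>v\<in>Basis. (u \<bullet> v) *\<^sub>R v)" by (simp add: euclidean_representation)
    also have "\<dots> = (\<Sum>v\<in>Basis. (u \<bullet> v) *\<^sub>R ?f' x v)"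
      by (simp add: linear_sum[OF lin] linear_scale[OF lin])
    also have "norm \<dots> \<le> (\<Sum>v\<in>Basis. norm u * c v)"
      by (intro sum_norm_le) (auto intro!: mult_mono c Basis_le_norm c0)
    finally show "norm (?f' x u) \<le> A1 * norm u" by (simp add: A1_def sum_distrib_left mult.commute)
  qed
  have lip: "norm (f x - f y) \<le> A1 * norm (x - y)" for x y
    by (rule differentiable_bound[of UNIV f ?f']) (use f' onorm in auto)
  have "A0 \<ge> 0" using A0[of undefined] norm_ge_zero order_trans by blast
  show ?thesis
  proof (rule that[of "A0 + A1"])
    show "norm (f x) \<le> A0 + A1" for x using A0[of x] A1 by linarith
    show "norm (f x - f y) \<le> (A0 + A1) * norm (x - y)" for x y
      using lip[of x y] \<open>A0 \<ge> 0\<close> by (simp add: distrib_right add_increasing)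
    show "continuous_on UNIV f"
      using diff by (intro continuous_at_imp_continuous_on ballI differentiable_imp_continuous_within) auto
  qed
qed

text \<open>Here \<open>y (k, c)\<close> is the \<open>c\<close>-th coordinate of the \<open>k\<close>-th increment of a discrete path; the grid
  has mesh \<open>1 / m\<close>.\<close>

definition holder_increments :: "real \<Rightarrow> real \<Rightarrow> nat \<Rightarrow> (nat \<times> 'd::finite \<Rightarrow> real) set" where
  "holder_increments a \<gamma> m = {y \<in> extensional ({..<m} \<times> UNIV). \<forall>i j. i \<le> j \<and> j \<le> m \<longrightarrow>
    norm (\<chi> c. \<Sum>k=i..<j. y (k, c)) \<le> a * ((real j - real i) / real m) powr \<gamma>}"

definition holder_distance :: "real \<Rightarrow> real \<Rightarrow> nat \<Rightarrow> (nat \<times> 'd::finite \<Rightarrow> real) \<Rightarrow> real" where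
  "holder_distance a \<gamma> m y =
    (INF z\<in>holder_increments a \<gamma> m. \<Sum>p\<in>{..<m} \<times> UNIV. \<bar>y p - z p\<bar>)"

text \<open>The zero path belongs to the set; over an empty set the infimum in
  \<open>holder_distance\<close> would carry no information.\<close>

lemma holder_increments_nonempty:
  assumes "a \<ge> 0"
  shows "(holder_increments a \<gamma> m :: (nat \<times> 'a::finite \<Rightarrow> real) set) \<noteq> {}"
proof -
  have "(\<lambda>p\<in>{..<m} \<times> UNIV. 0) \<in> (holder_increments a \<gamma> m :: (nat \<times> 'a \<Rightarrow> real) set)"
  proof -
    have "(\<chi> c. \<Sum>k=i..<j. (\<lambda>p\<in>{..<m} \<times> UNIV. 0::real) (k, c)) = (0 :: real^'a)"
      if "j \<le> m" for i j using that by (auto simp: vec_eq_iff intro!: sum.neutral)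
    then have "norm (\<chi> c::'a. \<Sum>k=i..<j. (\<lambda>p\<in>{..<m} \<times> UNIV. 0::real) (k, c))
        \<le> a * ((real j - real i) / real m) powr \<gamma>" if "j \<le> m" for i j
      using assms that by (metis norm_zero mult_nonneg_nonneg powr_ge_zero)
    then show ?thesis by (simp only: holder_increments_def mem_Collect_eq restrict_extensional) blast
  qed
  then show ?thesis by blast
qed

lemma l1_distance_bdd_below: "bdd_below ((\<lambda>z. \<Sum>p\<in>J. \<bar>y p - z p :: real\<bar>) ` S)"
proof (rule bdd_belowI)
  fix x assume "x \<in> (\<lambda>z. \<Sum>p\<in>J. \<bar>y p - z p :: real\<bar>) ` S"
  then obtain z where "x = (\<Sum>p\<in>J. \<bar>y p - z p\<bar>)" by blast
  then show "0 \<le> x" by (metis sum_nonneg abs_ge_zero)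
qed

lemma holder_distance_le:
  "z \<in> holder_increments a \<gamma> m \<Longrightarrow> holder_distance a \<gamma> m y \<le> (\<Sum>p\<in>{..<m} \<times> UNIV. \<bar>y p - z p\<bar>)"
  unfolding holder_distance_def by (rule cINF_lower[OF l1_distance_bdd_below])

lemma holder_distance_greatest:
  "a \<ge> 0 \<Longrightarrow> (\<And>z. z \<in> holder_increments a \<gamma> m \<Longrightarrow> c \<le> (\<Sum>p\<in>{..<m} \<times> UNIV. \<bar>y p - z p\<bar>))
    \<Longrightarrow> c \<le> holder_distance a \<gamma> m y"
  unfolding holder_distance_def by (rule cINF_greatest[OF holder_increments_nonempty])

lemma holder_distance_nonneg: "a \<ge> 0 \<Longrightarrow> 0 \<le> holder_distance a \<gamma> m y"
  by (rule holder_distance_greatest, assumption, rule sum_nonneg, rule abs_ge_zero)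

lemma holder_distance_lipschitz:
  assumes "a \<ge> 0"
  shows "\<bar>holder_distance a \<gamma> m y - holder_distance a \<gamma> m y'\<bar> \<le> (\<Sum>p\<in>{..<m} \<times> UNIV. \<bar>y p - y' p\<bar>)"
proof -
  have *: "holder_distance a \<gamma> m y - (\<Sum>p\<in>{..<m} \<times> UNIV. \<bar>y p - y' p\<bar>) \<le> holder_distance a \<gamma> m y'" for y y' :: "nat \<times> 'a \<Rightarrow> real"
  proof (rule holder_distance_greatest[OF assms])
    fix z :: "nat \<times> 'a \<Rightarrow> real" assume z: "z \<in> holder_increments a \<gamma> m"
    have "(\<Sum>p\<in>{..<m} \<times> UNIV. \<bar>y p - z p\<bar>) \<le> (\<Sum>p\<in>{..<m} \<times> UNIV. \<bar>y p - y' p\<bar> + \<bar>y' p - z p\<bar>)"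
      by (intro sum_mono) linarith
    then show "holder_distance a \<gamma> m y - (\<Sum>p\<in>{..<m} \<times> UNIV. \<bar>y p - y' p\<bar>) \<le> (\<Sum>p\<in>{..<m} \<times> UNIV. \<bar>y' p - z p\<bar>)"
      using holder_distance_le[OF z, of y] by (simp add: sum.distrib)
  qed
  show ?thesis using *[of y y'] *[of y' y] by (simp add: abs_le_iff abs_minus_commute)
qed

text \<open>An infimum over an uncountable family need not be measurable, but the distance is
  Lipschitz in finitely many coordinates and hence continuous for the product topology. The index
  type is countable, so the Borel sets of the full product are those of the product
  sigma-algebra.\<close>

lemma holder_distance_measurable:
  assumes "a \<ge> 0"
  shows "(holder_distance a \<gamma> m :: (nat \<times> 'd::finite \<Rightarrow> real) \<Rightarrow> real) \<in> borel_measurable (PiM ({..<m} \<times> UNIV) (\<lambda>_. borel))"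
proof -
  let ?J = "{..<m} \<times> (UNIV :: 'd set)"
  let ?\<Phi> = "holder_distance a \<gamma> m :: (nat \<times> 'd \<Rightarrow> real) \<Rightarrow> real"
  have "isCont ?\<Phi> y0" for y0 unfolding isCont_def
  proof (rule Lim_transform[OF tendsto_const])
    have coord: "((\<lambda>y. y p) \<longlongrightarrow> y0 p) (at y0)" for p :: "nat \<times> 'd"
      using continuous_on_product_coordinates[of p] unfolding continuous_on_def by blast
    show "((\<lambda>y. ?\<Phi> y - ?\<Phi> y0) \<longlongrightarrow> 0) (at y0)"
    proof (rule Lim_null_comparison)
      show "\<forall>\<^sub>F y in at y0. norm (?\<Phi> y - ?\<Phi> y0) \<le> (\<Sum>p\<in>?J. \<bar>y p - y0 p\<bar>)" unfolding real_norm_def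
        by (intro always_eventually allI holder_distance_lipschitz[OF assms])
      have "((\<lambda>y. \<Sum>p\<in>?J. \<bar>y p - y0 p\<bar>) \<longlongrightarrow> (\<Sum>p\<in>?J. \<bar>y0 p - y0 p\<bar>)) (at y0)"
        by (intro tendsto_sum tendsto_rabs tendsto_diff coord tendsto_const)
      then show "((\<lambda>y. \<Sum>p\<in>?J. \<bar>y p - y0 p\<bar>) \<longlongrightarrow> 0) (at y0)" by simp
    qed
  qed
  then have "?\<Phi> \<in> borel_measurable borel"
    by (intro borel_measurable_continuous_onI continuous_at_imp_continuous_on) auto
  then have \<Phi>: "?\<Phi> \<in> borel_measurable (PiM UNIV (\<lambda>_. borel))"
    by (simp add: measurable_cong_sets[OF sets_PiM_equal_borel refl])
  \<comment> \<open>Elements of the product over \<open>?J\<close> take the value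
    \<open>undefined\<close> elsewhere, so this embedding into the full product is the identity on
    them.\<close>
  have "(\<lambda>y. \<lambda>p\<in>UNIV. if p \<in> ?J then y p else undefined) \<in> PiM ?J (\<lambda>_. borel) \<rightarrow>\<^sub>M PiM UNIV (\<lambda>_. borel :: real measure)"
  proof (rule measurable_restrict)
    fix p :: "nat \<times> 'd"
    show "(\<lambda>y. if p \<in> ?J then y p else undefined) \<in> borel_measurable (PiM ?J (\<lambda>_. borel :: real measure))"
      by (cases "p \<in> ?J") auto
  qed
  from measurable_compose[OF this \<Phi>] show ?thesis by (rule measurable_cong[THEN iffD1, rotated])
      (auto simp: space_PiM PiE_def extensional_def intro!: arg_cong[of _ _ ?\<Phi>])
qed

lemma space_PiM_borel: "space (PiM J (\<lambda>_. borel :: real measure)) = extensional J"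
  by (auto simp: space_PiM PiE_iff extensional_def)

lemma holder_increments_sets:
  "(holder_increments a \<gamma> m :: (nat \<times> 'd::finite \<Rightarrow> real) set) \<in> sets (PiM ({..<m} \<times> UNIV) (\<lambda>_. borel))"
proof -
  let ?J = "{..<m} \<times> (UNIV :: 'd set)"
  let ?P = "PiM ?J (\<lambda>_. borel :: real measure)"
  have "{y\<in>space ?P. \<forall>i j. i \<le> j \<and> j \<le> m \<longrightarrow>
      norm (\<chi> c. \<Sum>k=i..<j. y (k, c)) \<le> a * ((real j - real i) / real m) powr \<gamma>} \<in> sets ?P"
  proof (intro sets.sets_Collect_countable_All)
    fix i j
    show "{y\<in>space ?P. i \<le> j \<and> j \<le> m \<longrightarrow>
      norm (\<chi> c. \<Sum>k=i..<j. y (k, c)) \<le> a * ((real j - real i) / real m) powr \<gamma>} \<in> sets ?P"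
    proof (cases "i \<le> j \<and> j \<le> m")
      case True
      have "(\<lambda>y. \<Sum>k=i..<j. y (k, c)) \<in> borel_measurable ?P" for c :: 'd
        using True by (intro borel_measurable_sum measurable_component_singleton) auto
      then have "(\<lambda>y. (\<chi> c. \<Sum>k=i..<j. y (k, c)) :: real^'d) \<in> borel_measurable ?P"
        by (subst borel_measurable_euclidean_space) (auto simp: Basis_vec_def inner_axis)
      then have "(\<lambda>y. norm ((\<chi> c. \<Sum>k=i..<j. y (k, c)) :: real^'d)) \<in> borel_measurable ?P"
        by (rule measurable_compose[OF _ borel_measurable_norm])
      then show ?thesis using True by simp
    next
      case False
      then have "{y\<in>space ?P. i \<le> j \<and> j \<le> m \<longrightarrow>
        norm (\<chi> c. \<Sum>k=i..<j. y (k, c)) \<le> a * ((real j - real i) / real m) powr \<gamma>} = space ?P"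
        by blast
      then show ?thesis by (simp only: sets.top)
    qed
  qed
  then show ?thesis unfolding holder_increments_def space_PiM_borel .
qed

section \<open>Growth of a solution in terms of the distance\<close>

definition bounded_lipschitz_fields :: "real \<Rightarrow> ('d::finite \<Rightarrow> 'a::real_normed_vector \<Rightarrow> 'a) \<Rightarrow> bool" where
  "bounded_lipschitz_fields A V \<longleftrightarrow>
    (\<forall>p (u::real^'d). norm (\<Sum>i\<in>UNIV. u $ i *\<^sub>R V i p) \<le> A * norm u) \<and>
    (\<forall>p q (u::real^'d). norm ((\<Sum>i\<in>UNIV. u $ i *\<^sub>R V i p) - (\<Sum>i\<in>UNIV. u $ i *\<^sub>R V i q))
      \<le> A * norm (p - q) * norm u)"

text \<open>For each Hoelder \<open>z\<close> the increments of \<open>b\<close> are split into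
  \<open>z\<close> and a rest. Drift, Young error and rest form the perturbation of a discrete
  equation, so \<open>growth_bound\<close> applies. The factor in front of the last bracket is
  \<open>global_const\<close> with its threshold inserted, and the sum with \<open>C i\<close> is
  the accumulated Young error of the \<open>m\<close> steps.\<close>

lemma path_growth:
  fixes X b :: "real \<Rightarrow> real^'d::finite" and V :: "'d \<Rightarrow> real^'d \<Rightarrow> real^'d" and T a \<gamma> :: real and m :: nat
  defines "y \<equiv> (\<lambda>p\<in>{..<m} \<times> UNIV. b (T / real m * real (Suc (fst p))) $ snd p - b (T / real m * real (fst p)) $ snd p)"
  assumes A: "A \<ge> 1" and A0: "A0 \<ge> 0" and T: "T > 0" and m: "m > 0" and a: "a > 0" and \<gamma>: "1/2 < \<gamma>" "\<gamma> \<le> 1"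
    and fields: "bounded_lipschitz_fields A V"
    and C: "\<And>i. C i \<ge> 0"
    and step: "\<And>s t. 0 \<le> s \<Longrightarrow> s \<le> t \<Longrightarrow> t \<le> T \<Longrightarrow>
      norm (X t - X s - (\<Sum>i\<in>UNIV. (b t $ i - b s $ i) *\<^sub>R V i (X s)))
        \<le> A0 * (t - s) + (\<Sum>i\<in>UNIV. C i * (t - s) powr \<theta> i)"
    and j: "j \<le> m"
  shows "norm (X (T / real m * real j) - X 0) \<le> (A + 2) * a
    + (1 + (2 * A + 2) * (1 + (A * (A + 2) * sewing_const (2 * \<gamma>) * a)\<^sup>2))
      * (a + A0 * T + (\<Sum>i\<in>UNIV. C i * (real m * (T / real m) powr \<theta> i)) + A * holder_distance a \<gamma> m y)"
    (is "_ \<le> ?C1 * a + ?G * (a + A0 * T + ?E + A * _)")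
proof -
  define h where "h = T / real m"
  have h: "h > 0" using T m by (simp add: h_def)
  have hm: "h * real m = T" using m by (simp add: h_def)
  have G1: "?G \<ge> 1" using A by simp
  then have GA: "?G * A > 0" using A by (intro mult_pos_pos) linarith+
  let ?N = "norm (X (h * real j) - X 0)"
  \<comment> \<open>Solved for the distance, the estimate is a lower bound valid for every
    \<open>z\<close>, so it passes to the infimum whether or not that is attained.\<close>
  have "(?N - ?C1 * a - ?G * (a + A0 * T + ?E)) / (?G * A) \<le> holder_distance a \<gamma> m y"
  proof (rule holder_distance_greatest)
    show "a \<ge> 0" using a by simp
    fix z :: "nat \<times> 'd \<Rightarrow> real" assume z: "z \<in> holder_increments a \<gamma> m"
    define \<sigma> where "\<sigma> p u = (\<Sum>i\<in>UNIV. u $ i *\<^sub>R V i p)" for p and u :: "real^'d"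
    have bounded: "norm (\<sigma> p u) \<le> A * norm u"
      and lipschitz: "norm (\<sigma> p u - \<sigma> q u) \<le> A * norm (p - q) * norm u" for p q u
      using fields by (auto simp: bounded_lipschitz_fields_def \<sigma>_def)
    define G where "G k = (\<chi> c. \<Sum>l<k. z (l, c))" for k
    define Y where "Y k = X (h * real k)" for k
    define \<eta> where "\<eta> k = Y (Suc k) - Y k - \<sigma> (Y k) (G (Suc k) - G k)" for k
    define v where "v k = A0 * h + (\<Sum>i\<in>UNIV. C i * h powr \<theta> i) + A * (\<Sum>c\<in>UNIV. \<bar>y (k, c) - z (k, c)\<bar>)" for k
    have \<sigma>_diff: "\<sigma> p (u - w) = \<sigma> p u - \<sigma> p w" for p u w
      by (simp add: \<sigma>_def left_diff_distrib scaleR_left_diff_distrib sum_subtractf)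
    interpret E: discrete_equation \<sigma> Y \<eta> G v A a \<gamma> m
    proof
      show "\<sigma> p (u - w) = \<sigma> p u - \<sigma> p w" for p u w by (rule \<sigma>_diff)
      show "norm (\<sigma> p u) \<le> A * norm u" for p u by (rule bounded)
      show "norm (\<sigma> p u - \<sigma> q u) \<le> A * norm (p - q) * norm u" for p q u by (rule lipschitz)
      show "Y (Suc k) = Y k + \<sigma> (Y k) (G (Suc k) - G k) + \<eta> k" for k by (simp add: \<eta>_def)
      show "norm (G j - G i) \<le> a * ((real j - real i) / real m) powr \<gamma>" if ij: "i \<le> j" "j \<le> m" for i j
      proof -
        have "(\<Sum>k<j. f k) - (\<Sum>k<i. f k) = (\<Sum>k=i..<j. f k)" for f :: "nat \<Rightarrow> real"
          using ij sum_diff_nat_ivl[of 0 i j f] by (simp add: lessThan_atLeast0)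
        then have "G j - G i = (\<chi> c. \<Sum>k=i..<j. z (k, c))" by (simp add: G_def vec_eq_iff)
        moreover have "norm (\<chi> c. \<Sum>k=i..<j. z (k, c)) \<le> a * ((real j - real i) / real m) powr \<gamma>"
          using z ij unfolding holder_increments_def by blast
        ultimately show ?thesis by simp
      qed
      show "norm (\<eta> k) \<le> v k" if k: "k < m" for k
      proof -
        define \<xi> where "\<xi> = b (h * real (Suc k)) - b (h * real k)"
        have \<xi>: "\<xi> $ c = y (k, c)" for c using k by (simp add: \<xi>_def y_def h_def)
        have "h * real (Suc k) \<le> h * real m" using k h by (intro mult_left_mono) auto
        then have "norm (X (h * real (Suc k)) - X (h * real k)
              - (\<Sum>i\<in>UNIV. (b (h * real (Suc k)) $ i - b (h * real k) $ i) *\<^sub>R V i (X (h * real k))))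
            \<le> A0 * (h * real (Suc k) - h * real k)
              + (\<Sum>i\<in>UNIV. C i * (h * real (Suc k) - h * real k) powr \<theta> i)"
          unfolding hm using h by (intro step) auto
        moreover have "h * real (Suc k) - h * real k = h" by (simp add: algebra_simps)
        ultimately have 1: "norm (Y (Suc k) - Y k - \<sigma> (Y k) \<xi>) \<le> A0 * h + (\<Sum>i\<in>UNIV. C i * h powr \<theta> i)"
          by (simp add: Y_def \<sigma>_def \<xi>_def)
        have "norm (\<xi> - (G (Suc k) - G k)) \<le> (\<Sum>c\<in>UNIV. \<bar>(\<xi> - (G (Suc k) - G k)) $ c\<bar>)"
          by (rule norm_le_l1_cart)
        also have "\<dots> = (\<Sum>c\<in>UNIV. \<bar>y (k, c) - z (k, c)\<bar>)" by (simp add: \<xi> G_def)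
        finally have "A * norm (\<xi> - (G (Suc k) - G k)) \<le> A * (\<Sum>c\<in>UNIV. \<bar>y (k, c) - z (k, c)\<bar>)"
          using A by simp
        then have 2: "norm (\<sigma> (Y k) (\<xi> - (G (Suc k) - G k))) \<le> A * (\<Sum>c\<in>UNIV. \<bar>y (k, c) - z (k, c)\<bar>)"
          by (rule order_trans[OF bounded])
        have "\<eta> k = (Y (Suc k) - Y k - \<sigma> (Y k) \<xi>) + \<sigma> (Y k) (\<xi> - (G (Suc k) - G k))"
          unfolding \<eta>_def \<sigma>_diff[of _ \<xi>] by simp
        then show ?thesis unfolding v_def using norm_triangle_mono[OF 1 2] by simp
      qed
      show "v k \<ge> 0" for k
        unfolding v_def using A0 h A C by (intro add_nonneg_nonneg mult_nonneg_nonneg sum_nonneg) auto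
    qed (use A a \<gamma> m in auto)
    have "(\<Sum>k<m. v k) = A0 * T + ?E + A * (\<Sum>p\<in>{..<m} \<times> UNIV. \<bar>y p - z p\<bar>)"
    proof -
      have "(\<Sum>k<m. v k) = real m * (A0 * h) + real m * (\<Sum>i\<in>UNIV. C i * h powr \<theta> i)
          + A * (\<Sum>k<m. \<Sum>c\<in>UNIV. \<bar>y (k, c) - z (k, c)\<bar>)"
        by (simp add: v_def sum.distrib sum_distrib_left distrib_left)
      also have "real m * (A0 * h) = A0 * T" using m by (simp add: h_def)
      also have "real m * (\<Sum>i\<in>UNIV. C i * h powr \<theta> i) = ?E"
        by (simp add: h_def sum_distrib_left mult_ac)
      also have "(\<Sum>k<m. \<Sum>c\<in>UNIV. \<bar>y (k, c) - z (k, c)\<bar>) = (\<Sum>p\<in>{..<m} \<times> UNIV. \<bar>y p - z p\<bar>)"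
        by (simp only: sum.cartesian_product')
      finally show ?thesis .
    qed
    moreover have "E.global_const = ?G"
      using A by (simp add: E.global_const_def E.ctrl_threshold_def E.local_const_def)
    moreover have "norm (Y j - Y 0) \<le> E.local_const * a + E.global_const * (a + (\<Sum>k<m. v k))"
      by (rule E.growth_bound[OF j])
    ultimately have "?N \<le> ?C1 * a + ?G * (a + (A0 * T + ?E + A * (\<Sum>p\<in>{..<m} \<times> UNIV. \<bar>y p - z p\<bar>)))"
      by (simp add: Y_def E.local_const_def)
    then have "?N - ?C1 * a - ?G * (a + A0 * T + ?E) \<le> (\<Sum>p\<in>{..<m} \<times> UNIV. \<bar>y p - z p\<bar>) * (?G * A)"
      by (simp add: algebra_simps)
    then show "(?N - ?C1 * a - ?G * (a + A0 * T + ?E)) / (?G * A) \<le> (\<Sum>p\<in>{..<m} \<times> UNIV. \<bar>y p - z p\<bar>)"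
      by (subst pos_divide_le_eq[OF GA])
  qed
  then have "?N - ?C1 * a - ?G * (a + A0 * T + ?E) \<le> holder_distance a \<gamma> m y * (?G * A)"
    by (subst (asm) pos_divide_le_eq[OF GA])
  then show ?thesis by (simp add: h_def algebra_simps)
qed

text \<open>By continuity of every path, the supremum may be taken over a countable dense set of
  times.\<close>

lemma running_sup_measurable:
  fixes X :: "real \<Rightarrow> 'w \<Rightarrow> 'a::euclidean_space"
  assumes X: "\<And>t. t \<ge> 0 \<Longrightarrow> X t \<in> borel_measurable P"
    and cont: "\<And>w. w \<in> space P \<Longrightarrow> continuous_on {0..} (\<lambda>t. X t w)" and T: "T > 0"
  shows "(\<lambda>w. SUP t\<in>{0..T}. norm (X t w)) \<in> borel_measurable P"
proof -
  obtain D :: "real set" where D: "countable D" "D \<subseteq> {0..T}" "{0..T} \<subseteq> closure D"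
    using separable[of "{0..T}"] by blast
  have cl: "closure D = {0..T}" using D closure_minimal[of D "{0..T}"] by auto
  have cont_T: "continuous_on {0..T} (\<lambda>t. X t w)" if "w \<in> space P" for w
    by (rule continuous_on_subset[OF cont[OF that]]) auto
  have bdd: "bdd_above ((\<lambda>t. norm (X t w)) ` {0..T})" if "w \<in> space P" for w
    by (intro compact_imp_bounded[THEN bounded_imp_bdd_above] compact_continuous_image
        continuous_on_norm cont_T that compact_Icc)
  have bdd_D: "bdd_above ((\<lambda>t. norm (X t w)) ` D)" if "w \<in> space P" for w
    using bdd[OF that] by (rule bdd_above_mono) (use D in auto)
  have "D \<noteq> {}" using D T by auto
  have "(SUP t\<in>{0..T}. norm (X t w)) = (SUP t\<in>D. norm (X t w))" if w: "w \<in> space P" for w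
  proof (rule antisym)
    show "(SUP t\<in>{0..T}. norm (X t w)) \<le> (SUP t\<in>D. norm (X t w))"
    proof (rule cSUP_least)
      fix t assume "t \<in> {0..T}"
      then have "t \<in> closure D" by (simp add: cl)
      moreover have "continuous_on (closure D) (\<lambda>t. X t w)" unfolding cl by (rule cont_T[OF w])
      moreover have "\<forall>t\<in>D. norm (X t w) \<le> (SUP t\<in>D. norm (X t w))"
        by (auto intro: cSUP_upper bdd_D[OF w])
      ultimately show "norm (X t w) \<le> (SUP t\<in>D. norm (X t w))"
        by (intro continuous_on_closure_norm_le[where s = D])
    qed (use T in auto)
    show "(SUP t\<in>D. norm (X t w)) \<le> (SUP t\<in>{0..T}. norm (X t w))"
      using D \<open>D \<noteq> {}\<close> bdd[OF w] by (intro cSUP_subset_mono) auto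
  qed
  moreover have "(\<lambda>w. SUP t\<in>D. norm (X t w)) \<in> borel_measurable P"
    using D bdd_D X by (intro borel_measurable_cSUP measurable_compose[OF _ borel_measurable_norm]) auto
  ultimately show ?thesis by (simp cong: measurable_cong)
qed

text \<open>The supremum is attained, which reduces its deviation to the increment at one time. That
  time depends on the path but not on the grid, as the limit over grids requires.\<close>

lemma running_sup_deviation:
  fixes f :: "real \<Rightarrow> 'a::real_normed_vector"
  assumes "continuous_on {0..T} f" "T > 0"
  obtains t where "t \<in> {0..T}" "\<bar>(SUP t\<in>{0..T}. norm (f t)) - norm (f 0)\<bar> \<le> norm (f t - f 0)"
proof -
  have cont: "continuous_on {0..T} (\<lambda>t. norm (f t))" using assms by (intro continuous_intros)
  obtain t where t: "t \<in> {0..T}" "\<And>s. s \<in> {0..T} \<Longrightarrow> norm (f s) \<le> norm (f t)"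
    using continuous_attains_sup[OF compact_Icc _ cont] assms(2) by fastforce
  have "(SUP t\<in>{0..T}. norm (f t)) = norm (f t)" using t by (intro cSup_eq_maximum) auto
  moreover have "norm (f 0) \<le> norm (f t)" using t(2)[of 0] assms(2) by simp
  moreover have "norm (f t) - norm (f 0) \<le> norm (f t - f 0)" by (rule norm_triangle_ineq2)
  ultimately show ?thesis using that[OF t(1)] by simp
qed

text \<open>Absorbs powers of the time into an exponential, for small and for large times at
  once.\<close>

lemma powr_le_exp: "t powr p \<le> exp t" if "0 < t" "0 \<le> p" "p \<le> 1" for t p :: real
proof -
  have "t powr p \<le> (1 + t) powr p" using that by (intro powr_mono2) auto
  also have "\<dots> \<le> (1 + t) powr 1" using that by (intro powr_mono) auto
  also have "\<dots> \<le> exp t" using that exp_ge_add_one_self[of t] by simp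
  finally show ?thesis .
qed

section \<open>From the grid to continuous time\<close>

context fractional_brownian
begin

text \<open>The set of Hoelder increments has probability at least 1/2, so dividing by it costs a
  factor 2. Partial sums of the increments telescope, which identifies this event with
  \<open>grid_holder\<close>.\<close>

lemma holder_distance_moment:
  assumes \<kappa>: "\<kappa> > 0" and T: "T > 0" and m: "m > 0"
    and prob_ge: "1 / 2 \<le> prob {w\<in>space P. grid_holder (\<kappa> * T powr H) \<gamma> T m w}"
  shows "(\<integral>\<^sup>+w. ennreal (exp ((holder_distance (\<kappa> * T powr H) \<gamma> m
      (\<lambda>p\<in>{..<m} \<times> UNIV. grid_increment T m p w))\<^sup>2 / (4 * (real CARD('d) * T powr H)\<^sup>2))) \<partial>P) \<le> 2"
    (is "?I \<le> 2")
proof -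
  let ?J = "{..<m} \<times> (UNIV :: 'd set)"
  let ?a = "\<kappa> * T powr H"
  have a: "?a \<ge> 0" using \<kappa> by simp
  have "?I * emeasure P {w\<in>space P. (\<lambda>p\<in>?J. grid_increment T m p w) \<in> holder_increments ?a \<gamma> m} \<le> 1"
  proof (rule distance_exponential_moment)
    show "real CARD('d) * T powr H > 0" using T by simp
    show "expectation (\<lambda>w. (\<Sum>p\<in>?J. \<epsilon> p * grid_increment T m p w)\<^sup>2) \<le> (real CARD('d) * T powr H)\<^sup>2"
      if "\<And>p. \<bar>\<epsilon> p\<bar> \<le> 1" for \<epsilon> by (rule grid_increment_covariance[OF T m that])
    show "holder_distance ?a \<gamma> m y \<le> (\<Sum>p\<in>?J. \<bar>y p - z p\<bar>)" if "z \<in> holder_increments ?a \<gamma> m" for y z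
      by (rule holder_distance_le[OF that])
  qed (use T a in \<open>auto intro: grid_increment_in_span_B holder_increments_sets holder_distance_measurable holder_distance_nonneg\<close>)
  also have "{w\<in>space P. (\<lambda>p\<in>?J. grid_increment T m p w) \<in> holder_increments ?a \<gamma> m}
      = {w\<in>space P. grid_holder ?a \<gamma> T m w}" (is "_ = ?S")
  proof -
    have "(\<chi> c. \<Sum>k=i..<j. (\<lambda>p\<in>?J. grid_increment T m p w) (k, c))
        = B (T / real m * real j) w - B (T / real m * real i) w" if ij: "i \<le> j" "j \<le> m" for i j w
    proof -
      have "(\<Sum>k=i..<j. (\<lambda>p\<in>?J. grid_increment T m p w) (k, c))
          = (\<Sum>k=i..<j. B (T / real m * real (Suc k)) w $ c - B (T / real m * real k) w $ c)" for c
        using ij by (intro sum.cong) (auto simp: grid_increment_def)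
      also have "\<dots> c = (B (T / real m * real j) w - B (T / real m * real i) w) $ c" for c
        using ij by (subst sum_Suc_diff') auto
      finally show ?thesis by (simp add: vec_eq_iff)
    qed
    then show ?thesis unfolding holder_increments_def grid_holder_def
      by (simp only: mem_Collect_eq restrict_extensional) (metis (no_types, lifting))
  qed
  finally have "?I * emeasure P ?S \<le> 1" .
  moreover have "ennreal (1 / 2) \<le> emeasure P ?S"
    using ennreal_leI[OF prob_ge] unfolding emeasure_eq_measure .
  ultimately have "?I * ennreal (1 / 2) \<le> 1" by (meson mult_left_mono order_trans zero_le)
  then have "2 * (?I * ennreal (1 / 2)) \<le> 2 * 1" by (rule mult_left_mono) simp
  moreover have "2 * (?I * ennreal (1 / 2)) = ?I * (2 * ennreal (1 / 2))" by (simp only: mult.left_commute)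
  moreover have "2 * ennreal (1 / 2) = 1" using ennreal_mult[of 2 "1 / 2"] by simp
  ultimately show ?thesis by simp
qed

text \<open>The Young error vanishes along each path, but its constants depend on the path, so the
  limit is not uniform. For this reason the bound is first proved pathwise for the
  \<open>liminf\<close> and only then integrated.\<close>

lemma running_sup_exponential_moment:
  fixes X :: "real \<Rightarrow> 'w \<Rightarrow> real^'d" and V :: "'d \<Rightarrow> real^'d \<Rightarrow> real^'d"
  assumes sol: "young_sde_solution P V0 V B x X"
    and V0: "continuous_on UNIV V0" "\<And>p. norm (V0 p) \<le> A0"
    and A: "A \<ge> 1"
    and fields: "bounded_lipschitz_fields A V"
  obtains D where "D > 0" "\<And>T. T > 0 \<Longrightarrow>
    (\<integral>\<^sup>+w. ennreal (exp (((SUP t\<in>{0..T}. norm (X t w)) - norm x)\<^sup>2 / (D * exp (3 * T) * T powr H)\<^sup>2)) \<partial>P)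
      \<le> ennreal (2 * exp 2)"
proof -
  define \<gamma> where "\<gamma> = (1 / 2 + H) / 2"
  have \<gamma>: "1/2 < \<gamma>" "\<gamma> < H" "\<gamma> \<le> 1" using H by (auto simp: \<gamma>_def)
  obtain \<kappa> where \<kappa>: "\<kappa> > 0" and grid: "\<And>T m. T > 0 \<Longrightarrow> m > 0 \<Longrightarrow> 1 / 2 \<le>
    prob {w\<in>space P. grid_holder (\<kappa> * T powr H) \<gamma> T m w}"
    using grid_holder_probability[of \<gamma>] \<gamma> by auto
  have A0: "A0 \<ge> 0" using V0(2)[of x] norm_ge_zero order_trans by blast
  define d where "d = real CARD('d)"
  have d: "d > 0" by (simp add: d_def)
  define Q where "Q = A * (A + 2) * sewing_const (2 * \<gamma>) * \<kappa>"
  define D1 where "D1 = 1 + (2 * A + 2) * (1 + Q\<^sup>2)"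
  have D1: "D1 \<ge> 1" using A by (simp add: D1_def)
  \<comment> \<open>The summands dominate, in this order, the local term, the term with
    \<open>a\<close> and the drift, and three times the coefficient of the distance in units of its
    Gaussian scale \<open>\<sigma>\<close>.\<close>
  define D where "D = (A + 2) * \<kappa> + D1 * (\<kappa> + A0) + 3 * (D1 * A * d)"
  have D: "D > 0"
    unfolding D_def using A A0 \<kappa> D1 d by (intro add_pos_pos add_pos_nonneg mult_pos_pos mult_nonneg_nonneg) auto
  show ?thesis
  proof (rule that[OF D])
    fix T :: real assume T: "T > 0"
    define h where "h = T powr H"
    have h: "h > 0" using T by (simp add: h_def)
    define \<sigma> where "\<sigma> = d * h"
    have \<sigma>: "\<sigma> > 0" using d h by (simp add: \<sigma>_def)
    define a where "a = \<kappa> * h"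
    have a: "a > 0" using \<kappa> h by (simp add: a_def)
    define G where "G = 1 + (2 * A + 2) * (1 + (A * (A + 2) * sewing_const (2 * \<gamma>) * a)\<^sup>2)"
    define q where "q = (A + 2) * a + G * (a + A0 * T)"
    define \<tau> where "\<tau> = D * exp (3 * T) * h"
    have \<tau>: "\<tau> > 0" using D h by (simp add: \<tau>_def)
    have G1: "G \<ge> 1" using A by (simp add: G_def)
    \<comment> \<open>The drift must be of order \<open>T powr H\<close> also for small
      \<open>T\<close>; the remaining factor \<open>T powr (1 - H)\<close> is at most
      \<open>exp T\<close>.\<close>
    have T_le: "T \<le> h * exp T"
    proof -
      have "T = h * T powr (1 - H)" using T by (simp add: h_def powr_add[symmetric])
      also have "\<dots> \<le> h * exp T" using h H T by (intro mult_left_mono powr_le_exp) auto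
      finally show ?thesis .
    qed
    \<comment> \<open>\<open>G\<close> is quadratic in \<open>a\<close>, which is proportional to
      \<open>T powr H\<close>; two factors \<open>exp T\<close> absorb the square.\<close>
    have G_le: "G \<le> D1 * exp (2 * T)"
    proof -
      have "h\<^sup>2 \<le> (exp T)\<^sup>2" using T H h by (intro power_mono) (auto simp: h_def intro: powr_le_exp)
      then have "(Q * h)\<^sup>2 \<le> Q\<^sup>2 * exp (2 * T)"
        by (simp add: power_mult_distrib mult_left_mono exp_double)
      moreover have e1: "1 \<le> exp (2 * T)" using T by simp
      ultimately have "1 + (Q * h)\<^sup>2 \<le> exp (2 * T) + Q\<^sup>2 * exp (2 * T)" by linarith
      also have "\<dots> = (1 + Q\<^sup>2) * exp (2 * T)" by (simp only: distrib_right mult_1_left)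
      finally have "1 + (Q * h)\<^sup>2 \<le> (1 + Q\<^sup>2) * exp (2 * T)" .
      then have "(2 * A + 2) * (1 + (Q * h)\<^sup>2) \<le> (2 * A + 2) * ((1 + Q\<^sup>2) * exp (2 * T))"
        using A by (intro mult_left_mono) auto
      then have "1 + (2 * A + 2) * (1 + (Q * h)\<^sup>2) \<le> D1 * exp (2 * T)"
        unfolding D1_def distrib_right[of 1 _ "exp (2 * T)"] mult_1_left mult.assoc[of "2 * A + 2"]
        using e1 by linarith
      then show ?thesis by (simp add: G_def Q_def a_def mult.assoc)
    qed
    have e3: "exp (3 * T) = exp (2 * T) * exp T" by (simp add: exp_add[symmetric])
    have q_le: "q \<le> \<tau>"
    proof -
      have "a + A0 * T \<le> \<kappa> * h * exp T + A0 * (h * exp T)"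
        unfolding a_def using T T_le A0 \<kappa> h by (intro add_mono mult_left_mono) auto
      also have "\<dots> = (\<kappa> + A0) * h * exp T" by (simp add: algebra_simps)
      finally have "G * (a + A0 * T) \<le> (D1 * exp (2 * T)) * ((\<kappa> + A0) * h * exp T)"
        using G_le G1 a A0 T D1 by (intro mult_mono) auto
      moreover have "(A + 2) * a \<le> (A + 2) * \<kappa> * h * exp (3 * T)"
        unfolding a_def using A \<kappa> h T by simp
      moreover have "0 \<le> 3 * (D1 * A * d) * exp (3 * T) * h" using D1 A d h by simp
      ultimately have "q \<le> (A + 2) * \<kappa> * h * exp (3 * T) + (D1 * exp (2 * T)) * ((\<kappa> + A0) * h * exp T)
          + 3 * (D1 * A * d) * exp (3 * T) * h"
        unfolding q_def by linarith
      also have "\<dots> = \<tau>" unfolding \<tau>_def D_def e3 by (simp add: algebra_simps)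
      finally show ?thesis .
    qed
    have q0: "q \<ge> 0" unfolding q_def using A a G1 A0 T by simp
    \<comment> \<open>The square of 3 exceeds 8, the product of the 2 from splitting a square and
      the 4 in the exponent of the distance.\<close>
    have g_le: "3 * (G * A * \<sigma>) \<le> \<tau>"
    proof -
      have "G * (A * \<sigma>) \<le> (D1 * exp (3 * T)) * (A * \<sigma>)"
      proof (rule mult_right_mono)
        have "D1 * exp (2 * T) \<le> D1 * exp (3 * T)" using T D1 by (intro mult_left_mono) auto
        then show "G \<le> D1 * exp (3 * T)" using G_le by linarith
      qed (use A \<sigma> in auto)
      then have "3 * (G * A * \<sigma>) \<le> 3 * (D1 * A * d) * (exp (3 * T) * h)"
        by (simp add: \<sigma>_def algebra_simps)
      also have "\<dots> \<le> D * (exp (3 * T) * h)"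
        unfolding D_def using A \<kappa> D1 A0 h by (intro mult_right_mono) auto
      finally show ?thesis by (simp add: \<tau>_def mult.assoc)
    qed
    define \<Phi> where "\<Phi> m w = holder_distance a \<gamma> m (\<lambda>p\<in>{..<m} \<times> UNIV. grid_increment T m p w)" for m w
    have \<Phi>0: "\<Phi> m w \<ge> 0" for m w unfolding \<Phi>_def using a by (intro holder_distance_nonneg) simp
    \<comment> \<open>The index \<open>Suc m\<close> avoids the empty grid, and \<open>exp 2\<close>
      is the contribution of \<open>q \<le> \<tau>\<close> after squaring.\<close>
    define \<Psi> where "\<Psi> m w = ennreal (exp 2) * ennreal (exp ((\<Phi> (Suc m) w)\<^sup>2 / (4 * \<sigma>\<^sup>2)))" for m w
    have \<Phi>_meas: "\<Phi> m \<in> borel_measurable P" for m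
    proof -
      have "(\<lambda>w. \<lambda>p\<in>{..<m} \<times> UNIV. grid_increment T m p w) \<in> P \<rightarrow>\<^sub>M PiM ({..<m} \<times> UNIV) (\<lambda>_. borel)"
        by (intro measurable_restrict meas grid_increment_in_span_B T)
      from measurable_compose[OF this holder_distance_measurable[of a \<gamma> m]] show ?thesis
        using a by (simp add: \<Phi>_def[abs_def])
    qed
    have \<Psi>_meas: "\<Psi> m \<in> borel_measurable P" for m
      unfolding \<Psi>_def[abs_def] using \<Phi>_meas by measurable
    have \<Psi>_int: "(\<integral>\<^sup>+w. \<Psi> m w \<partial>P) \<le> ennreal (2 * exp 2)" for m
    proof -
      have "(\<integral>\<^sup>+w. ennreal (exp ((\<Phi> (Suc m) w)\<^sup>2 / (4 * \<sigma>\<^sup>2))) \<partial>P) \<le> 2"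
        unfolding \<Phi>_def a_def \<sigma>_def h_def d_def
        using holder_distance_moment[OF \<kappa> T _ grid[OF T], of "Suc m"] by simp
      then have "ennreal (exp 2) * (\<integral>\<^sup>+w. ennreal (exp ((\<Phi> (Suc m) w)\<^sup>2 / (4 * \<sigma>\<^sup>2))) \<partial>P) \<le> ennreal (exp 2) * 2"
        by (rule mult_left_mono) simp
      also have "ennreal (exp 2) * 2 = ennreal (2 * exp 2)"
        using ennreal_mult[of "exp 2" 2] by (simp add: mult.commute)
      finally show ?thesis unfolding \<Psi>_def using \<Phi>_meas by (subst nn_integral_cmult) auto
    qed
    have limit: "ennreal (exp ((norm (X t w - x))\<^sup>2 / \<tau>\<^sup>2)) \<le> liminf (\<lambda>m. \<Psi> m w)"
      if w: "w \<in> space P" and t: "t \<in> {0..T}"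
        and path: "young_path_solution V0 V (\<lambda>t. B t w) x (\<lambda>t. X t w)" for w t
    proof -
      have cont: "continuous_on {0..} (\<lambda>t. X t w)" using sol w by (simp add: young_sde_solution_def)
      have "X 0 w = x" by (rule young_equation_initial[OF path])
      obtain C \<theta> :: "'d \<Rightarrow> real" where C: "\<And>i. \<theta> i > 1" "\<And>i. C i \<ge> 0"
        and step: "\<And>s t. 0 \<le> s \<Longrightarrow> s \<le> t \<Longrightarrow> t \<le> T \<Longrightarrow>
          norm (X t w - X s w - (\<Sum>i\<in>UNIV. (B t w $ i - B s w $ i) *\<^sub>R V i (X s w)))
            \<le> A0 * (t - s) + (\<Sum>i\<in>UNIV. C i * (t - s) powr \<theta> i)"
        by (rule young_equation_step[OF path cont V0 T]) (rule that)
      define n where "n m = real (Suc m)" for m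
      have n: "n m > 0" for m by (simp add: n_def)
      \<comment> \<open>The time \<open>s m\<close> formed from this index is the last grid point
        not after \<open>t\<close>.\<close>
      define j where "j m = nat \<lfloor>t * n m / T\<rfloor>" for m
      have j_le: "real (j m) \<le> t * n m / T" "t * n m / T < real (j m) + 1" for m
        using t T n[of m] by (auto simp: j_def)
      have j: "j m \<le> Suc m" for m
      proof -
        have "t * n m / T \<le> n m" using t T n[of m] by (simp add: field_simps mult_right_mono)
        then have "real (j m) \<le> real (Suc m)" using j_le(1)[of m] by (simp add: n_def)
        then show ?thesis by (simp only: of_nat_le_iff)
      qed
      define s where "s m = T / n m * real (j m)" for m
      have s_close: "\<bar>s m - t\<bar> \<le> T / n m" for m
      proof -
        have "s m \<le> t" "t \<le> s m + T / n m"
          using j_le[of m] T n[of m] by (auto simp: s_def field_simps)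
        then show ?thesis by (simp add: abs_le_iff)
      qed
      have T_n: "(\<lambda>m. T / n m) \<longlonglongrightarrow> 0" unfolding n_def by (intro LIMSEQ_Suc lim_const_over_n)
      have "(\<lambda>m. s m - t) \<longlonglongrightarrow> 0" by (rule Lim_null_comparison[OF _ T_n]) (use s_close in auto)
      then have s_lim: "s \<longlonglongrightarrow> t" by (simp add: LIM_zero_iff)
      have s0: "s m \<ge> 0" for m using T n[of m] by (simp add: s_def)
      have "(\<lambda>m. X (s m) w) \<longlonglongrightarrow> X t w" using continuous_on_tendsto_compose[OF cont s_lim] t s0 by simp
      then have L_lim: "(\<lambda>m. norm (X (s m) w - x)) \<longlonglongrightarrow> norm (X t w - x)" by (intro tendsto_intros)
      \<comment> \<open>The Young error of all steps together; each summand is a constant times a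
        positive power of the mesh, because \<open>\<theta> i > 1\<close>.\<close>
      define E where "E m = (\<Sum>i\<in>UNIV. C i * (n m * (T / n m) powr \<theta> i))" for m
      have "E \<longlonglongrightarrow> 0"
      proof -
        have "(\<lambda>m. C i * (n m * (T / n m) powr \<theta> i)) \<longlonglongrightarrow> 0" for i
        proof -
          have "n m * (T / n m) powr \<theta> i = T * (T / n m) powr (\<theta> i - 1)" for m
            using T n[of m] by (simp add: powr_diff)
          moreover have "(\<lambda>m. C i * (T * (T / n m) powr (\<theta> i - 1))) \<longlonglongrightarrow> C i * (T * 0)"
          proof (intro tendsto_mult tendsto_const)
            show "(\<lambda>m. (T / n m) powr (\<theta> i - 1)) \<longlonglongrightarrow> 0"
              using tendsto_powr'[OF T_n tendsto_const[of "\<theta> i - 1"]] C(1)[of i] T n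
              by (simp add: less_imp_le)
          qed
          ultimately show ?thesis by simp
        qed
        then have "E \<longlonglongrightarrow> (\<Sum>i\<in>(UNIV::'d set). 0)" unfolding E_def[abs_def] by (intro tendsto_sum)
        then show ?thesis by simp
      qed
      \<comment> \<open>Truncation at 0 lets the upper bound survive squaring; in the limit it
        changes nothing, since the norm is non-negative.\<close>
      define L where "L m = max 0 (norm (X (s m) w - x) - G * E m)" for m
      have "L \<longlonglongrightarrow> max 0 (norm (X t w - x) - G * 0)"
        unfolding L_def[abs_def] by (intro tendsto_max tendsto_diff tendsto_mult tendsto_const L_lim \<open>E \<longlonglongrightarrow> 0\<close>)
      then have "L \<longlonglongrightarrow> norm (X t w - x)" by simp
      then have lim: "(\<lambda>m. ennreal (exp ((L m)\<^sup>2 / \<tau>\<^sup>2))) \<longlonglongrightarrow> ennreal (exp ((norm (X t w - x))\<^sup>2 / \<tau>\<^sup>2))"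
        using \<tau> by (intro tendsto_ennrealI tendsto_intros) auto
      have "ennreal (exp ((L m)\<^sup>2 / \<tau>\<^sup>2)) \<le> \<Psi> m w" for m
      proof -
        define \<phi> where "\<phi> = \<Phi> (Suc m) w"
        have "norm (X (s m) w - x) \<le> (A + 2) * a + G * (a + A0 * T + E m + A * \<phi>)"
        proof -
          have "(\<lambda>p\<in>{..<Suc m} \<times> UNIV. B (T / real (Suc m) * real (Suc (fst p))) w $ snd p
              - B (T / real (Suc m) * real (fst p)) w $ snd p)
              = (\<lambda>p\<in>{..<Suc m} \<times> UNIV. grid_increment T (Suc m) p w)"
            by (auto simp: grid_increment_def fun_eq_iff)
          then show ?thesis
            using path_growth[OF A A0 T zero_less_Suc a \<gamma>(1,3) fields C(2) step j[of m]]
            unfolding s_def E_def n_def G_def \<phi>_def \<Phi>_def \<open>X 0 w = x\<close> by simp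
        qed
        then have "norm (X (s m) w - x) - G * E m \<le> q + G * A * \<phi>"
          by (simp add: q_def algebra_simps)
        moreover have "\<phi> \<ge> 0" unfolding \<phi>_def by (rule \<Phi>0)
        then have "0 \<le> q + G * A * \<phi>" using q0 G1 A by simp
        ultimately have "L m \<le> q + G * A * \<phi>" by (simp add: L_def)
        then have "(L m)\<^sup>2 \<le> (q + G * A * \<phi>)\<^sup>2" by (intro power_mono) (auto simp: L_def)
        also have "\<dots> \<le> 2 * q\<^sup>2 + 2 * (G * A * \<phi>)\<^sup>2"
          using zero_le_power2[of "q - G * A * \<phi>"] by (simp add: power2_sum power2_diff)
        also have "\<dots> \<le> 2 * \<tau>\<^sup>2 + \<tau>\<^sup>2 * (\<phi>\<^sup>2 / (4 * \<sigma>\<^sup>2))"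
        proof (intro add_mono mult_left_mono power_mono q_le q0)
          have "(3 * (G * A * \<sigma>))\<^sup>2 \<le> \<tau>\<^sup>2" using g_le G1 A \<sigma> by (intro power_mono) auto
          then have "9 * ((G * A)\<^sup>2 * \<sigma>\<^sup>2) \<le> \<tau>\<^sup>2" by (simp add: power_mult_distrib)
          moreover have "0 \<le> (G * A)\<^sup>2 * \<sigma>\<^sup>2" by simp
          ultimately have "8 * ((G * A)\<^sup>2 * \<sigma>\<^sup>2) \<le> \<tau>\<^sup>2" by linarith
          then have "8 * ((G * A)\<^sup>2 * \<sigma>\<^sup>2) * (\<phi>\<^sup>2 / (4 * \<sigma>\<^sup>2)) \<le> \<tau>\<^sup>2 * (\<phi>\<^sup>2 / (4 * \<sigma>\<^sup>2))"
            by (rule mult_right_mono) simp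
          moreover have "8 * ((G * A)\<^sup>2 * \<sigma>\<^sup>2) * (\<phi>\<^sup>2 / (4 * \<sigma>\<^sup>2)) = 2 * (G * A * \<phi>)\<^sup>2"
            using \<sigma> by (simp add: power_mult_distrib)
          ultimately show "2 * (G * A * \<phi>)\<^sup>2 \<le> \<tau>\<^sup>2 * (\<phi>\<^sup>2 / (4 * \<sigma>\<^sup>2))" by simp
        qed simp
        also have "\<dots> = \<tau>\<^sup>2 * (2 + \<phi>\<^sup>2 / (4 * \<sigma>\<^sup>2))" by (simp add: distrib_left)
        finally have "(L m)\<^sup>2 / \<tau>\<^sup>2 \<le> 2 + \<phi>\<^sup>2 / (4 * \<sigma>\<^sup>2)"
          using \<tau> by (subst pos_divide_le_eq) (auto simp: mult.commute)
        then have "exp ((L m)\<^sup>2 / \<tau>\<^sup>2) \<le> exp 2 * exp (\<phi>\<^sup>2 / (4 * \<sigma>\<^sup>2))"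
          by (simp add: exp_add[symmetric])
        then show ?thesis unfolding \<Psi>_def \<phi>_def by (simp add: ennreal_leI ennreal_mult[symmetric])
      qed
      then have "liminf (\<lambda>m. ennreal (exp ((L m)\<^sup>2 / \<tau>\<^sup>2))) \<le> liminf (\<lambda>m. \<Psi> m w)"
        by (intro Liminf_mono always_eventually allI)
      then show ?thesis using lim_imp_Liminf[OF _ lim] by simp
    qed
    have "AE w in P. ennreal (exp (((SUP t\<in>{0..T}. norm (X t w)) - norm x)\<^sup>2 / \<tau>\<^sup>2)) \<le> liminf (\<lambda>m. \<Psi> m w)"
    proof -
      have "AE w in P. young_path_solution V0 V (\<lambda>t. B t w) x (\<lambda>t. X t w)"
        using sol by (simp add: young_sde_solution_def young_path_solution_def)
      then show ?thesis using AE_space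
      proof eventually_elim
        case (elim w)
        have "continuous_on {0..} (\<lambda>t. X t w)"
          using sol elim(2) by (simp add: young_sde_solution_def)
        then have cont: "continuous_on {0..T} (\<lambda>t. X t w)" by (rule continuous_on_subset) auto
        have "X 0 w = x" by (rule young_equation_initial[OF elim(1)])
        obtain t where t: "t \<in> {0..T}" "\<bar>(SUP t\<in>{0..T}. norm (X t w)) - norm (X 0 w)\<bar> \<le> norm (X t w - X 0 w)"
          by (rule running_sup_deviation[OF cont T])
        then have "\<bar>(SUP t\<in>{0..T}. norm (X t w)) - norm x\<bar> \<le> \<bar>norm (X t w - x)\<bar>"
          unfolding \<open>X 0 w = x\<close> by simp
        then have "((SUP t\<in>{0..T}. norm (X t w)) - norm x)\<^sup>2 \<le> (norm (X t w - x))\<^sup>2"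
          by (simp only: abs_le_square_iff)
        then have "exp (((SUP t\<in>{0..T}. norm (X t w)) - norm x)\<^sup>2 / \<tau>\<^sup>2) \<le> exp ((norm (X t w - x))\<^sup>2 / \<tau>\<^sup>2)"
          by (simp add: divide_right_mono)
        from order_trans[OF ennreal_leI[OF this] limit[OF elim(2) t(1) elim(1)]] show ?case .
      qed
    qed
    then have "(\<integral>\<^sup>+w. ennreal (exp (((SUP t\<in>{0..T}. norm (X t w)) - norm x)\<^sup>2 / \<tau>\<^sup>2)) \<partial>P)
        \<le> (\<integral>\<^sup>+w. liminf (\<lambda>m. \<Psi> m w) \<partial>P)"
      by (rule nn_integral_mono_AE)
    also have "\<dots> \<le> liminf (\<lambda>m. \<integral>\<^sup>+w. \<Psi> m w \<partial>P)" by (rule nn_integral_liminf) (rule \<Psi>_meas)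
    also have "\<dots> \<le> liminf (\<lambda>m::nat. ennreal (2 * exp 2))"
      using \<Psi>_int by (intro Liminf_mono always_eventually allI)
    also have "\<dots> = ennreal (2 * exp 2)" by (simp add: Liminf_const)
    finally show "(\<integral>\<^sup>+w. ennreal (exp (((SUP t\<in>{0..T}. norm (X t w)) - norm x)\<^sup>2 / (D * exp (3 * T) * T powr H)\<^sup>2)) \<partial>P)
        \<le> ennreal (2 * exp 2)"
      by (simp add: \<tau>_def h_def)
  qed
qed

end

lemma vector_fields_bounded_lipschitz:
  fixes V :: "'d::finite \<Rightarrow> real^'n \<Rightarrow> real^'n"
  assumes "\<And>i. smooth_bounded (V i)"
  obtains A where "A \<ge> 1" "bounded_lipschitz_fields A V"
proof -
  have "\<forall>i. \<exists>a. (\<forall>p. norm (V i p) \<le> a) \<and> (\<forall>p q. norm (V i p - V i q) \<le> a * norm (p - q))"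
  proof
    fix i
    obtain a where "\<And>p. norm (V i p) \<le> a" "\<And>p q. norm (V i p - V i q) \<le> a * norm (p - q)"
      by (rule smooth_bounded_lipschitz[OF assms[of i]]) (rule that)
    then show "\<exists>a. (\<forall>p. norm (V i p) \<le> a) \<and> (\<forall>p q. norm (V i p - V i q) \<le> a * norm (p - q))"
      by blast
  qed
  from choice[OF this] obtain a where a: "\<And>i p. norm (V i p) \<le> a i" "\<And>i p q. norm (V i p - V i q) \<le> a i * norm (p - q)"
    by blast
  have a0: "a i \<ge> 0" for i using a(1)[of i undefined] norm_ge_zero order_trans by blast
  define A where "A = 1 + (\<Sum>i\<in>UNIV. a i)"
  have A: "A \<ge> 1" "(\<Sum>i\<in>UNIV. a i) \<le> A" unfolding A_def using a0 by (auto simp: sum_nonneg)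
  have "norm (\<Sum>i\<in>UNIV. u $ i *\<^sub>R V i p) \<le> A * norm u \<and>
    norm ((\<Sum>i\<in>UNIV. u $ i *\<^sub>R V i p) - (\<Sum>i\<in>UNIV. u $ i *\<^sub>R V i q)) \<le> A * norm (p - q) * norm u"
    for p q and u :: "real^'d"
  proof
    have "norm (\<Sum>i\<in>UNIV. u $ i *\<^sub>R V i p) \<le> (\<Sum>i\<in>UNIV. norm u * a i)"
      by (intro sum_norm_le) (auto intro!: mult_mono a component_le_norm_cart)
    also have "\<dots> = norm u * (\<Sum>i\<in>UNIV. a i)" by (rule sum_distrib_left[symmetric])
    also have "\<dots> \<le> norm u * A" using A(2) by (intro mult_left_mono) auto
    also have "\<dots> = A * norm u" by (rule mult.commute)
    finally show "norm (\<Sum>i\<in>UNIV. u $ i *\<^sub>R V i p) \<le> A * norm u" .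
    have "norm ((\<Sum>i\<in>UNIV. u $ i *\<^sub>R V i p) - (\<Sum>i\<in>UNIV. u $ i *\<^sub>R V i q))
        = norm (\<Sum>i\<in>UNIV. u $ i *\<^sub>R (V i p - V i q))"
      by (simp add: sum_subtractf scaleR_right_diff_distrib)
    also have "\<dots> \<le> (\<Sum>i\<in>UNIV. norm u * (a i * norm (p - q)))"
      by (intro sum_norm_le) (auto intro!: mult_mono a component_le_norm_cart)
    also have "\<dots> = (\<Sum>i\<in>UNIV. a i) * (norm (p - q) * norm u)"
      by (subst sum_distrib_right) (simp only: mult_ac)
    also have "\<dots> \<le> A * (norm (p - q) * norm u)" using A(2) by (intro mult_right_mono) auto
    finally show "norm ((\<Sum>i\<in>UNIV. u $ i *\<^sub>R V i p) - (\<Sum>i\<in>UNIV. u $ i *\<^sub>R V i q))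
        \<le> A * norm (p - q) * norm u" by (simp add: mult.assoc)
  qed
  then show ?thesis by (intro that[OF A(1)]) (simp add: bounded_lipschitz_fields_def)
qed

text \<open>Integrability is asserted along with the tail because the Bochner integral of a
  non-integrable function is 0 by convention. Likewise \<open>M > 0\<close> excludes the trivial
  bound that division by 0 would produce.\<close>

theorem proposition3p8:
  fixes P :: "'w measure"
    and H :: real
    and B X :: "real \<Rightarrow> 'w \<Rightarrow> real^'d"
    and V0 :: "real^'d \<Rightarrow> real^'d"
    and V :: "'d::finite \<Rightarrow> real^'d \<Rightarrow> real^'d"
    and x :: "real^'d"
  assumes "1/2 < H" and "H < 1"
    and "fractional_brownian_motion P H B"
    and "geometric_hypothesis V0 V"
    and "young_sde_solution P V0 V B x X"
  shows "(\<forall>T>0. integrable P (\<lambda>w. SUP t\<in>{0..T}. norm (X t w))) \<and>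
    (\<exists>(C::real) (M::real). M > 0 \<and>
      (\<forall>T>0. \<forall>l\<ge>0.
        measure P {w \<in> space P.
            (SUP t\<in>{0..T}. norm (X t w))
              - prob_space.expectation P (\<lambda>w. SUP t\<in>{0..T}. norm (X t w)) \<ge> l}
          \<le> exp (- (l\<^sup>2 / (2 * M\<^sup>2 * exp (2 * C * T) * T powr (2 * H))))))"
proof -
  interpret fractional_brownian P H B by standard (use assms in auto)
  have smooth: "smooth_bounded V0" "\<And>i. smooth_bounded (V i)"
    using assms(4) by (auto simp: geometric_hypothesis_def)
  obtain A0 where A0: "\<And>p. norm (V0 p) \<le> A0" "continuous_on UNIV V0"
    by (rule smooth_bounded_lipschitz[OF smooth(1)]) (rule that)
  obtain A where A: "A \<ge> 1" "bounded_lipschitz_fields A V"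
    by (rule vector_fields_bounded_lipschitz[of V, OF smooth(2)]) (rule that)
  obtain D where D: "D > 0" and moment: "\<And>T. T > 0 \<Longrightarrow>
    (\<integral>\<^sup>+w. ennreal (exp (((SUP t\<in>{0..T}. norm (X t w)) - norm x)\<^sup>2 / (D * exp (3 * T) * T powr H)\<^sup>2)) \<partial>P)
      \<le> ennreal (2 * exp 2)"
    by (rule running_sup_exponential_moment[OF assms(5) A0(2,1) A]) (rule that)
  define S where "S T w = (SUP t\<in>{0..T}. norm (X t w))" for T w
  \<comment> \<open>This is \<open>2 * (K * exp K) + 1\<close> for \<open>K = 2 * exp 2\<close>, the
    constant of the sub-Gaussian tail.\<close>
  define c where "c = 2 * (2 * exp 2 * exp (2 * exp 2)) + (1 :: real)"
  have c: "c > 0" by (simp add: c_def add_pos_pos)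
  \<comment> \<open>Chosen so that \<open>2 * M\<^sup>2 * exp (2 * 3 * T) * T powr (2 * H)\<close>
    equals \<open>4 * c * \<tau>\<^sup>2\<close>; the constant \<open>C\<close> is 3.\<close>
  define M where "M = D * sqrt (2 * c)"
  have tail: "integrable P (S T) \<and> (\<forall>l\<ge>0. prob {w\<in>space P. S T w - expectation (S T) \<ge> l}
      \<le> exp (- (l\<^sup>2 / (2 * M\<^sup>2 * exp (2 * 3 * T) * T powr (2 * H)))))" if T: "T > 0" for T
  proof -
    define \<tau> where "\<tau> = D * exp (3 * T) * T powr H"
    define Z where "Z w = S T w - norm x" for w
    have \<tau>: "\<tau> > 0" using D T by (simp add: \<tau>_def)
    have S_meas: "S T \<in> borel_measurable P" unfolding S_def[abs_def] using assms(5) T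
      by (intro running_sup_measurable) (auto simp: young_sde_solution_def)
    then have Z_meas: "Z \<in> borel_measurable P" unfolding Z_def[abs_def] by measurable
    have Z_moment: "(\<integral>\<^sup>+w. ennreal (exp ((Z w)\<^sup>2 / \<tau>\<^sup>2)) \<partial>P) \<le> ennreal (2 * exp 2)"
      unfolding Z_def S_def \<tau>_def by (rule moment[OF T])
    note Z_tail = subgaussian_centered_tail[OF Z_meas \<tau> Z_moment]
    have S_Z: "S T = (\<lambda>w. Z w + norm x)" by (simp add: Z_def fun_eq_iff)
    have int: "integrable P (S T)" unfolding S_Z using Z_tail(1) by simp
    have "expectation (S T) = expectation Z + norm x"
      unfolding S_Z using Z_tail(1) by (simp add: prob_space)
    then have diff: "S T w - expectation (S T) = Z w - expectation Z" for w by (simp add: Z_def)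
    have "4 * c * \<tau>\<^sup>2 = 2 * M\<^sup>2 * exp (2 * 3 * T) * T powr (2 * H)"
    proof -
      have "(exp (3 * T))\<^sup>2 = exp (2 * 3 * T)" by (simp add: exp_double[symmetric])
      moreover have "(T powr H)\<^sup>2 = T powr (2 * H)" by (simp add: power2_eq_square powr_add[symmetric])
      ultimately show ?thesis using c by (simp add: \<tau>_def M_def power_mult_distrib)
    qed
    then show ?thesis using int Z_tail(2) unfolding diff c_def by simp
  qed
  have "M > 0" using D c by (simp add: M_def)
  then show ?thesis
    using tail unfolding S_def[abs_def] by (intro conjI exI[of _ 3] exI[of _ M]) auto
qed

end
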